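(* Let $m,n\ge1$, $\mathfrak g=\mathfrak{gl}(m,n)$ and $\eta=\epsilon_1-\delta_n$. For $\lambda\in\mathfrak h^*$ let $\mathbb A(\lambda)$ be the $(m+n-1)\times(m+n-1)$ matrix whose $(i,j)$ entry is $e_{m+n+1-i,\,m+n-j}$ for $i\le j$, whose $(i+1,i)$ entry is $-B_{m+n-1-i}$ for $1\le i\le m+n-2$, and whose remaining entries are $0$, where $$B_i=\begin{cases} (\lambda+\rho,\epsilon_1-\epsilon_{i+1})-1,&1\le i\le m-1,\\ (\lambda+\rho,\delta_{i+1-m}-\delta_n),&m\le i\le m+n-2.\end{cases}$$ Then $$\overset{\longrightarrow}{\det}\ \mathbb A(\lambda)=\sum_{J\in\mathbb I}f_JH_J(\lambda).$$ Thus, if $(\lambda+\rho,\eta)=0$, then $\overset{\longrightarrow}{\det}\ \mathbb A(\lambda)$ is the evaluation at $\lambda$ of the Šapovalov element $\theta_\eta$ for the pair $(\eta,1)$.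
   Context: Ground field $\mathbb C$. $\mathfrak g=\mathfrak{gl}(m,n)$ has matrix units $e_{i,j}$, $1\le i,j\le m+n$, even iff $i,j$ are both $\le m$ or both $>m$. $\mathfrak h$ is the diagonal subalgebra; $\epsilon_i,\delta_j\in\mathfrak h^*$ are dual to $e_{i,i}$ ($i\le m$), $e_{m+j,m+j}$; $(\epsilon_i,\epsilon_j)=\delta_{ij}=-(\delta_i,\delta_j)$, $(\epsilon_i,\delta_j)=0$; $h_\alpha\in\mathfrak h$ satisfies $\beta(h_\alpha)=(\alpha,\beta)$ for all $\beta\in\mathfrak h^*$. The distinguished (upper triangular) Borel is used: $\mathfrak n^\pm$ strictly upper/lower triangular, $\mathfrak b^-=\mathfrak h\oplus\mathfrak n^-$, $\Delta^+$ the positive roots, $\Pi$ the simple roots, $\rho=\frac12\sum_{\Delta_0^+}\alpha-\frac12\sum_{\Delta_1^+}\alpha$ (even, odd positive roots). Noncommutative determinant of an $N\times N$ matrix: $\overset{\longrightarrow}{\det}(B)=\sum_{w\in S_N}\operatorname{sign}(w)\,b_{w(1),1}\cdots b_{w(N),N}$. $\mathbb I=\{I\subseteq\{1,\dots,m+n\}:1,m+n\in I\}$; for $I=\{i_0>i_1>\dots>i_{s+1}\}$, $f_I=e_{i_0,i_1}e_{i_1,i_2}\cdots e_{i_s,i_{s+1}}$. Put $$h_i=\begin{cases} h_{\sigma_i}+(\rho,\sigma_i)-1,\ \sigma_i=\epsilon_1-\epsilon_{i+1},&1\le i\le m-1,\\ h_{\tau}+(\rho,\tau),\ \tau=\delta_{i+1-m}-\delta_n,&m\le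 i\le m+n-2,\end{cases}$$ $r(I)=\{x-1:x\in\{1,\dots,m+n\}\setminus I\}$, $H_I=\prod_{i\in r(I)}h_i\in U(\mathfrak h)$. For $H\in U(\mathfrak h)=S(\mathfrak h)$, $H(\lambda)$ is its value as a polynomial function on $\mathfrak h^*$. Šapovalov element for $(\eta,1)$: an element $\theta\in U(\mathfrak b^-)$ of weight $-\eta$ of the form $\theta=\sum_\pi e_{-\pi}H_\pi$, $H_\pi\in U(\mathfrak h)$, where $\pi$ runs over partitions of $\eta$ (functions $\pi:\Delta^+\to\mathbb Z_{\ge0}$ with $\sum\pi(\alpha)\alpha=\eta$, $\pi(\alpha)\le1$ for $\alpha$ odd), $e_{-\pi}$ is the ordered product of the $e_{-\alpha}^{\pi(\alpha)}$ for a fixed order on $\Delta^+$, with $H_{\pi^0}=1$ for the partition $\pi^0$ vanishing off $\Pi$, and $e_\alpha\theta\in U(\mathfrak g)(h_\eta+\rho(h_\eta))+U(\mathfrak g)\mathfrak n^+$ for all $\alpha\in\Delta^+$. Its evaluation at $\lambda$ is $\theta(\lambda)=\sum_\pi e_{-\pi}H_\pi(\lambda)$, which for $(\lambda+\rho,\eta)=0$ does not depend on the choice of Šapovalov element. *)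

theory Defs
  imports
    Complex_Main
    "HOL-Library.Poly_Mapping"
    "HOL-Library.Function_Algebras"
    "HOL-Library.Cardinality"
    "HOL-Combinatorics.Permutations"
begin

section \<open>The free associative algebra on symbols $X_{i,j}$\<close>

datatype word = Word (letters: "(nat \<times> nat) list")

instantiation word :: monoid_add
begin

definition zero_word :: word where "0 = Word []"

definition plus_word :: "word \<Rightarrow> word \<Rightarrow> word" where
  "u + v = Word (letters u @ letters v)"

instance
  by standard (simp_all add: zero_word_def plus_word_def)

end

text \<open>Words form a monoid under concatenation (written additively because of the conventions of
  \<^theory>\<open>HOL-Library.Poly_Mapping\<close>); the free algebra is its monoid algebra.\<close>

type_synonym free_alg = "word \<Rightarrow>\<^sub>0 complex"

definition fgen :: "nat \<Rightarrow> nat \<Rightarrow> free_alg" where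
  "fgen i j = Poly_Mapping.single (Word [(i, j)]) 1"

definition fscal :: "complex \<Rightarrow> free_alg" where
  "fscal c = Poly_Mapping.single 0 c"


section \<open>The enveloping algebra of $\mathfrak{gl}(m,n)$\<close>

definition odd_unit :: "nat \<Rightarrow> nat \<Rightarrow> nat \<Rightarrow> bool" where
  "odd_unit m i j \<longleftrightarrow> (i \<le> m) \<noteq> (j \<le> m)"

definition ssign :: "nat \<Rightarrow> nat \<times> nat \<Rightarrow> nat \<times> nat \<Rightarrow> 'a::ring_1" where
  "ssign m a b = (if odd_unit m (fst a) (snd a) \<and> odd_unit m (fst b) (snd b) then -1 else 1)"

text \<open>The first family expresses
  $[e_{ij},e_{kl}] = \delta_{jk}e_{il}-(-1)^{|e_{ij}||e_{kl}|}\delta_{li}e_{kj}$ for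
  $1\le i,j,k,l\le m+n$. Generators are indexed by arbitrary pairs of natural numbers; the second
  family removes those that are not matrix units of $\mathfrak{gl}(m,n)$.\<close>

definition gl_relators :: "nat \<Rightarrow> nat \<Rightarrow> free_alg set" where
  "gl_relators m n =
     {fgen i j * fgen k l - ssign m (i, j) (k, l) * (fgen k l * fgen i j)
        - ((if j = k then fgen i l else 0)
           - ssign m (i, j) (k, l) * (if l = i then fgen k j else 0))
      | i j k l. {i, j, k, l} \<subseteq> {1..m+n}}
     \<union> {fgen i j | i j. \<not> {i, j} \<subseteq> {1..m+n}}"

inductive_set gl_ideal :: "nat \<Rightarrow> nat \<Rightarrow> free_alg set" for m n where
  zero: "0 \<in> gl_ideal m n"
| add: "x \<in> gl_ideal m n \<Longrightarrow> y \<in> gl_ideal m n \<Longrightarrow> x + y \<in> gl_ideal m n"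
| gen: "r \<in> gl_relators m n \<Longrightarrow> a * r * b \<in> gl_ideal m n"

lemma gl_ideal_mult_left: "x \<in> gl_ideal m n \<Longrightarrow> c * x \<in> gl_ideal m n"
proof (induction rule: gl_ideal.induct)
  case (gen r a b)
  then show ?case using gl_ideal.gen[of r m n "c * a" b] by (simp add: mult.assoc)
qed (auto simp: distrib_left intro: gl_ideal.intros)

lemma gl_ideal_mult_right: "x \<in> gl_ideal m n \<Longrightarrow> x * c \<in> gl_ideal m n"
proof (induction rule: gl_ideal.induct)
  case (gen r a b)
  then show ?case using gl_ideal.gen[of r m n a "b * c"] by (simp add: mult.assoc)
qed (auto simp: distrib_right intro: gl_ideal.intros)

lemma gl_ideal_uminus: "x \<in> gl_ideal m n \<Longrightarrow> - x \<in> gl_ideal m n"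
  using gl_ideal_mult_left[of x m n "-1"] by simp

lemma gl_ideal_diff: "x \<in> gl_ideal m n \<Longrightarrow> y \<in> gl_ideal m n \<Longrightarrow> x - y \<in> gl_ideal m n"
  using gl_ideal.add[of x m n "- y"] gl_ideal_uminus[of y m n] by simp

text \<open>$U(\mathfrak{gl}(m,n))$ with $m$, $n$ the cardinalities of the two type parameters.\<close>

quotient_type (overloaded) ('m, 'n) Ugl = free_alg /
  "\<lambda>x y. x - y \<in> gl_ideal CARD('m::finite) CARD('n::finite)"
proof (rule equivpI)
  show "reflp (\<lambda>x y. x - y \<in> gl_ideal CARD('m) CARD('n))"
    by (auto simp: reflp_def intro: gl_ideal.zero)
  show "symp (\<lambda>x y. x - y \<in> gl_ideal CARD('m) CARD('n))"
    by (rule sympI) (use gl_ideal_uminus in fastforce)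
  show "transp (\<lambda>x y. x - y \<in> gl_ideal CARD('m) CARD('n))"
  proof (rule transpI)
    fix x y z :: free_alg
    assume "x - y \<in> gl_ideal CARD('m) CARD('n)" "y - z \<in> gl_ideal CARD('m) CARD('n)"
    from gl_ideal.add[OF this] show "x - z \<in> gl_ideal CARD('m) CARD('n)" by simp
  qed
qed

instantiation Ugl :: (finite, finite) ring_1
begin

lift_definition zero_Ugl :: "('a, 'b) Ugl" is 0 .
lift_definition one_Ugl :: "('a, 'b) Ugl" is 1 .
lift_definition plus_Ugl :: "('a, 'b) Ugl \<Rightarrow> ('a, 'b) Ugl \<Rightarrow> ('a, 'b) Ugl" is "(+)"
  by (simp add: add_diff_add gl_ideal.add)
lift_definition uminus_Ugl :: "('a, 'b) Ugl \<Rightarrow> ('a, 'b) Ugl" is uminus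
  by (simp only: minus_diff_minus gl_ideal_uminus)
lift_definition minus_Ugl :: "('a, 'b) Ugl \<Rightarrow> ('a, 'b) Ugl \<Rightarrow> ('a, 'b) Ugl" is "(-)"
proof -
  fix a b c d :: free_alg
  assume "a - b \<in> gl_ideal CARD('a) CARD('b)" "c - d \<in> gl_ideal CARD('a) CARD('b)"
  then have "(a - b) - (c - d) \<in> gl_ideal CARD('a) CARD('b)" by (rule gl_ideal_diff)
  then show "(a - c) - (b - d) \<in> gl_ideal CARD('a) CARD('b)" by (simp add: algebra_simps)
qed
lift_definition times_Ugl :: "('a, 'b) Ugl \<Rightarrow> ('a, 'b) Ugl \<Rightarrow> ('a, 'b) Ugl" is "(*)"
proof -
  fix a b c d :: free_alg
  assume "a - b \<in> gl_ideal CARD('a) CARD('b)" "c - d \<in> gl_ideal CARD('a) CARD('b)"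
  then have "(a - b) * c + b * (c - d) \<in> gl_ideal CARD('a) CARD('b)"
    by (intro gl_ideal.add gl_ideal_mult_left gl_ideal_mult_right)
  then show "a * c - b * d \<in> gl_ideal CARD('a) CARD('b)" by (simp add: algebra_simps)
qed

lemma one_notin_gl_ideal: "(1 :: free_alg) \<notin> gl_ideal m n"
proof
  text \<open>The augmentation (constant coefficient) vanishes on the ideal.\<close>
  have word_sum_zero: "u + v = 0 \<longleftrightarrow> u = 0 \<and> v = 0" for u v :: word
    by (cases u; cases v) (auto simp: plus_word_def zero_word_def)
  have aug: "Poly_Mapping.lookup (x * y) 0 = Poly_Mapping.lookup x 0 * Poly_Mapping.lookup y 0" for x y :: free_alg
  proof -
    have "Poly_Mapping.lookup (x * y) 0 = (\<Sum>l. Poly_Mapping.lookup x l * (\<Sum>q. Poly_Mapping.lookup y q when l = 0 \<and> q = 0))"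
      by (simp add: times_poly_mapping.rep_eq prod_fun_def word_sum_zero eq_commute[of 0])
    also have "\<dots> = (\<Sum>l. Poly_Mapping.lookup x l * Poly_Mapping.lookup y 0 when l = 0)"
      by (intro Sum_any.cong) (auto simp: when_def)
    finally show ?thesis by simp
  qed
  have g: "Poly_Mapping.lookup (fgen i j) 0 = 0" for i j
    by (simp add: fgen_def lookup_single zero_word_def when_def)
  have r: "Poly_Mapping.lookup r 0 = 0" if "r \<in> gl_relators m n" for r
    using that by (auto simp: gl_relators_def lookup_minus aug g)
  have "Poly_Mapping.lookup x 0 = 0" if "x \<in> gl_ideal m n" for x
    using that by induction (auto simp: lookup_add aug r)
  moreover assume "(1 :: free_alg) \<in> gl_ideal m n"
  ultimately have "Poly_Mapping.lookup (1 :: free_alg) 0 = 0" by blast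
  then show False by (simp add: lookup_one)
qed

instance
proof
  fix a b c :: "('a, 'b) Ugl"
  show "a + b + c = a + (b + c)" by transfer (simp add: gl_ideal.zero add.assoc)
  show "a + b = b + a" by transfer (simp add: gl_ideal.zero add.commute)
  show "0 + a = a" by transfer (simp add: gl_ideal.zero)
  show "- a + a = 0" by transfer (simp add: gl_ideal.zero)
  show "a - b = a + - b" by transfer (simp add: gl_ideal.zero)
  show "a * b * c = a * (b * c)" by transfer (simp add: gl_ideal.zero mult.assoc)
  show "1 * a = a" by transfer (simp add: gl_ideal.zero)
  show "a * 1 = a" by transfer (simp add: gl_ideal.zero)
  show "(a + b) * c = a * c + b * c" by transfer (simp add: gl_ideal.zero distrib_right)
  show "a * (b + c) = a * b + a * c" by transfer (simp add: gl_ideal.zero distrib_left)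
  show "(0 :: ('a, 'b) Ugl) \<noteq> 1"
  proof transfer
    show "(0 :: free_alg) - 1 \<notin> gl_ideal CARD('a) CARD('b)"
      using gl_ideal_uminus[of "0 - 1 :: free_alg" "CARD('a)" "CARD('b)"]
        one_notin_gl_ideal[of "CARD('a)" "CARD('b)"] by auto
  qed
qed

end

text \<open>There is no class of complex algebras in the library: scalars are the elements \<open>scal c\<close>.\<close>

lift_definition e :: "nat \<Rightarrow> nat \<Rightarrow> ('m::finite, 'n::finite) Ugl" is fgen .

lift_definition scal :: "complex \<Rightarrow> ('m::finite, 'n::finite) Ugl" is fscal .

lemma e_supercommutator:
  assumes "{i, j, k, l} \<subseteq> {1..CARD('m) + CARD('n)}"
  defines "s \<equiv> ssign CARD('m) (i, j) (k, l)"
  shows "e i j * e k l - s * (e k l * e i j)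
       = (if j = k then e i l else 0) - s * (if l = i then e k j else (0 :: ('m::finite, 'n::finite) Ugl))"
proof -
  let ?t = "ssign CARD('m) (i, j) (k, l) :: free_alg"
  let ?abs = "abs_Ugl :: free_alg \<Rightarrow> ('m, 'n) Ugl"
  let ?R = "fgen i j * fgen k l - ?t * (fgen k l * fgen i j)
        - ((if j = k then fgen i l else 0) - ?t * (if l = i then fgen k j else 0))"
  have "?R \<in> gl_relators CARD('m) CARD('n)"
    using assms(1) unfolding gl_relators_def by blast
  from gl_ideal.gen[OF this, of 1 1] have "?abs ?R = 0"
    unfolding zero_Ugl_def by (simp add: Ugl.abs_eq_iff)
  moreover have "?abs ?t = s"
    unfolding s_def ssign_def
    by (simp add: one_Ugl_def uminus_Ugl.abs_eq)
  moreover have "?abs (if P then x else 0) = (if P then ?abs x else 0)" for P x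
    by (simp add: zero_Ugl_def)
  ultimately show ?thesis
    by (simp only: minus_Ugl.abs_eq[symmetric] times_Ugl.abs_eq[symmetric] e.abs_eq[symmetric]
        right_minus_eq)
qed


section \<open>Weights\<close>

text \<open>A weight $\lambda\in\mathfrak h^*$ is given by its values $\lambda(e_{i,i})$,
  $1\le i\le m+n$; values at other indices play no role. Thus \<open>wt i\<close> is $\epsilon_i$ for
  $i\le m$ and $\delta_{i-m}$ for $i>m$.\<close>

type_synonym weight = "nat \<Rightarrow> complex"

definition wt :: "nat \<Rightarrow> weight" where
  "wt i = (\<lambda>k. if k = i then 1 else 0)"

definition eps :: "nat \<Rightarrow> weight" where
  "eps i = wt i"

definition del :: "nat \<Rightarrow> nat \<Rightarrow> weight" where
  "del m j = wt (m + j)"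

definition form :: "nat \<Rightarrow> nat \<Rightarrow> weight \<Rightarrow> weight \<Rightarrow> complex" where
  "form m n \<alpha> \<beta> = (\<Sum>i=1..m. \<alpha> i * \<beta> i) - (\<Sum>i=m+1..m+n. \<alpha> i * \<beta> i)"

text \<open>Positive roots are indexed by the positions \<open>(i, j)\<close>, \<open>i < j\<close>, of their root vectors.\<close>

definition pos_roots :: "nat \<Rightarrow> nat \<Rightarrow> (nat \<times> nat) set" where
  "pos_roots m n = {(i, j). 1 \<le> i \<and> i < j \<and> j \<le> m + n}"

definition simple_roots :: "nat \<Rightarrow> nat \<Rightarrow> (nat \<times> nat) set" where
  "simple_roots m n = {(i, i + 1) | i. 1 \<le> i \<and> i + 1 \<le> m + n}"

definition root :: "nat \<times> nat \<Rightarrow> weight" where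
  "root a = wt (fst a) - wt (snd a)"

definition odd_root :: "nat \<Rightarrow> nat \<times> nat \<Rightarrow> bool" where
  "odd_root m a \<longleftrightarrow> odd_unit m (fst a) (snd a)"

definition rho :: "nat \<Rightarrow> nat \<Rightarrow> weight" where
  "rho m n = (\<lambda>k. 1/2 * (\<Sum>a | a \<in> pos_roots m n \<and> \<not> odd_root m a. root a k)
                - 1/2 * (\<Sum>a | a \<in> pos_roots m n \<and> odd_root m a. root a k))"

definition eta :: "nat \<Rightarrow> nat \<Rightarrow> weight" where
  "eta m n = eps 1 - del m n"


section \<open>$U(\mathfrak h)=S(\mathfrak h)$\<close>

text \<open>Elements of $S(\mathfrak h)$ are polynomials in $X_1,\dots,X_{m+n}$, where $X_i$ stands for
  $e_{i,i}$. Substituting $x_i$ for $X_i$, with coefficients mapped by \<open>c\<close>, gives both the evaluation at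
  a weight and the embedding into $U(\mathfrak g)$, in which the $e_{i,i}$ commute.\<close>

type_synonym hpoly = "(nat \<Rightarrow>\<^sub>0 nat) \<Rightarrow>\<^sub>0 complex"

definition S_h :: "nat \<Rightarrow> nat \<Rightarrow> hpoly set" where
  "S_h m n = {P. \<forall>k \<in> Poly_Mapping.keys P. Poly_Mapping.keys k \<subseteq> {1..m+n}}"

definition hX :: "nat \<Rightarrow> hpoly" where
  "hX i = Poly_Mapping.single (Poly_Mapping.single i 1) 1"

definition hC :: "complex \<Rightarrow> hpoly" where
  "hC c = Poly_Mapping.single 0 c"

definition hsubst :: "nat \<Rightarrow> (complex \<Rightarrow> 'a::ring_1) \<Rightarrow> (nat \<Rightarrow> 'a) \<Rightarrow> hpoly \<Rightarrow> 'a" where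
  "hsubst N c x P = (\<Sum>k \<in> Poly_Mapping.keys P.
     c (Poly_Mapping.lookup P k) * prod_list (map (\<lambda>i. x i ^ Poly_Mapping.lookup k i) [1..<N+1]))"

definition heval :: "nat \<Rightarrow> nat \<Rightarrow> hpoly \<Rightarrow> weight \<Rightarrow> complex" where
  "heval m n P l = hsubst (m + n) id l P"

definition hembed :: "hpoly \<Rightarrow> ('m::finite, 'n::finite) Ugl" where
  "hembed P = hsubst (CARD('m) + CARD('n)) scal (\<lambda>i. e i i) P"

text \<open>The element $h_\alpha\in\mathfrak h$ determined by $\beta(h_\alpha)=(\alpha,\beta)$ for all
  $\beta\in\mathfrak h^*$.\<close>

definition h_elt :: "nat \<Rightarrow> nat \<Rightarrow> weight \<Rightarrow> hpoly" where
  "h_elt m n \<alpha> = (\<Sum>i=1..m. hC (\<alpha> i) * hX i) - (\<Sum>i=m+1..m+n. hC (\<alpha> i) * hX i)"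

definition h_poly :: "nat \<Rightarrow> nat \<Rightarrow> nat \<Rightarrow> hpoly" where
  "h_poly m n i =
     (if i \<le> m - 1
      then h_elt m n (eps 1 - eps (i + 1)) + hC (form m n (rho m n) (eps 1 - eps (i + 1))) - 1
      else h_elt m n (del m (i + 1 - m) - del m n)
             + hC (form m n (rho m n) (del m (i + 1 - m) - del m n)))"

definition II :: "nat \<Rightarrow> nat \<Rightarrow> nat set set" where
  "II m n = {I. I \<subseteq> {1..m+n} \<and> 1 \<in> I \<and> m + n \<in> I}"

definition r_set :: "nat \<Rightarrow> nat \<Rightarrow> nat set \<Rightarrow> nat set" where
  "r_set m n I = (\<lambda>x. x - 1) ` ({1..m+n} - I)"

definition H_poly :: "nat \<Rightarrow> nat \<Rightarrow> nat set \<Rightarrow> hpoly" where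
  "H_poly m n I = (\<Prod>i \<in> r_set m n I. h_poly m n i)"

definition f_elt :: "nat set \<Rightarrow> ('m::finite, 'n::finite) Ugl" where
  "f_elt I = (let xs = rev (sorted_list_of_set I) in prod_list (map2 e xs (tl xs)))"


section \<open>The determinant\<close>

definition ncdet :: "nat \<Rightarrow> (nat \<Rightarrow> nat \<Rightarrow> 'a::ring_1) \<Rightarrow> 'a" where
  "ncdet N B = (\<Sum>w | w permutes {1..N}.
     of_int (sign w) * prod_list (map (\<lambda>k. B (w k) k) [1..<N+1]))"

definition Bcoef :: "nat \<Rightarrow> nat \<Rightarrow> weight \<Rightarrow> nat \<Rightarrow> complex" where
  "Bcoef m n l i =
     (if i \<le> m - 1 then form m n (l + rho m n) (eps 1 - eps (i + 1)) - 1
      else form m n (l + rho m n) (del m (i + 1 - m) - del m n))"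

definition Amat :: "weight \<Rightarrow> nat \<Rightarrow> nat \<Rightarrow> ('m::finite, 'n::finite) Ugl" where
  "Amat l i j = (let m = CARD('m); n = CARD('n) in
     if i \<le> j then e (m + n + 1 - i) (m + n - j)
     else if i = j + 1 then - scal (Bcoef m n l (m + n - 1 - j))
     else 0)"


section \<open>Sapovalov elements\<close>

definition partitions :: "nat \<Rightarrow> nat \<Rightarrow> weight \<Rightarrow> (nat \<times> nat \<Rightarrow> nat) set" where
  "partitions m n \<gamma> = {p. (\<forall>a. a \<notin> pos_roots m n \<longrightarrow> p a = 0)
     \<and> (\<forall>a \<in> pos_roots m n. odd_root m a \<longrightarrow> p a \<le> 1)
     \<and> (\<lambda>k. \<Sum>a \<in> pos_roots m n. of_nat (p a) * root a k) = \<gamma>}"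

text \<open>The fixed order on the positive roots is given by a list \<open>os\<close> enumerating them.\<close>

definition e_neg :: "(nat \<times> nat) list \<Rightarrow> (nat \<times> nat \<Rightarrow> nat) \<Rightarrow> ('m::finite, 'n::finite) Ugl" where
  "e_neg os p = prod_list (map (\<lambda>a. e (snd a) (fst a) ^ p a) os)"

inductive_set U_b_minus :: "('m::finite, 'n::finite) Ugl set" where
  scal: "scal c \<in> U_b_minus"
| gen: "j \<le> i \<Longrightarrow> e i j \<in> U_b_minus"
| add: "x \<in> U_b_minus \<Longrightarrow> y \<in> U_b_minus \<Longrightarrow> x + y \<in> U_b_minus"
| mult: "x \<in> U_b_minus \<Longrightarrow> y \<in> U_b_minus \<Longrightarrow> x * y \<in> U_b_minus"

definition has_weight :: "('m::finite, 'n::finite) Ugl \<Rightarrow> weight \<Rightarrow> bool" where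
  "has_weight x \<mu> \<longleftrightarrow>
     (\<forall>i \<in> {1..CARD('m) + CARD('n)}. e i i * x - x * e i i = scal (\<mu> i) * x)"

text \<open>The left ideal $U(\mathfrak g)\mathfrak n^+$.\<close>

definition U_n_plus :: "('m::finite, 'n::finite) Ugl set" where
  "U_n_plus = {\<Sum>a \<in> pos_roots CARD('m) CARD('n). y a * e (fst a) (snd a) | y. True}"

definition sapovalov_sum ::
  "(nat \<times> nat) list \<Rightarrow> weight \<Rightarrow> ((nat \<times> nat \<Rightarrow> nat) \<Rightarrow> hpoly) \<Rightarrow> ('m::finite, 'n::finite) Ugl" where
  "sapovalov_sum os \<gamma> H = (\<Sum>p \<in> partitions CARD('m) CARD('n) \<gamma>. e_neg os p * hembed (H p))"

text \<open>\<open>sapovalov os \<gamma> H \<theta>\<close>: \<open>\<theta>\<close> is a Sapovalov element for the pair $(\gamma,1)$ with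
  coefficients \<open>H\<close>.\<close>

definition sapovalov ::
  "(nat \<times> nat) list \<Rightarrow> weight \<Rightarrow> ((nat \<times> nat \<Rightarrow> nat) \<Rightarrow> hpoly) \<Rightarrow> ('m::finite, 'n::finite) Ugl \<Rightarrow> bool" where
  "sapovalov os \<gamma> H \<theta> \<longleftrightarrow> (let m = CARD('m); n = CARD('n) in
     \<theta> \<in> U_b_minus \<and> has_weight \<theta> (- \<gamma>) \<and>
     (\<forall>p \<in> partitions m n \<gamma>. H p \<in> S_h m n) \<and>
     \<theta> = sapovalov_sum os \<gamma> H \<and>
     (\<forall>p \<in> partitions m n \<gamma>. (\<forall>a. a \<notin> simple_roots m n \<longrightarrow> p a = 0) \<longrightarrow> H p = 1) \<and>
     (\<forall>a \<in> pos_roots m n. \<exists>x. \<exists>y \<in> U_n_plus.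
        e (fst a) (snd a) * \<theta>
          = x * (hembed (h_elt m n \<gamma>) + scal (heval m n (h_elt m n \<gamma>) (rho m n))) + y))"

definition sapovalov_eval ::
  "(nat \<times> nat) list \<Rightarrow> weight \<Rightarrow> ((nat \<times> nat \<Rightarrow> nat) \<Rightarrow> hpoly) \<Rightarrow> weight \<Rightarrow> ('m::finite, 'n::finite) Ugl" where
  "sapovalov_eval os \<gamma> H l = (\<Sum>p \<in> partitions CARD('m) CARD('n) \<gamma>.
     e_neg os p * scal (heval CARD('m) CARD('n) (H p) l))"

end

theory Submission
  imports Defs "HOL-Library.Nat_Bijection"
begin

text \<open>Expanding along the first column shows that the determinants of the trailing blocks, with their
  first row replaced by the row starting with $e_{t,u}$, satisfy
  $G(t,u)=e_{t,u}G(u,u-1)+B_{u-1}G(t,u-1)$, and splitting according to whether $u\in J$ gives the same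
  recursion for the sum over $J$.

  All simple roots have multiplicity one in $\eta$. Hence the partitions of $\eta$ correspond to the
  sets $J\in\mathbb I$, and $e_{-\pi}$ is the matching $f_J$ up to terms $f_K$ with $K\subset J$. Modulo
  $U(\mathfrak g)e_{i,i+1}$, the product $e_{i,i+1}f_J$ is a coefficient times a product of two paths,
  from $m+n$ to $i+1$ and from $i$ to $1$, which depends only on $J\cup\{i,i+1\}$. So
  $\sum_J f_Jc_J$ is singular iff the $c_J$ satisfy a recurrence; the products $H_J$ solve it modulo
  $h_\eta+\rho(h_\eta)$, and it determines all $c_J$ from $c_{\{1,\dots,m+n\}}$.

  Reading off the recurrence needs the independence of the products of two paths on a highest
  weight vector of weight $\lambda$. Instead of the PBW theorem, an explicit highest weight module is
  used: inducing from $\mathfrak{gl}$ of one size smaller, one index at a time, realizes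
  $U(\mathfrak g)$ by creation and annihilation operators, and a path acts on the vacuum as a
  product of distinct creation operators.\<close>

section \<open>Homomorphisms out of a monoid algebra\<close>

text \<open>Both sides are expanded in the f_J with scalar coefficients, and the two coefficient
  families are compared. Coefficients stand to the right of f_J, so on a highest weight vector of
  weight \<lambda> an element of U(h) acts by its value at \<lambda>; this turns a statement on
  \<theta> into one on \<theta>(\<lambda>). The recurrence determines the c_J for every \<lambda>,
  not just a generic one: in the equation for i and T the unknown c_{T - {i+1}} has coefficient 1 or
  -1, and the equations with i+1 < m+n are enough to reach every J. The shape of the h_i comes from
  the same recurrence. Away from i = m, h_{i-1} and h_i involve the same end \<epsilon>_1 or
  \<delta>_n and cancel against the Cartan element of the simple root. At i = m the two families
  meet and the remainder is h_\<eta> + \<rho>(h_\<eta>), so only there do the H_J need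
  (\<lambda>+\<rho>,\<eta>) = 0.\<close>

lemma poly_mapping_single_induct [case_names single add]:
  fixes P :: "'k \<Rightarrow>\<^sub>0 'b::comm_monoid_add"
  assumes single: "\<And>k a. Q (Poly_Mapping.single k a)"
    and add: "\<And>P R. Q P \<Longrightarrow> Q R \<Longrightarrow> Q (P + R)"
  shows "Q P"
proof -
  have "Q (\<Sum>k\<in>K. Poly_Mapping.single k (Poly_Mapping.lookup P k))" if "finite K" for K
    using that
  proof (induction K)
    case empty
    then show ?case using single[of undefined 0] by simp
  next
    case (insert k K)
    then show ?case by (simp add: add single)
  qed
  moreover have "P = (\<Sum>k\<in>Poly_Mapping.keys P. Poly_Mapping.single k (Poly_Mapping.lookup P k))"
    by (rule poly_mapping_eqI) (auto simp: lookup_sum lookup_single when_def in_keys_iff sum.delta)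
  ultimately show ?thesis by (metis finite_keys)
qed

text \<open>The universal property of a complex monoid algebra with values in a possibly
  noncommutative ring: \<open>c\<close> carries the scalars, \<open>f\<close> the monoid, and these
  two have to commute. Exponent functions give polynomials on the Cartan subalgebra, words give the
  free algebra.\<close>

locale monoid_algebra_hom =
  fixes c :: "complex \<Rightarrow> 'a::ring_1" and f :: "'k::monoid_add \<Rightarrow> 'a"
  assumes c_add: "c (a + b) = c a + c b"
    and c_mult: "c (a * b) = c a * c b"
    and c_one: "c 1 = 1"
    and c_comm: "c a * f k = f k * c a"
    and f_zero: "f 0 = 1"
    and f_add: "f (k + l) = f k * f l"
begin

lemma c_zero: "c 0 = 0"
  using c_add[of 0 0] by simp

definition ext :: "('k \<Rightarrow>\<^sub>0 complex) \<Rightarrow> 'a" where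
  "ext P = (\<Sum>k\<in>Poly_Mapping.keys P. c (Poly_Mapping.lookup P k) * f k)"

text \<open>Keys may cancel in a sum, so additivity is proved over a common finite superset of the
  supports.\<close>

lemma ext_superset:
  assumes "finite K" "Poly_Mapping.keys P \<subseteq> K"
  shows "ext P = (\<Sum>k\<in>K. c (Poly_Mapping.lookup P k) * f k)"
  unfolding ext_def
  by (rule sum.mono_neutral_left) (use assms in \<open>auto simp: in_keys_iff c_zero\<close>)

lemma ext_add: "ext (P + R) = ext P + ext R"
proof -
  let ?K = "Poly_Mapping.keys P \<union> Poly_Mapping.keys R"
  have "ext (P + R) = (\<Sum>k\<in>?K. c (Poly_Mapping.lookup (P + R) k) * f k)"
    by (rule ext_superset) (auto simp: keys_add)
  also have "\<dots> = (\<Sum>k\<in>?K. c (Poly_Mapping.lookup P k) * f k) + (\<Sum>k\<in>?K. c (Poly_Mapping.lookup R k) * f k)"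
    by (simp add: lookup_add c_add distrib_right sum.distrib)
  also have "\<dots> = ext P + ext R"
    by (simp add: ext_superset[of ?K])
  finally show ?thesis .
qed

lemma ext_single: "ext (Poly_Mapping.single k a) = c a * f k"
  by (simp add: ext_superset[of "{k}"])

lemma ext_zero: "ext 0 = 0"
  by (simp add: ext_def)

lemma ext_one: "ext 1 = 1"
  using ext_single[of 0 1] by (simp add: c_one f_zero)

lemma ext_uminus: "ext (- P) = - ext P"
  using ext_add[of P "- P"] by (simp add: ext_zero eq_neg_iff_add_eq_0 add.commute)

lemma ext_diff: "ext (P - R) = ext P - ext R"
  using ext_add[of P "- R"] by (simp add: ext_uminus)

lemma ext_sum: "ext (sum g A) = (\<Sum>x\<in>A. ext (g x))"
  by (induction A rule: infinite_finite_induct) (auto simp: ext_zero ext_add)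

lemma ext_mult: "ext (P * R) = ext P * ext R"
proof (induction P rule: poly_mapping_single_induct)
  case (single k a)
  show ?case
  proof (induction R rule: poly_mapping_single_induct)
    case (single l b)
    have "ext (Poly_Mapping.single k a * Poly_Mapping.single l b) = c a * (c b * f k) * f l"
      by (simp add: mult_single ext_single c_mult f_add mult.assoc)
    also have "\<dots> = ext (Poly_Mapping.single k a) * ext (Poly_Mapping.single l b)"
      unfolding c_comm by (simp add: ext_single mult.assoc)
    finally show ?case .
  qed (simp add: ext_add distrib_left)
qed (simp add: ext_add distrib_right)

end

section \<open>Polynomials on the Cartan subalgebra\<close>

lemma prod_list_map_mult_commuting:
  fixes f g :: "nat \<Rightarrow> 'a::monoid_mult"
  assumes "\<And>i j. i \<in> set xs \<Longrightarrow> j \<in> set xs \<Longrightarrow> f i * g j = g j * f i"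
  shows "prod_list (map (\<lambda>i. f i * g i) xs) = prod_list (map f xs) * prod_list (map g xs)"
  using assms
proof (induction xs)
  case (Cons x xs)
  note comm = Cons.prems
  have "prod_list (map f is) * g x = g x * prod_list (map f is)" if "set is \<subseteq> set xs" for "is"
    using that
  proof (induction "is")
    case (Cons i "is")
    then have "f i * g x = g x * f i" by (auto intro: comm)
    with Cons show ?case by (simp add: mult.assoc) (simp add: mult.assoc[symmetric])
  qed simp
  from this[of xs] have 1: "prod_list (map f xs) * g x = g x * prod_list (map f xs)" by simp
  have 2: "prod_list (map (\<lambda>i. f i * g i) xs) = prod_list (map f xs) * prod_list (map g xs)"
    using Cons by auto
  have "prod_list (map (\<lambda>i. f i * g i) (x # xs)) = f x * (g x * prod_list (map f xs)) * prod_list (map g xs)"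
    by (simp add: 2 mult.assoc)
  also have "\<dots> = prod_list (map f (x # xs)) * prod_list (map g (x # xs))"
    unfolding 1[symmetric] by (simp add: mult.assoc)
  finally show ?case .
qed simp

lemma power_commuting_powers:
  fixes x y :: "'a::monoid_mult"
  assumes "x * y = y * x"
  shows "x ^ a * y ^ b = y ^ b * x ^ a"
  by (rule power_commuting_commutes) (rule power_commuting_commutes[OF assms[symmetric], symmetric])

text \<open>\<open>hsubst\<close> writes every monomial in increasing index order, so it respects
  products only when the substituted elements commute; this is the purpose of
  \<open>x_x\<close>.\<close>

locale hsubst_hom =
  fixes N :: nat and c :: "complex \<Rightarrow> 'a::ring_1" and x :: "nat \<Rightarrow> 'a"
  assumes coeff_add: "c (a + b) = c a + c b"
    and coeff_mult: "c (a * b) = c a * c b"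
    and coeff_one: "c 1 = 1"
    and c_x: "i \<in> {1..N} \<Longrightarrow> c a * x i = x i * c a"
    and x_x: "i \<in> {1..N} \<Longrightarrow> j \<in> {1..N} \<Longrightarrow> x i * x j = x j * x i"
begin

definition mon :: "(nat \<Rightarrow>\<^sub>0 nat) \<Rightarrow> 'a" where
  "mon k = prod_list (map (\<lambda>i. x i ^ Poly_Mapping.lookup k i) [1..<N+1])"

lemma mon_add: "mon (k + l) = mon k * mon l"
  unfolding mon_def lookup_add power_add
  by (rule prod_list_map_mult_commuting) (auto intro!: power_commuting_powers x_x)

lemma commute_mon:
  assumes "\<And>i. i \<in> {1..N} \<Longrightarrow> y * x i = x i * y"
  shows "y * mon k = mon k * y"
proof -
  have "y * prod_list (map (\<lambda>i. x i ^ Poly_Mapping.lookup k i) is) = prod_list (map (\<lambda>i. x i ^ Poly_Mapping.lookup k i) is) * y"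
    if "set is \<subseteq> {1..N}" for "is"
    using that
  proof (induction "is")
    case (Cons i "is")
    have "y * x i ^ Poly_Mapping.lookup k i = x i ^ Poly_Mapping.lookup k i * y"
      by (rule power_commuting_commutes[symmetric]) (use assms[of i] Cons.prems in auto)
    with Cons show ?case by (simp add: mult.assoc[symmetric]) (simp add: mult.assoc)
  qed simp
  from this[of "[1..<N+1]"] show ?thesis
    unfolding mon_def by (simp add: atLeastLessThanSuc_atLeastAtMost del: upt_Suc)
qed

sublocale monoid_algebra_hom c mon
proof
  show "c a * mon k = mon k * c a" for a k
    by (rule commute_mon) (rule c_x)
  show "mon 0 = 1" unfolding mon_def by (simp add: map_replicate_const)
qed (auto simp: coeff_add coeff_mult coeff_one mon_add)

lemma hsubst_eq_ext: "hsubst N c x P = ext P"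
  unfolding hsubst_def ext_def mon_def by simp

lemma hsubst_add: "hsubst N c x (P + R) = hsubst N c x P + hsubst N c x R"
  and hsubst_mult: "hsubst N c x (P * R) = hsubst N c x P * hsubst N c x R"
  and hsubst_diff: "hsubst N c x (P - R) = hsubst N c x P - hsubst N c x R"
  and hsubst_uminus: "hsubst N c x (- P) = - hsubst N c x P"
  and hsubst_one: "hsubst N c x 1 = 1"
  and hsubst_zero: "hsubst N c x 0 = 0"
  and hsubst_sum: "hsubst N c x (sum g A) = (\<Sum>a\<in>A. hsubst N c x (g a))"
  by (simp_all add: hsubst_eq_ext ext_add ext_mult ext_diff ext_uminus ext_one ext_zero ext_sum)

lemma hsubst_hC: "hsubst N c x (hC a) = c a"
  by (simp add: hsubst_eq_ext hC_def ext_single f_zero)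

lemma hsubst_hX:
  assumes "i \<in> {1..N}"
  shows "hsubst N c x (hX i) = x i"
proof -
  have "prod_list (map (\<lambda>j. x j ^ (if i = j then Suc 0 else 0)) is) = (if i \<in> set is then x i else 1)"
    if "distinct is" for "is"
    using that by (induction "is") auto
  from this[of "[1..<N+1]"] show ?thesis
    using assms by (simp add: hsubst_eq_ext hX_def ext_single c_one mon_def lookup_single when_def del: upt_Suc)
qed

end

interpretation heval: hsubst_hom "m + n" id "l :: weight" for m n l
  by unfold_locales auto

section \<open>Scalars and Cartan elements in the enveloping algebra\<close>

lemma scal_zero: "scal 0 = (0 :: ('m::finite, 'n::finite) Ugl)"
  by transfer (simp add: fscal_def gl_ideal.zero)

lemma scal_one: "scal 1 = (1 :: ('m::finite, 'n::finite) Ugl)"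
  by transfer (simp add: fscal_def gl_ideal.zero)

lemma scal_add: "scal (a + b) = (scal a + scal b :: ('m::finite, 'n::finite) Ugl)"
  by transfer (simp add: fscal_def gl_ideal.zero single_add)

lemma scal_mult: "scal (a * b) = (scal a * scal b :: ('m::finite, 'n::finite) Ugl)"
  by transfer (simp add: fscal_def gl_ideal.zero mult_single)

lemma scal_uminus: "scal (- a) = (- scal a :: ('m::finite, 'n::finite) Ugl)"
  using scal_add[of a "-a"] by (simp add: scal_zero eq_neg_iff_add_eq_0 add.commute)

lemma scal_diff: "scal (a - b) = (scal a - scal b :: ('m::finite, 'n::finite) Ugl)"
  using scal_add[of a "-b"] by (simp add: scal_uminus)

lemma fscal_commute: "fscal a * x = x * fscal a"
proof (induction x rule: poly_mapping_single_induct)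
  case (single k b)
  then show ?case by (simp add: fscal_def mult_single mult.commute)
qed (simp add: algebra_simps)

lemma scal_commute: "scal a * x = (x * scal a :: ('m::finite, 'n::finite) Ugl)"
  by transfer (simp add: fscal_commute gl_ideal.zero)

lemma cartan_commute:
  assumes "i \<in> {1..CARD('m) + CARD('n)}" "j \<in> {1..CARD('m) + CARD('n)}"
  shows "e i i * e j j = (e j j * e i i :: ('m::finite, 'n::finite) Ugl)"
  using e_supercommutator[of i i j j, where 'm = 'm and 'n = 'n] assms
  by (simp add: ssign_def odd_unit_def split: if_splits)

interpretation hembed: hsubst_hom "CARD('m) + CARD('n)" "scal :: complex \<Rightarrow> ('m::finite, 'n::finite) Ugl" "\<lambda>i. e i i"
  by unfold_locales (rule scal_add scal_mult scal_one scal_commute cartan_commute; assumption)+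

lemmas heval_simps = heval.hsubst_add heval.hsubst_mult heval.hsubst_diff heval.hsubst_uminus
  heval.hsubst_one heval.hsubst_zero heval.hsubst_sum heval.hsubst_hC heval.hsubst_hX

lemmas heval_hom = heval_simps[folded heval_def]

lemmas hembed_hom = hembed.hsubst_add[folded hembed_def] hembed.hsubst_mult[folded hembed_def]
  hembed.hsubst_diff[folded hembed_def] hembed.hsubst_uminus[folded hembed_def] hembed.hsubst_one[folded hembed_def]
  hembed.hsubst_zero[folded hembed_def] hembed.hsubst_sum[folded hembed_def]
  hembed.hsubst_hC[folded hembed_def] hembed.hsubst_hX[folded hembed_def]

section \<open>The determinant of a Hessenberg matrix\<close>

text \<open>Indices keep their values in the full matrix, so that expanding along the first column
  merely raises \<open>s\<close>.\<close>

definition ncdet_from :: "nat \<Rightarrow> nat \<Rightarrow> (nat \<Rightarrow> nat \<Rightarrow> 'a::ring_1) \<Rightarrow> 'a" where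
  "ncdet_from s D B = (\<Sum>w | w permutes {s..D}.
     of_int (sign w) * prod_list (map (\<lambda>k. B (w k) k) [s..<D+1]))"

lemma ncdet_from_cong:
  assumes "\<And>i j. i \<in> {s..D} \<Longrightarrow> j \<in> {s..D} \<Longrightarrow> B i j = C i j"
  shows "ncdet_from s D B = ncdet_from s D C"
  unfolding ncdet_from_def
proof (rule sum.cong[OF refl])
  fix w assume w: "w \<in> {w. w permutes {s..D}}"
  have "B (w k) k = C (w k) k" if "k \<in> set [s..<D+1]" for k
  proof -
    have k: "k \<in> {s..D}" using that by auto
    moreover have "w k \<in> {s..D}" using w k permutes_in_image[of w "{s..D}" k] by blast
    ultimately show ?thesis by (intro assms)
  qed
  then have "map (\<lambda>k. B (w k) k) [s..<D+1] = map (\<lambda>k. C (w k) k) [s..<D+1]"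
    by (intro map_cong[OF refl])
  then show "of_int (sign w) * prod_list (map (\<lambda>k. B (w k) k) [s..<D+1])
      = of_int (sign w) * prod_list (map (\<lambda>k. C (w k) k) [s..<D+1])" by (rule arg_cong)
qed

lemma ncdet_from_empty: "ncdet_from (Suc D) D B = 1"
proof -
  have "{Suc D..D} = {}" by auto
  then show ?thesis unfolding ncdet_from_def by (simp add: sign_id)
qed

text \<open>The factors of each product are ordered by columns, so the entry of the first column
  stands on the left and can be pulled out in a noncommutative ring. Every permutation of
  \<open>{s..D}\<close> is uniquely \<open>transpose s b\<close> after a permutation fixing
  \<open>s\<close>.\<close>

lemma ncdet_from_first_column:
  assumes "s \<le> D"
  shows "ncdet_from s D B = (\<Sum>b\<in>{s..D}. of_int (sign (transpose s b)) * B b s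
           * ncdet_from (Suc s) D (\<lambda>i. B (transpose s b i)))"
proof -
  have ins: "{s..D} = insert s {Suc s..D}" using assms by auto
  have l: "[s..<D+1] = s # [Suc s..<D+1]" using assms by (simp add: upt_conv_Cons)
  have *: "of_int (sign (transpose s b \<circ> q)) * prod_list (map (\<lambda>k. B ((transpose s b \<circ> q) k) k) [s..<D+1])
     = of_int (sign (transpose s b)) * B b s *
        (of_int (sign q) * prod_list (map (\<lambda>k. B (transpose s b (q k)) k) [Suc s..<D+1]))"
    if q: "q permutes {Suc s..D}" for b q
  proof -
    have "q s = s" using q by (auto simp: permutes_def)
    then have 1: "(transpose s b \<circ> q) s = b" by simp
    have "permutation q" using q permutation_permutes[of q] by blast
    then have 2: "sign (transpose s b \<circ> q) = sign (transpose s b) * sign q"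
      by (rule sign_compose[OF permutation_swap_id])
    have 3: "of_int (sign q) * B b s = B b s * of_int (sign q)"
      by (rule mult_of_int_commute)
    have "of_int (sign (transpose s b \<circ> q)) * prod_list (map (\<lambda>k. B ((transpose s b \<circ> q) k) k) [s..<D+1])
      = of_int (sign (transpose s b)) * (of_int (sign q) * B b s)
          * prod_list (map (\<lambda>k. B (transpose s b (q k)) k) [Suc s..<D+1])"
      unfolding l list.map prod_list.Cons 1 2 by (simp add: mult.assoc del: upt_Suc)
    then show ?thesis unfolding 3 by (simp add: mult.assoc del: upt_Suc)
  qed
  have "ncdet_from s D B = (\<Sum>b\<in>{s..D}. \<Sum>q | q permutes {Suc s..D}.
      of_int (sign (transpose s b \<circ> q)) * prod_list (map (\<lambda>k. B ((transpose s b \<circ> q) k) k) [s..<D+1]))"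
    unfolding ncdet_from_def ins by (rule sum_over_permutations_insert) auto
  also have "\<dots> = (\<Sum>b\<in>{s..D}. of_int (sign (transpose s b)) * B b s
           * ncdet_from (Suc s) D (\<lambda>i. B (transpose s b i)))"
    unfolding ncdet_from_def sum_distrib_left by (intro sum.cong refl *) simp
  finally show ?thesis .
qed

text \<open>In column \<open>s\<close> only the rows \<open>s\<close> and \<open>Suc s\<close> of
  the block can be nonzero. For the second one the transposition puts \<open>r\<close> in the place
  of row \<open>Suc s\<close>, so blocks with a replaced first row are closed under the expansion;
  the sign of the transposition gives the minus.\<close>

lemma ncdet_from_hessenberg:
  assumes s: "s < D" and hess: "\<And>i j. Suc j < i \<Longrightarrow> B i j = 0"
  shows "ncdet_from s D (B(s := r)) = r s * ncdet_from (Suc s) D B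
           - B (Suc s) s * ncdet_from (Suc s) D (B(Suc s := r))"
proof -
  let ?F = "\<lambda>b. of_int (sign (transpose s b)) * (B(s := r)) b s
           * ncdet_from (Suc s) D (\<lambda>i. (B(s := r)) (transpose s b i))"
  have "ncdet_from s D (B(s := r)) = (\<Sum>b\<in>{s..D}. ?F b)"
    by (rule ncdet_from_first_column) (use s in simp)
  also have "\<dots> = (\<Sum>b\<in>{s, Suc s}. ?F b)"
    by (rule sum.mono_neutral_right) (use s in \<open>auto simp: hess\<close>)
  also have "\<dots> = ?F s + ?F (Suc s)" by (simp del: fun_upd_apply transpose_same)
  also have "?F s = r s * ncdet_from (Suc s) D B"
  proof -
    have "ncdet_from (Suc s) D (B(s := r)) = ncdet_from (Suc s) D B"
      by (rule ncdet_from_cong) auto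
    moreover have "transpose s s = id" by (simp add: fun_eq_iff)
    ultimately show ?thesis by (simp add: sign_id del: fun_upd_apply) simp
  qed
  also have "?F (Suc s) = - B (Suc s) s * ncdet_from (Suc s) D (B(Suc s := r))"
  proof -
    have 1: "ncdet_from (Suc s) D (\<lambda>i. (B(s := r)) (transpose s (Suc s) i)) = ncdet_from (Suc s) D (B(Suc s := r))"
      by (rule ncdet_from_cong) (auto simp: transpose_def)
    have "?F (Suc s) = - B (Suc s) s * ncdet_from (Suc s) D (\<lambda>i. (B(s := r)) (transpose s (Suc s) i))"
      by (simp add: sign_swap_id)
    then show ?thesis unfolding 1 .
  qed
  finally show ?thesis by (simp only: mult_minus_left add_uminus_conv_diff)
qed

section \<open>The elements $f_J$\<close>

text \<open>The product reads its set downwards, which is why the inductions over index sets below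
  add a new maximum each time.\<close>

lemma f_elt_insert:
  assumes "finite J" "J \<noteq> {}" "\<And>j. j \<in> J \<Longrightarrow> j < t"
  shows "f_elt (insert t J) = (e t (Max J) * f_elt J :: ('m::finite, 'n::finite) Ugl)"
proof -
  have "sorted_list_of_set (insert t J) = sorted_list_of_set J @ [t]"
    by (rule sorted_distinct_set_unique) (use assms in \<open>auto simp: sorted_append less_imp_le
          simp del: sorted_list_of_set_insert_remove\<close>)
  moreover obtain x xs where x: "rev (sorted_list_of_set J) = x # xs"
    using assms by (cases "rev (sorted_list_of_set J)") auto
  moreover have "x = Max J"
  proof (rule Max_eqI[symmetric])
    have eq: "sorted_list_of_set J = rev xs @ [x]" using x by (metis rev.simps(2) rev_swap)
    then have "set (rev xs @ [x]) = J" using assms by (metis set_sorted_list_of_set)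
    then show "x \<in> J" by auto
    have "sorted (rev xs @ [x])" using eq by (metis sorted_sorted_list_of_set)
    with \<open>set (rev xs @ [x]) = J\<close> show "y \<le> x" if "y \<in> J" for y
      using that by (auto simp: sorted_append)
  qed (use assms in auto)
  ultimately show ?thesis by (simp add: f_elt_def)
qed

lemma f_elt_singleton: "f_elt {a} = (1 :: ('m::finite, 'n::finite) Ugl)"
  by (simp add: f_elt_def)

section \<open>Sums over paths ending at 1\<close>

definition low_sets :: "nat \<Rightarrow> nat set set" where
  "low_sets u = {J. J \<subseteq> {1..u} \<and> 1 \<in> J}"

lemma finite_low_sets [simp]: "finite (low_sets u)"
  unfolding low_sets_def by (rule finite_subset[of _ "Pow {1..u}"]) auto

lemma low_sets_Suc:
  assumes "1 \<le> u"
  shows "low_sets (Suc u) = low_sets u \<union> insert (Suc u) ` low_sets u"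
proof -
  have "J \<in> low_sets (Suc u) \<Longrightarrow> J \<in> low_sets u \<union> insert (Suc u) ` low_sets u" for J
  proof (cases "Suc u \<in> J")
    case True
    assume "J \<in> low_sets (Suc u)"
    with assms True have "J - {Suc u} \<in> low_sets u" "J = insert (Suc u) (J - {Suc u})"
      by (auto simp: low_sets_def atLeastAtMostSuc_conv)
    then show ?thesis by blast
  next
    case False
    assume "J \<in> low_sets (Suc u)"
    with False show ?thesis by (auto simp: low_sets_def atLeastAtMostSuc_conv)
  qed
  then show ?thesis by (auto simp: low_sets_def)
qed

lemma inj_on_insert_low_sets:
  assumes "u < t"
  shows "inj_on (insert t) (low_sets u)"
proof (rule inj_onI)
  fix A B assume "A \<in> low_sets u" "B \<in> low_sets u" "insert t A = insert t B"
  moreover have "t \<notin> A" "t \<notin> B" using calculation assms by (auto simp: low_sets_def)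
  ultimately show "A = B" by (metis insert_ident)
qed

lemma sum_low_sets_Suc:
  assumes "1 \<le> u"
  shows "(\<Sum>J\<in>low_sets (Suc u). F J) = (\<Sum>J\<in>low_sets u. F J) + (\<Sum>J\<in>low_sets u. F (insert (Suc u) J))"
proof -
  have "low_sets u \<inter> insert (Suc u) ` low_sets u = {}"
    by (auto simp: low_sets_def)
  moreover have "inj_on (insert (Suc u)) (low_sets u)"
    by (rule inj_on_insert_low_sets) simp
  ultimately show ?thesis
    unfolding low_sets_Suc[OF assms] by (simp add: sum.union_disjoint sum.reindex)
qed

text \<open>This is G(t,u) of the overview when \<open>b x\<close> is B_{x-1}: a path starts at
  \<open>t\<close>, may visit the indices up to \<open>u\<close> and ends at 1, and every skipped
  index \<open>x\<close> contributes \<open>b x\<close>.\<close>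

definition path_sum :: "(nat \<Rightarrow> complex) \<Rightarrow> nat \<Rightarrow> nat \<Rightarrow> ('m::finite, 'n::finite) Ugl" where
  "path_sum b t u = (\<Sum>J\<in>low_sets u. f_elt (insert t J) * scal (\<Prod>x\<in>{1..u} - J. b x))"

lemma path_sum_1:
  assumes "1 < t"
  shows "path_sum b t 1 = e t 1"
proof -
  have "low_sets 1 = {{1}}" by (auto simp: low_sets_def)
  then show ?thesis using f_elt_insert[of "{1}" t] assms
    by (simp add: path_sum_def f_elt_singleton scal_one)
qed

lemma path_sum_Suc:
  assumes u: "1 \<le> u" "Suc u < t"
  shows "path_sum b t (Suc u) = (e t (Suc u) * path_sum b (Suc u) u + scal (b (Suc u)) * path_sum b t u
    :: ('m::finite, 'n::finite) Ugl)"
proof -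
  have J: "finite J" "1 \<in> J" "\<And>j. j \<in> J \<Longrightarrow> j \<le> u" if "J \<in> low_sets u" for J
    using that finite_subset[of J "{1..u}"] by (auto simp: low_sets_def)
  have "(\<Sum>J\<in>low_sets u. f_elt (insert t (insert (Suc u) J)) * scal (\<Prod>x\<in>{1..Suc u} - insert (Suc u) J. b x))
      = (e t (Suc u) * path_sum b (Suc u) u :: ('m, 'n) Ugl)"
    unfolding path_sum_def sum_distrib_left
  proof (rule sum.cong[OF refl])
    fix J assume JJ: "J \<in> low_sets u"
    have M: "Max (insert (Suc u) J) = Suc u"
      using J[OF JJ] by (intro Max_eqI) (auto simp: le_SucI)
    have D: "{1..Suc u} - insert (Suc u) J = {1..u} - J" by auto
    have "j < t" if "j \<in> insert (Suc u) J" for j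
      using that J(3)[OF JJ] u by fastforce
    then have "f_elt (insert t (insert (Suc u) J)) = (e t (Suc u) * f_elt (insert (Suc u) J) :: ('m, 'n) Ugl)"
      using f_elt_insert[of "insert (Suc u) J" t] J(1)[OF JJ] unfolding M by blast
    then show "f_elt (insert t (insert (Suc u) J)) * scal (\<Prod>x\<in>{1..Suc u} - insert (Suc u) J. b x)
        = (e t (Suc u) * (f_elt (insert (Suc u) J) * scal (\<Prod>x\<in>{1..u} - J. b x)) :: ('m, 'n) Ugl)"
      unfolding D by (simp only: mult.assoc)
  qed
  moreover have "(\<Sum>J\<in>low_sets u. f_elt (insert t J) * scal (\<Prod>x\<in>{1..Suc u} - J. b x))
      = (scal (b (Suc u)) * path_sum b t u :: ('m, 'n) Ugl)"
    unfolding path_sum_def sum_distrib_left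
  proof (rule sum.cong[OF refl])
    fix J assume JJ: "J \<in> low_sets u"
    have "Suc u \<notin> J" using J(3)[OF JJ] by fastforce
    then have "{1..Suc u} - J = insert (Suc u) ({1..u} - J)" by auto
    then have "(\<Prod>x\<in>{1..Suc u} - J. b x) = b (Suc u) * (\<Prod>x\<in>{1..u} - J. b x)" by simp
    then show "f_elt (insert t J) * scal (\<Prod>x\<in>{1..Suc u} - J. b x)
        = (scal (b (Suc u)) * (f_elt (insert t J) * scal (\<Prod>x\<in>{1..u} - J. b x)) :: ('m, 'n) Ugl)"
      unfolding scal_commute[of "b (Suc u)"] by (simp add: scal_mult[symmetric] mult.assoc mult.commute)
  qed
  ultimately show ?thesis
    unfolding path_sum_def[of b t "Suc u"] sum_low_sets_Suc[OF u(1)] by simp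
qed

text \<open>The block of size \<open>u\<close> occupies the rows \<open>N - u\<close> to
  \<open>N - 1\<close>. Row \<open>N - u\<close> of the matrix itself consists of the
  \<open>e (Suc u) (N - j)\<close>, so an unmodified block is the case \<open>t = Suc u\<close>; in
  this way the minor without a replaced row also falls under the induction hypothesis.\<close>

lemma ncdet_Amat_path_sum:
  fixes l :: weight
  defines "m \<equiv> CARD('m::finite)" and "n \<equiv> CARD('n::finite)"
  defines "N \<equiv> m + n"
  defines "A \<equiv> Amat l :: nat \<Rightarrow> nat \<Rightarrow> ('m, 'n) Ugl"
  assumes "1 \<le> u" "u < t" "u < N"
  shows "ncdet_from (N - u) (N - 1) (A(N - u := (\<lambda>j. e t (N - j)))) = path_sum (\<lambda>x. Bcoef m n l (x - 1)) t u"
  using assms(5-7)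
proof (induction u arbitrary: t rule: nat_induct_at_least)
  case base
  let ?C = "A(N - 1 := (\<lambda>j. e t (N - j)))"
  have "ncdet_from (N - 1) (N - 1) ?C = of_int (sign (transpose (N - 1) (N - 1))) * ?C (N - 1) (N - 1)
      * ncdet_from (Suc (N - 1)) (N - 1) (\<lambda>i. ?C (transpose (N - 1) (N - 1) i))"
    by (subst ncdet_from_first_column) auto
  also have "\<dots> = e t 1"
    unfolding ncdet_from_empty using base by (simp add: sign_id)
  also have "\<dots> = path_sum (\<lambda>x. Bcoef m n l (x - 1)) t 1"
    by (rule path_sum_1[symmetric]) (use base in simp)
  finally show ?case .
next
  case (Suc u)
  define s where "s = N - Suc u"
  have s: "Suc s = N - u" "s < N - 1" using Suc by (auto simp: s_def)
  have A: "Suc j < i \<Longrightarrow> A i j = 0" for i j by (simp add: A_def Amat_def)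
  have 1: "A (Suc s) s = - scal (Bcoef m n l u)"
    using Suc by (simp add: A_def Amat_def s_def m_def n_def N_def)
  have 2: "ncdet_from (Suc s) (N - 1) A = ncdet_from (N - u) (N - 1) (A(N - u := (\<lambda>j. e (Suc u) (N - j))))"
    using Suc.prems Suc.hyps unfolding s
    by (intro ncdet_from_cong) (auto simp: A_def Amat_def m_def n_def N_def)
  have "ncdet_from s (N - 1) (A(s := (\<lambda>j. e t (N - j))))
     = e t (Suc u) * ncdet_from (Suc s) (N - 1) A
         + scal (Bcoef m n l u) * ncdet_from (Suc s) (N - 1) (A(Suc s := (\<lambda>j. e t (N - j))))"
    using ncdet_from_hessenberg[of s "N - 1" A "\<lambda>j. e t (N - j)"] s A 1 Suc.prems
    by (simp add: s_def)
  also have "\<dots> = e t (Suc u) * path_sum (\<lambda>x. Bcoef m n l (x - 1)) (Suc u) u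
      + scal (Bcoef m n l u) * path_sum (\<lambda>x. Bcoef m n l (x - 1)) t u"
    unfolding 2 unfolding s(1)
    by (subst Suc.IH[of "Suc u"] Suc.IH[of t], use Suc.prems in linarith, use Suc.prems in linarith)+ (rule refl)
  also have "\<dots> = path_sum (\<lambda>x. Bcoef m n l (x - 1)) t (Suc u)"
    using Suc by (simp add: path_sum_Suc)
  finally show ?case unfolding s_def .
qed

section \<open>Evaluation of the polynomials h_i and H_J\<close>

lemma heval_h_elt:
  "heval m n (h_elt m n \<alpha>) l = form m n l \<alpha>"
  unfolding heval_def h_elt_def form_def
  by (simp add: heval_simps mult.commute)

lemma form_add_left: "form m n (\<alpha> + \<beta>) \<gamma> = form m n \<alpha> \<gamma> + form m n \<beta> \<gamma>"
  by (simp add: form_def distrib_right sum.distrib)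

lemma heval_h_poly: "heval m n (h_poly m n i) l = Bcoef m n l i"
  unfolding h_poly_def Bcoef_def
  by (simp add: heval_def heval_simps heval_h_elt[unfolded heval_def] form_add_left)

lemma heval_prod: "heval m n (prod g A) l = (\<Prod>x\<in>A. heval m n (g x) l)"
  by (induction A rule: infinite_finite_induct) (auto simp: heval_def heval_simps)

lemma H_poly_eq_prod: "H_poly m n J = (\<Prod>x\<in>{1..m+n} - J. h_poly m n (x - 1))"
  unfolding H_poly_def r_set_def
  by (subst prod.reindex) (auto simp: inj_on_def)

lemma II_eq_image:
  assumes "2 \<le> m + n"
  shows "II m n = insert (m + n) ` low_sets (m + n - 1)"
proof -
  have "J \<in> insert (m + n) ` low_sets (m + n - 1)" if "J \<in> II m n" for J
  proof (rule image_eqI)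
    show "J = insert (m + n) (J - {m + n})" using that by (auto simp: II_def)
    have "x \<le> m + n - 1" if "x \<in> J" "x \<noteq> m + n" for x
    proof -
      have "x \<le> m + n" using \<open>J \<in> II m n\<close> that by (auto simp: II_def)
      with that show ?thesis by linarith
    qed
    then show "J - {m + n} \<in> low_sets (m + n - 1)" using that assms by (auto simp: II_def low_sets_def)
  qed
  then show ?thesis using assms by (fastforce simp: II_def low_sets_def)
qed

lemma ncdet_Amat:
  fixes l :: weight
  defines "m \<equiv> CARD('m::finite)" and "n \<equiv> CARD('n::finite)"
  shows "ncdet (m + n - 1) (Amat l :: nat \<Rightarrow> nat \<Rightarrow> ('m, 'n) Ugl)
           = (\<Sum>J\<in>II m n. f_elt J * scal (heval m n (H_poly m n J) l))"
proof -
  let ?N = "m + n"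
  let ?A = "Amat l :: nat \<Rightarrow> nat \<Rightarrow> ('m, 'n) Ugl"
  have "1 \<le> m" "1 \<le> n" by (simp_all add: m_def n_def Suc_leI)
  then have N: "2 \<le> ?N" by simp
  \<comment> \<open>The first row already reads \<open>e ?N (?N - j)\<close>, so replacing it
    changes nothing, and the determinant is G(N,N-1).\<close>
  have "ncdet (?N - 1) ?A = ncdet_from (?N - (?N - 1)) (?N - 1) (?A(?N - (?N - 1) := (\<lambda>j. e ?N (?N - j))))"
    unfolding ncdet_def ncdet_from_def[symmetric] using N
    by (simp, intro ncdet_from_cong) (auto simp: Amat_def Let_def m_def n_def)
  also have "\<dots> = path_sum (\<lambda>x. Bcoef m n l (x - 1)) ?N (?N - 1)"
    unfolding m_def n_def by (rule ncdet_Amat_path_sum) (use N in \<open>auto simp: m_def n_def\<close>)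
  also have "\<dots> = (\<Sum>J\<in>low_sets (?N - 1). f_elt (insert ?N J) * scal (heval m n (H_poly m n (insert ?N J)) l))"
    unfolding path_sum_def
  proof (intro sum.cong refl)
    fix J assume "J \<in> low_sets (?N - 1)"
    have "{1..?N} - insert ?N J = {1..?N - 1} - J" using N by auto
    then show "f_elt (insert ?N J) * scal (\<Prod>x\<in>{1..?N - 1} - J. Bcoef m n l (x - 1))
        = f_elt (insert ?N J) * scal (heval m n (H_poly m n (insert ?N J)) l)"
      by (simp add: H_poly_eq_prod heval_prod heval_h_poly)
  qed
  also have "\<dots> = (\<Sum>J\<in>II m n. f_elt J * scal (heval m n (H_poly m n J) l))"
  proof -
    have "inj_on (insert ?N) (low_sets (?N - 1))"
      by (rule inj_on_insert_low_sets) (use N in simp)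
    then show ?thesis unfolding II_eq_image[OF N] by (simp add: sum.reindex)
  qed
  finally show ?thesis .
qed

section \<open>Super brackets\<close>

definition sg :: "bool \<Rightarrow> 'a::ring_1" where
  "sg s = (if s then -1 else 1)"

text \<open>The supercommutator. \<open>s\<close> tells whether both arguments are odd; it is an
  explicit parameter because elements of a plain ring carry no parity.\<close>

definition br :: "bool \<Rightarrow> 'a::ring_1 \<Rightarrow> 'a \<Rightarrow> 'a" where
  "br s x y = x * y - sg s * (y * x)"

lemma sg_simps [simp]: "sg False = 1" "sg True = -1"
  by (simp_all add: sg_def)

lemma sg_sg [simp]: "sg s * (sg s * x) = x"
  by (cases s) auto

text \<open>Super Leibniz rule. If \<open>x\<close> is odd, then \<open>s\<close> and
  \<open>t\<close> are the parities of \<open>y\<close> and \<open>z\<close>, which add modulo 2 in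
  the product; if \<open>x\<close> is even, all three flags are false.\<close>

lemma br_mult_right: "r = (s \<noteq> t) \<Longrightarrow> br r x (y * z) = br s x y * z + sg s * (y * br t x z)"
  by (cases s; cases t) (simp_all add: br_def algebra_simps)

lemma br_mult_left: "r = (s \<noteq> t) \<Longrightarrow> br r (x * y) z = x * br t y z + sg t * (br s x z * y)"
  by (cases s; cases t) (simp_all add: br_def algebra_simps)

lemma br_add_left: "br s (x + y) z = br s x z + br s y z"
  and br_add_right: "br s z (x + y) = br s z x + br s z y"
  and br_diff_left: "br s (x - y) z = br s x z - br s y z"
  and br_diff_right: "br s z (x - y) = br s z x - br s z y"
  and br_zero_left: "br s 0 z = 0"
  and br_zero_right: "br s z 0 = 0"
  by (simp_all add: br_def algebra_simps)

lemma br_sg_left: "br s (sg t * y) z = sg t * br s y z"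
  and br_sg_right: "br s z (sg t * y) = sg t * br s z y"
  by (cases t; simp add: br_def algebra_simps)+

lemma br_sum_left: "br s (sum f A) z = (\<Sum>a\<in>A. br s (f a) z)"
  by (induction A rule: infinite_finite_induct) (auto simp: br_add_left br_zero_left)

lemma br_sum_right: "br s z (sum f A) = (\<Sum>a\<in>A. br s z (f a))"
  by (induction A rule: infinite_finite_induct) (auto simp: br_add_right br_zero_right)

lemma br_swap: "br s y x = - sg s * br s x y"
  by (cases s) (simp_all add: br_def algebra_simps)

lemma br_self: "br False x x = 0"
  by (simp add: br_def)

section \<open>Inducing a representation from $\mathfrak{gl}$ of one size smaller\<close>

text \<open>\<open>W\<close> represents $\mathfrak{gl}$ of size \<open>M\<close> and \<open>c\<close> is the weight of the new index \<open>N = M + 1\<close>. In the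
  module induced from the parabolic subalgebra killing the $e_{i,N}$, the $e_{N,k}$ act as
  multiplications \<open>y k\<close>; the operators \<open>NN\<close>, \<open>E\<close>, \<open>R\<close> below are $e_{N,N}$, $e_{i,j}$ and $e_{i,N}$ written in terms
  of \<open>y\<close> and the superderivations \<open>d\<close>.\<close>

locale gl_step =
  fixes p :: "nat \<Rightarrow> bool" and M :: nat
    and W :: "nat \<Rightarrow> nat \<Rightarrow> 'a::ring_1" and y d :: "nat \<Rightarrow> 'a" and c :: 'a
  fixes N par q
  defines "N \<equiv> Suc M" and "par i j \<equiv> p i \<noteq> p j" and "q i \<equiv> p N \<noteq> p i"
  assumes WW: "{i, j, k, l} \<subseteq> {1..M} \<Longrightarrow> br (par i j \<and> par k l) (W i j) (W k l)
      = (if j = k then W i l else 0) - sg (par i j \<and> par k l) * (if l = i then W k j else 0)"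
    and Wy: "{i, j, k} \<subseteq> {1..M} \<Longrightarrow> br (par i j \<and> q k) (W i j) (y k) = 0"
    and Wd: "{i, j, k} \<subseteq> {1..M} \<Longrightarrow> br (par i j \<and> q k) (W i j) (d k) = 0"
    and yy: "br (q i \<and> q k) (y i) (y k) = 0"
    and dd: "br (q i \<and> q k) (d i) (d k) = 0"
    and dy: "br (q i \<and> q k) (d i) (y k) = (if i = k then 1 else 0)"
    and cc: "br False c x = 0"
begin

definition NN :: 'a where "NN = c + (\<Sum>k\<in>{1..M}. y k * d k)"

text \<open>The subtracted term is the adjoint action on the \<open>y k\<close>, which stand for
  e_{N,k}: bracketing e_{i,j} with e_{N,i} gives e_{N,j} up to sign.\<close>

definition E :: "nat \<Rightarrow> nat \<Rightarrow> 'a" where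
  "E i j = W i j - sg (par i j \<and> q i) * (y j * d i)"

text \<open>Chosen so that the bracket with e_{N,k} is \<open>E i k\<close> minus, for k = i, a
  signed \<open>NN\<close>. These contain \<open>d\<close> once, so \<open>R i\<close> is quadratic
  in \<open>d\<close>, through \<open>NN * d i\<close>. Every term ends in some \<open>d\<close>,
  hence a vector killed by all \<open>d\<close> is killed by \<open>R i\<close>.\<close>

definition R :: "nat \<Rightarrow> 'a" where
  "R i = (\<Sum>k\<in>{1..M}. W i k * d k) - sg (q i) * (NN * d i)"

text \<open>With the parity of e_{i,j} reduced to those of e_{N,i} and e_{N,j}, the sign identities
  below become case distinctions on \<open>q\<close>.\<close>

lemma par_q: "par i j = (q i \<noteq> q j)"
  by (auto simp: par_def q_def)

lemma yd: "br (q i \<and> q k) (y i) (d k) = (if i = k then - sg (q i) else 0)"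
proof -
  have c: "(q i \<and> q k) = (q k \<and> q i)" by blast
  show ?thesis unfolding c br_swap[of _ "y i"] dy by simp
qed

lemma yW: "{i, j, k} \<subseteq> {1..M} \<Longrightarrow> br (q k \<and> par i j) (y k) (W i j) = 0"
  and dW: "{i, j, k} \<subseteq> {1..M} \<Longrightarrow> br (q k \<and> par i j) (d k) (W i j) = 0"
proof -
  assume a: "{i, j, k} \<subseteq> {1..M}"
  have c: "(q k \<and> par i j) = (par i j \<and> q k)" by blast
  show "br (q k \<and> par i j) (y k) (W i j) = 0" "br (q k \<and> par i j) (d k) (W i j) = 0"
    unfolding c br_swap[of _ _ "W i j"] Wy[OF a] Wd[OF a] by simp_all
qed

lemma E_y:
  assumes "{i, j, k} \<subseteq> {1..M}"
  shows "br (par i j \<and> q k) (E i j) (y k) = (if k = i then - sg (par i j \<and> q i) * y j else 0)"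
proof -
  have "br (par i j \<and> q k) (y j * d i) (y k) = y j * (if i = k then 1 else 0)"
    by (subst br_mult_left[of _ "q j \<and> q k" "q i \<and> q k"]) (auto simp: par_q dy yy)
  then show ?thesis
    using Wy[OF assms] by (simp add: E_def br_diff_left br_sg_left)
qed

lemma E_d:
  assumes "{i, j, k} \<subseteq> {1..M}"
  shows "br (par i j \<and> q k) (E i j) (d k) = (if k = j then sg (par i j) * d i else 0)"
proof -
  have "br (par i j \<and> q k) (y j * d i) (d k) = sg (q i \<and> q k) * ((if j = k then - sg (q j) else 0) * d i)"
    by (subst br_mult_left[of _ "q j \<and> q k" "q i \<and> q k"]) (auto simp: par_q dd yd)
  then show ?thesis
    using Wd[OF assms] by (simp add: E_def br_diff_left br_sg_left) (simp add: par_q sg_def)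
qed

lemma E_W:
  assumes "{i, j, k, l} \<subseteq> {1..M}"
  shows "br (par i j \<and> par k l) (E i j) (W k l)
    = (if j = k then W i l else 0) - sg (par i j \<and> par k l) * (if l = i then W k j else 0)"
proof -
  have "br (par i j \<and> par k l) (y j * d i) (W k l) = 0"
    using yW[of k l j] dW[of k l i] assms
    by (subst br_mult_left[of _ "q j \<and> par k l" "q i \<and> par k l"]) (auto simp: par_q)
  then show ?thesis
    using WW[OF assms] by (simp add: E_def br_diff_left br_sg_left)
qed

lemma E_E:
  assumes "{i, j, k, l} \<subseteq> {1..M}"
  shows "br (par i j \<and> par k l) (E i j) (E k l)
    = (if j = k then E i l else 0) - sg (par i j \<and> par k l) * (if l = i then E k j else 0)"
proof -
  have "br (par i j \<and> par k l) (E i j) (y l * d k)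
      = (if l = i then - sg (par i j \<and> q i) * y j else 0) * d k
        + sg (par i j \<and> q l) * (y l * (if k = j then sg (par i j) * d i else 0))"
    using E_y[of i j l] E_d[of i j k] assms
    by (subst br_mult_right[of _ "par i j \<and> q l" "par i j \<and> q k"]) (auto simp: par_q)
  then have 1: "br (par i j \<and> par k l) (E i j) (E k l)
      = (if j = k then W i l else 0) - sg (par i j \<and> par k l) * (if l = i then W k j else 0)
       - sg (par k l \<and> q k) * ((if l = i then - sg (par i j \<and> q i) * y j else 0) * d k
        + sg (par i j \<and> q l) * (y l * (if k = j then sg (par i j) * d i else 0)))"
    using E_W[OF assms] unfolding E_def[of k l] by (simp add: br_diff_right br_sg_right)
  show ?thesis
    unfolding 1 E_def[of i l] E_def[of k j]
    by (cases "q i"; cases "q j"; cases "q k"; cases "q l") (auto simp: par_q algebra_simps)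
qed

lemma NN_y: "k \<in> {1..M} \<Longrightarrow> br False NN (y k) = y k"
proof -
  assume k: "k \<in> {1..M}"
  have "br False (y l * d l) (y k) = (if l = k then y l else 0)" for l
    by (subst br_mult_left[of _ "q l \<and> q k" "q l \<and> q k"]) (auto simp: dy yy)
  then show ?thesis using k by (simp add: NN_def br_add_left br_sum_left cc sum.delta)
qed

lemma NN_d: "k \<in> {1..M} \<Longrightarrow> br False NN (d k) = - d k"
proof -
  assume k: "k \<in> {1..M}"
  have "br False (y l * d l) (d k) = (if l = k then - d l else 0)" for l
    by (subst br_mult_left[of _ "q l \<and> q k" "q l \<and> q k"]) (auto simp: dd yd sg_def)
  then show ?thesis using k by (simp add: NN_def br_add_left br_sum_left cc sum.delta)
qed

lemma NN_W:
  assumes "{i, j} \<subseteq> {1..M}"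
  shows "br False NN (W i j) = 0"
proof -
  have "br False (y l * d l) (W i j) = 0" if "l \<in> {1..M}" for l
    using yW[of i j l] dW[of i j l] assms that
    by (subst br_mult_left[of _ "q l \<and> par i j" "q l \<and> par i j"]) auto
  then show ?thesis by (simp add: NN_def br_add_left br_sum_left cc)
qed

lemma NN_E:
  assumes "{i, j} \<subseteq> {1..M}"
  shows "br False NN (E i j) = 0"
proof -
  have "br False NN (y j * d i) = 0"
    using NN_y[of j] NN_d[of i] assms by (subst br_mult_right[of _ False False]) auto
  then show ?thesis using NN_W[OF assms] by (simp add: E_def br_diff_right br_sg_right)
qed

lemma NN_R:
  assumes "i \<in> {1..M}"
  shows "br False NN (R i) = - R i"
proof -
  have "br False NN (W i k * d k) = - (W i k * d k)" if "k \<in> {1..M}" for k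
    using NN_d[of k] NN_W[of i k] assms that by (subst br_mult_right[of _ False False]) auto
  moreover have "br False NN (NN * d i) = - (NN * d i)"
    using NN_d[of i] assms by (subst br_mult_right[of _ False False]) (auto simp: br_self)
  ultimately show ?thesis
    by (simp add: R_def br_diff_right br_sum_right br_sg_right sum_negf)
qed

lemma R_y:
  assumes "{i, k} \<subseteq> {1..M}"
  shows "br (q i \<and> q k) (R i) (y k) = E i k - sg (q i \<and> q k) * (if k = i then NN else 0)"
proof -
  have "br (q i \<and> q k) (W i l * d l) (y k) = (if l = k then W i l else 0)" if "l \<in> {1..M}" for l
    using Wy[of i l k] assms that
    by (subst br_mult_left[of _ "par i l \<and> q k" "q l \<and> q k"]) (auto simp: par_q dy)
  then have 1: "br (q i \<and> q k) (\<Sum>l\<in>{1..M}. W i l * d l) (y k) = W i k"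
    using assms by (simp add: br_sum_left sum.delta)
  have 2: "br (q i \<and> q k) (NN * d i) (y k) = (if i = k then NN else 0) + sg (q i \<and> q k) * (y k * d i)"
    using NN_y[of k] assms by (subst br_mult_left[of _ False "q i \<and> q k"]) (auto simp: dy)
  show ?thesis
    unfolding R_def br_diff_left br_sg_left 1 2 E_def
    by (cases "q i"; cases "q k") (auto simp: par_q algebra_simps)
qed

text \<open>In the sum over \<open>l\<close>, the term \<open>W k j * d i\<close> arises at
  \<open>l = i\<close> from \<open>W\<close> and at \<open>l = j\<close> from \<open>d\<close>, with
  opposite signs: the contraction over \<open>l\<close> is invariant.\<close>

lemma E_R:
  assumes "{i, j, k} \<subseteq> {1..M}"
  shows "br (par i j \<and> q k) (E i j) (R k) = (if j = k then R i else 0)"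
proof -
  have 0: "br (par i j \<and> q k) (E i j) (W k l * d l)
      = ((if j = k then W i l else 0) - sg (par i j \<and> par k l) * (if l = i then W k j else 0)) * d l
       + sg (par i j \<and> par k l) * (W k l * (if l = j then sg (par i j) * d i else 0))"
    if "l \<in> {1..M}" for l
    using E_W[of i j k l] E_d[of i j l] assms that
    by (subst br_mult_right[of _ "par i j \<and> par k l" "par i j \<and> q l"]) (auto simp: par_q)
  have "br (par i j \<and> q k) (E i j) (\<Sum>l\<in>{1..M}. W k l * d l)
     = (\<Sum>l\<in>{1..M}. (if j = k then W i l * d l else 0)
          - (if l = i then sg (par i j \<and> par k i) * (W k j * d i) else 0)
          + (if l = j then sg (par i j \<and> par k j) * (sg (par i j) * (W k j * d i)) else 0))"
    unfolding br_sum_right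
  proof (rule sum.cong[OF refl])
    fix l assume "l \<in> {1..M}"
    from 0[OF this] show "br (par i j \<and> q k) (E i j) (W k l * d l)
      = (if j = k then W i l * d l else 0) - (if l = i then sg (par i j \<and> par k i) * (W k j * d i) else 0)
          + (if l = j then sg (par i j \<and> par k j) * (sg (par i j) * (W k j * d i)) else 0)"
      by (cases "par i j"; cases "par k l"; cases "l = i"; cases "l = j"; cases "j = k") (simp_all add: left_diff_distrib mult.assoc)
  qed
  also have "\<dots> = (if j = k then (\<Sum>l\<in>{1..M}. W i l * d l) else 0)
      - sg (par i j \<and> par k i) * (W k j * d i) + sg (par i j \<and> par k j) * (sg (par i j) * (W k j * d i))"
    using assms by (simp add: sum.distrib sum_subtractf sum.delta)
  also have "\<dots> = (if j = k then (\<Sum>l\<in>{1..M}. W i l * d l) else 0)"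
    by (cases "q i"; cases "q j"; cases "q k") (auto simp: par_q)
  finally have 1: "br (par i j \<and> q k) (E i j) (\<Sum>l\<in>{1..M}. W k l * d l)
      = (if j = k then (\<Sum>l\<in>{1..M}. W i l * d l) else 0)" .
  have "br False (E i j) NN = 0" using NN_E[of i j] br_swap[of False "E i j" NN] assms by simp
  then have 2: "br (par i j \<and> q k) (E i j) (NN * d k) = NN * (if k = j then sg (par i j) * d i else 0)"
    using E_d[OF assms] by (subst br_mult_right[of _ False "par i j \<and> q k"]) auto
  show ?thesis
    unfolding R_def br_diff_right br_sg_right 1 2
    by (cases "q i"; cases "q j"; cases "q k") (auto simp: par_q)
qed

text \<open>Only the \<open>y\<close> hidden in \<open>NN\<close> fails to supercommute with
  \<open>d k\<close>.\<close>

lemma R_d: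
  assumes "{i, k} \<subseteq> {1..M}"
  shows "br (q i \<and> q k) (R i) (d k) = sg (q i) * (d i * d k)"
proof -
  have "br (q i \<and> q k) (W i l * d l) (d k) = 0" if "l \<in> {1..M}" for l
    using Wd[of i l k] assms that
    by (subst br_mult_left[of _ "par i l \<and> q k" "q l \<and> q k"]) (auto simp: par_q dd)
  then have 1: "br (q i \<and> q k) (\<Sum>l\<in>{1..M}. W i l * d l) (d k) = 0"
    by (simp add: br_sum_left)
  have 2: "br (q i \<and> q k) (NN * d i) (d k) = - (d i * d k)"
    using NN_d[of k] assms dd[of i k]
    by (subst br_mult_left[of _ False "q i \<and> q k"]) (auto simp: br_def sg_def split: if_splits)
  show ?thesis
    unfolding R_def br_diff_left br_sg_left 1 2 by simp
qed

lemma R_W: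
  assumes "{i, j, l} \<subseteq> {1..M}"
  shows "br (q i \<and> par j l) (R i) (W j l)
    = sg (q j \<and> par j l) * (W i l * d j)
     - (if l = i then (\<Sum>k\<in>{1..M}. sg (q i \<and> par j l) * (W j k * d k)) else 0)"
proof -
  have "br (q i \<and> par j l) (W i k * d k) (W j l)
     = (if k = j then sg (q j \<and> par j l) * (W i l * d j) else 0)
      - (if l = i then sg (q i \<and> par j l) * (W j k * d k) else 0)"
    if "k \<in> {1..M}" for k
  proof -
    have "br (q i \<and> par j l) (W i k * d k) (W j l) = W i k * br (q k \<and> par j l) (d k) (W j l)
        + sg (q k \<and> par j l) * (br (par i k \<and> par j l) (W i k) (W j l) * d k)"
      by (rule br_mult_left) (auto simp: par_q)
    moreover have "br (q k \<and> par j l) (d k) (W j l) = 0"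
      using assms that by (intro dW) auto
    moreover have "br (par i k \<and> par j l) (W i k) (W j l)
        = (if k = j then W i l else 0) - sg (par i k \<and> par j l) * (if l = i then W j k else 0)"
      using assms that by (intro WW) auto
    ultimately show ?thesis
      by (cases "q i"; cases "q k"; cases "q j"; cases "q l"; cases "k = j"; cases "l = i")
        (simp_all add: par_q left_diff_distrib distrib_right mult.assoc)
  qed
  then have 1: "br (q i \<and> par j l) (\<Sum>k\<in>{1..M}. W i k * d k) (W j l)
     = sg (q j \<and> par j l) * (W i l * d j)
      - (if l = i then (\<Sum>k\<in>{1..M}. sg (q i \<and> par j l) * (W j k * d k)) else 0)"
    using assms by (simp add: br_sum_left sum_subtractf sum.delta)
  have 2: "br (q i \<and> par j l) (NN * d i) (W j l) = 0"
    using NN_W[of j l] dW[of j l i] assms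
    by (subst br_mult_left[of _ False "q i \<and> par j l"]) auto
  show ?thesis unfolding R_def br_diff_left br_sg_left 1 2 by simp
qed

text \<open>The terms of \<open>R_W\<close> at \<open>l = i\<close> cancel against those of
  \<open>R_d\<close> once two \<open>d\<close> are interchanged. What remains of the sum in
  \<open>R j\<close> equals the signed bracket with \<open>NN * d j\<close>, again after
  interchanging two \<open>d\<close>, so the two parts of \<open>R j\<close> cancel.\<close>

lemma R_R:
  assumes "{i, j} \<subseteq> {1..M}"
  shows "br (q i \<and> q j) (R i) (R j) = 0"
proof -
  have d_swap: "d l * d k = sg (q l \<and> q k) * (d k * d l)" for k l
    using dd[of l k] by (simp add: br_def)
  have "br (q i \<and> q j) (R i) (W j l * d l)
     = sg (q j \<and> par j l) * (W i l * d j * d l)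
      - (if l = i then (\<Sum>k\<in>{1..M}. sg (q i \<and> par j i) * (W j k * d k * d i)) else 0)
      + sg (q i \<and> par j l) * (sg (q i) * (W j l * d i * d l))" if "l \<in> {1..M}" for l
  proof -
    have 1: "br (q i \<and> q j) (R i) (W j l * d l) = br (q i \<and> par j l) (R i) (W j l) * d l
        + sg (q i \<and> par j l) * (W j l * br (q i \<and> q l) (R i) (d l))"
      by (rule br_mult_right) (auto simp: par_q)
    have 2: "br (q i \<and> par j l) (R i) (W j l) = sg (q j \<and> par j l) * (W i l * d j)
        - (if l = i then (\<Sum>k\<in>{1..M}. sg (q i \<and> par j l) * (W j k * d k)) else 0)"
      using assms that by (intro R_W) auto
    have 3: "br (q i \<and> q l) (R i) (d l) = sg (q i) * (d i * d l)"
      using assms that by (intro R_d) auto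
    have 4: "W j l * (sg (q i) * (d i * d l)) = sg (q i) * (W j l * d i * d l)"
      by (cases "q i") (simp_all add: mult.assoc)
    show ?thesis
      unfolding 1 2 3 4 by (cases "l = i") (simp_all add: left_diff_distrib sum_distrib_right mult.assoc)
  qed
  then have "br (q i \<and> q j) (R i) (\<Sum>l\<in>{1..M}. W j l * d l)
     = (\<Sum>l\<in>{1..M}. sg (q j \<and> par j l) * (W i l * d j * d l))
      - (\<Sum>k\<in>{1..M}. sg (q i \<and> par j i) * (W j k * d k * d i))
      + (\<Sum>l\<in>{1..M}. sg (q i \<and> par j l) * (sg (q i) * (W j l * d i * d l)))"
    using assms by (simp add: br_sum_right sum.distrib sum_subtractf sum.delta)
  also have "(\<Sum>l\<in>{1..M}. sg (q i \<and> par j l) * (sg (q i) * (W j l * d i * d l)))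
      = (\<Sum>k\<in>{1..M}. sg (q i \<and> par j i) * (W j k * d k * d i))"
  proof (rule sum.cong[OF refl])
    fix k
    show "sg (q i \<and> par j k) * (sg (q i) * (W j k * d i * d k)) = sg (q i \<and> par j i) * (W j k * d k * d i)"
      by (cases "q i"; cases "q j"; cases "q k") (simp_all add: par_q mult.assoc d_swap[of k i])
  qed
  finally have 1: "br (q i \<and> q j) (R i) (\<Sum>l\<in>{1..M}. W j l * d l)
     = (\<Sum>l\<in>{1..M}. sg (q j \<and> par j l) * (W i l * d j * d l))" by simp
  have "br False (R i) NN = R i"
    using NN_R[of i] br_swap[of False "R i" NN] assms by simp
  then have "br (q i \<and> q j) (R i) (NN * d j) = R i * d j + sg (q i) * (NN * (d i * d j))"
    using R_d[OF assms] by (subst br_mult_right[of _ False "q i \<and> q j"]) (auto simp: sg_def)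
  also have "\<dots> = (\<Sum>k\<in>{1..M}. W i k * d k * d j)"
    by (simp add: R_def left_diff_distrib sum_distrib_right mult.assoc)
  finally have 2: "sg (q j) * br (q i \<and> q j) (R i) (NN * d j)
     = (\<Sum>l\<in>{1..M}. sg (q j \<and> par j l) * (W i l * d j * d l))"
  proof -
    assume "br (q i \<and> q j) (R i) (NN * d j) = (\<Sum>k\<in>{1..M}. W i k * d k * d j)"
    moreover have "sg (q j) * (W i k * d k * d j) = sg (q j \<and> par j k) * (W i k * d j * d k)" for k
      by (cases "q j"; cases "q k") (simp_all add: par_q mult.assoc d_swap[of k j])
    ultimately show ?thesis by (simp add: sum_distrib_left)
  qed
  show ?thesis
    unfolding R_def[of j] br_diff_right br_sg_right 1 2 by simp
qed

definition F :: "nat \<Rightarrow> nat \<Rightarrow> 'a" where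
  "F i j = (if i = N then (if j = N then NN else y j) else if j = N then R i else E i j)"

text \<open>Each of the four indices is \<open>N\<close> or smaller, which makes sixteen cases. Each
  is a bracket already known or, through \<open>s1\<close> to \<open>s6\<close>, the mirror image of
  one.\<close>

lemma F_F:
  assumes "{i, j, k, l} \<subseteq> {1..N}"
  shows "br (par i j \<and> par k l) (F i j) (F k l)
    = (if j = k then F i l else 0) - sg (par i j \<and> par k l) * (if l = i then F k j else 0)"
proof -
  have N: "x \<in> {1..M} \<longleftrightarrow> x \<noteq> N" if "x \<in> {1..N}" for x
    using that by (auto simp: N_def)
  have pN: "par N x = q x" "par x N = q x" "q N = False" for x
    by (auto simp: par_def q_def)
  have sw: "br s b a = - sg s * c'" if "br s a b = c'" for s a b c'
    using that br_swap[of s b a] by simp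
  have s1: "br (par i j \<and> q k) (y k) (E i j) = (if k = i then y j else 0)" if "{i, j, k} \<subseteq> {1..M}" for i j k
    using sw[of "par i j \<and> q k" "E i j" "y k", OF E_y[OF that]] by simp
  have s2: "br False (y k) NN = - y k" if "k \<in> {1..M}" for k
    using sw[OF NN_y[OF that]] by simp
  have s3: "br False (E i j) NN = 0" if "{i, j} \<subseteq> {1..M}" for i j
    using sw[OF NN_E[OF that]] by simp
  have s4: "br False (R k) NN = R k" if "k \<in> {1..M}" for k
    using sw[OF NN_R[OF that]] by simp
  have s5: "br (q i \<and> q k) (y k) (R i) = (if k = i then NN else 0) - sg (q i \<and> q k) * E i k" if "{i, k} \<subseteq> {1..M}" for i k
    using sw[of "q i \<and> q k", OF R_y[OF that]] by (simp add: algebra_simps)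
  have s6: "br (par i j \<and> q k) (R k) (E i j) = (if j = k then - sg (par i j \<and> q k) * R i else 0)" if "{i, j, k} \<subseteq> {1..M}" for i j k
    using sw[of "par i j \<and> q k" "E i j" "R k", OF E_R[OF that]] by simp
  note cj = conj_commute
  show ?thesis
    using assms N[of i] N[of j] N[of k] N[of l]
      E_E[of i j k l] E_y[of i j l] E_R[of i j k] NN_y[of l] NN_E[of k l] NN_R[of k] s3[of i j]
      R_y[of i l] R_R[of i k] s1[of k l j] s2[of j] s4[of i] s5[of k j] s6[of k l i] yy[of j l] br_self[of NN]
    by (cases "i = N"; cases "j = N"; cases "k = N"; cases "l = N")
      (auto simp: F_def pN cj)
qed

end

section \<open>Operators on Fock space\<close>

text \<open>A vector assigns a coefficient to every multiplicity function on the positions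
  \<open>(i, j)\<close>. Arbitrary families make sense because each coefficient of the image under a
  creation or annihilation operator depends on a single coefficient of the argument.\<close>

type_synonym vec = "(nat \<times> nat \<Rightarrow> nat) \<Rightarrow> complex"

definition smul :: "complex \<Rightarrow> vec \<Rightarrow> vec" where
  "smul c v = (\<lambda>k. c * v k)"

lemma smul_simps: "smul c (v + w) = smul c v + smul c w" "smul c (v - w) = smul c v - smul c w"
  "smul c (- v) = - smul c v" "smul c 0 = 0" "smul c (smul d v) = smul (c * d) v" "smul c v k = c * v k"
  by (simp_all add: smul_def fun_eq_iff algebra_simps)

text \<open>Linear operators get a type of their own so that they form an instance of
  \<open>ring_1\<close>, as \<open>gl_step\<close> and \<open>monoid_algebra_hom\<close> require of
  their target.\<close>

typedef endo = "{F :: vec \<Rightarrow> vec. (\<forall>x y. F (x + y) = F x + F y) \<and> (\<forall>c x. F (smul c x) = smul c (F x))}"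
  morphisms app Endo
  by (rule exI[of _ "\<lambda>x. x"]) simp

setup_lifting type_definition_endo

instantiation endo :: ring_1
begin
lift_definition zero_endo :: endo is "\<lambda>_. 0" by (simp add: smul_simps)
lift_definition one_endo :: endo is "\<lambda>x. x" by simp
lift_definition plus_endo :: "endo \<Rightarrow> endo \<Rightarrow> endo" is "\<lambda>F G x. F x + G x" by (simp add: algebra_simps smul_simps)
lift_definition minus_endo :: "endo \<Rightarrow> endo \<Rightarrow> endo" is "\<lambda>F G x. F x - G x" by (simp add: algebra_simps smul_simps)
lift_definition uminus_endo :: "endo \<Rightarrow> endo" is "\<lambda>F x. - F x" by (simp add: smul_simps)
lift_definition times_endo :: "endo \<Rightarrow> endo \<Rightarrow> endo" is "\<lambda>F G x. F (G x)" by simp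
instance
proof
  fix a b c :: endo
  show "a * b * c = a * (b * c)" by transfer simp
  show "1 * a = a" by transfer simp
  show "a * 1 = a" by transfer simp
  show "a + b + c = a + (b + c)" by transfer (simp add: add.assoc)
  show "a + b = b + a" by transfer (simp add: add.commute)
  show "0 + a = a" by transfer simp
  show "- a + a = 0" by transfer simp
  show "a - b = a + - b" by transfer (simp add: fun_eq_iff)
  show "(a + b) * c = a * c + b * c" by transfer simp
  show "a * (b + c) = a * b + a * c" by transfer simp
  show "(0 :: endo) \<noteq> 1"
  proof transfer
    show "(\<lambda>_ :: vec. 0 :: vec) \<noteq> (\<lambda>x. x)"
    proof
      assume "(\<lambda>_ :: vec. 0 :: vec) = (\<lambda>x. x)"
      from fun_cong[OF fun_cong[OF this, of "\<lambda>_. 1"], of undefined] show False by simp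
    qed
  qed
qed
end

lemma endo_eqI: "(\<And>v k. app a v k = app b v k) \<Longrightarrow> a = b"
  by transfer (auto simp: fun_eq_iff)

lemma app_simps [simp]:
  "app 0 v = 0" "app 1 v = v" "app (a + b) v = app a v + app b v" "app (a - b) v = app a v - app b v"
  "app (- a) v = - app a v" "app (a * b) v = app a (app b v)"
  by (transfer, simp)+

lemma app_add: "app a (v + w) = app a v + app a w"
  using app[of a] by simp

lemma app_smul: "app a (smul c v) = smul c (app a v)"
  using app[of a] by simp

lemma app_zero [simp]: "app a 0 = 0"
  using app_add[of a 0 0] by simp

lemma app_sum: "app (sum f A) v = (\<Sum>x\<in>A. app (f x) v)"
  by (induction A rule: infinite_finite_induct) auto

lift_definition cst :: "complex \<Rightarrow> endo" is smul
  by (simp add: smul_simps mult.commute)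

lemma app_cst [simp]: "app (cst c) v = smul c v"
  by transfer simp

lemma cst_commute: "cst c * x = x * cst c"
  by (rule endo_eqI) (simp add: app_smul)

lemma cst_hom: "cst (a + b) = cst a + cst b" "cst (a * b) = cst a * cst b" "cst 1 = 1"
  by (rule endo_eqI; simp add: smul_simps algebra_simps)+

section \<open>Creation and annihilation operators\<close>

definition jw_set :: "nat \<Rightarrow> nat \<times> nat \<Rightarrow> (nat \<times> nat) set" where
  "jw_set m p = {r. odd_root m r \<and> prod_encode r < prod_encode p}"

text \<open>The Jordan--Wigner sign makes the operators at different odd positions anticommute.\<close>

definition jw :: "nat \<Rightarrow> nat \<times> nat \<Rightarrow> (nat \<times> nat \<Rightarrow> nat) \<Rightarrow> complex" where
  "jw m p k = (-1) ^ (\<Sum>r\<in>jw_set m p. k r)"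

text \<open>Without finiteness the exponent in \<open>jw\<close> would be a sum over an infinite
  set, hence 0, and the sign would be lost. \<open>prod_encode\<close> supplies a linear order with
  finite initial segments.\<close>

lemma finite_jw_set: "finite (jw_set m p)"
proof (rule finite_subset)
  show "jw_set m p \<subseteq> prod_encode -` {..<prod_encode p}" by (auto simp: jw_set_def)
  show "finite (prod_encode -` {..<prod_encode p} :: (nat \<times> nat) set)"
    by (rule finite_vimageI) (auto simp: inj_prod_encode)
qed

lemma jw_other: "r \<notin> jw_set m p \<Longrightarrow> jw m p (k(r := x)) = jw m p k"
  unfolding jw_def by (rule arg_cong[of _ _ "\<lambda>z. (-1) ^ z"]) (auto intro!: sum.cong)

lemma jw_flip:
  assumes "r \<in> jw_set m p" "even x \<noteq> even (k r)"
  shows "jw m p (k(r := x)) = - jw m p k"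
proof -
  have split: "sum f (jw_set m p) = f r + sum f (jw_set m p - {r})" for f :: "nat \<times> nat \<Rightarrow> nat"
    by (rule sum.remove) (use assms finite_jw_set in auto)
  have rest: "sum (k(r := x)) (jw_set m p - {r}) = sum k (jw_set m p - {r})"
    by (rule sum.cong) auto
  have "(-1) ^ x = - ((-1) ^ k r :: complex)"
    using assms(2) by (cases "even x") auto
  then show ?thesis
    unfolding jw_def split[of k] split[of "k(r := x)"] rest by (simp add: power_add)
qed

lemma jw_self [simp]: "jw m p (k(p := x)) = jw m p k"
  by (rule jw_other) (auto simp: jw_set_def)

lemma jw_jw [simp]: "jw m p k * jw m p k = 1" "jw m p k * (jw m p k * z) = z"
proof -
  show "jw m p k * jw m p k = 1"
    by (simp add: jw_def power_mult_distrib[symmetric])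
  then show "jw m p k * (jw m p k * z) = z"
    by (simp add: mult.assoc[symmetric])
qed

text \<open>Of two distinct odd positions exactly one precedes the other. Exchanging their operators
  therefore alters exactly one of the two signs, which yields anticommutation.\<close>

lemma jw_cases: "p \<noteq> r \<Longrightarrow> odd_root m p \<Longrightarrow> odd_root m r \<Longrightarrow>
    p \<in> jw_set m r \<and> r \<notin> jw_set m p \<or> r \<in> jw_set m p \<and> p \<notin> jw_set m r"
proof -
  assume "p \<noteq> r" "odd_root m p" "odd_root m r"
  moreover have "prod_encode p \<noteq> prod_encode r" using \<open>p \<noteq> r\<close> by (simp add: prod_encode_eq)
  then have "prod_encode p < prod_encode r \<or> prod_encode r < prod_encode p" by linarith
  ultimately show ?thesis unfolding jw_set_def mem_Collect_eq by linarith
qed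

text \<open>At an odd position only the parity of \<open>k p\<close> counts: the multiplicities 2a
  and 2a+1 carry a copy of the exterior algebra in one variable, so the relations hold on all
  multiplicity functions, also on those exceeding 1 there. At an even position this is
  multiplication by a variable, and \<open>ann\<close> is its derivative.\<close>

lift_definition cre :: "nat \<Rightarrow> nat \<times> nat \<Rightarrow> endo" is
  "\<lambda>m p v k. if odd_root m p then (if odd (k p) then jw m p k * v (k(p := k p - 1)) else 0)
     else if k p = 0 then 0 else v (k(p := k p - 1))"
  by (auto simp: fun_eq_iff smul_simps algebra_simps)

lift_definition ann :: "nat \<Rightarrow> nat \<times> nat \<Rightarrow> endo" is
  "\<lambda>m p v k. if odd_root m p then (if even (k p) then jw m p k * v (k(p := k p + 1)) else 0)
     else of_nat (k p + 1) * v (k(p := k p + 1))"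
  by (auto simp: fun_eq_iff smul_simps algebra_simps)

lemma app_cre: "app (cre m p) v k =
   (if odd_root m p then (if odd (k p) then jw m p k * v (k(p := k p - 1)) else 0)
     else if k p = 0 then 0 else v (k(p := k p - 1)))"
  by transfer simp

lemma app_ann: "app (ann m p) v k =
   (if odd_root m p then (if even (k p) then jw m p k * v (k(p := k p + 1)) else 0)
     else of_nat (k p + 1) * v (k(p := k p + 1)))"
  by transfer simp

lemma jw_shift:
  assumes "odd_root m p"
  shows "odd (k p) \<Longrightarrow> jw m r (k(p := k p - Suc 0)) = (if p \<in> jw_set m r then - jw m r k else jw m r k)"
    and "even (k p) \<Longrightarrow> jw m r (k(p := Suc (k p))) = (if p \<in> jw_set m r then - jw m r k else jw m r k)"
  by (auto intro: jw_other jw_flip)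

lemma jw_even_root: "\<not> odd_root m p \<Longrightarrow> jw m r (k(p := x)) = jw m r k"
  by (rule jw_other) (auto simp: jw_set_def)

lemma cre_cre: "br (odd_root m p \<and> odd_root m r) (cre m p) (cre m r) = 0"
proof (cases "p = r")
  case True
  then show ?thesis
    by (cases "odd_root m r") (auto intro!: endo_eqI simp: br_def app_cre)
next
  case False
  then show ?thesis
    using jw_cases[OF False, of m]
    by (intro endo_eqI; cases "odd_root m p"; cases "odd_root m r")
      (auto simp: br_def app_cre jw_shift jw_even_root fun_upd_twist[OF False])
qed

lemma ann_ann: "br (odd_root m p \<and> odd_root m r) (ann m p) (ann m r) = 0"
proof (cases "p = r")
  case True
  then show ?thesis
    by (cases "odd_root m r") (auto intro!: endo_eqI simp: br_def app_ann)
next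
  case False
  then show ?thesis
    using jw_cases[OF False, of m]
    by (intro endo_eqI; cases "odd_root m p"; cases "odd_root m r")
      (auto simp: br_def app_ann jw_shift jw_even_root fun_upd_twist[OF False])
qed

lemma ann_cre: "br (odd_root m p \<and> odd_root m r) (ann m p) (cre m r) = (if p = r then 1 else 0)"
proof (cases "p = r")
  case True
  then show ?thesis
    by (cases "odd_root m r") (auto intro!: endo_eqI simp: br_def app_ann app_cre algebra_simps)
next
  case False
  then show ?thesis
    using jw_cases[OF False, of m]
    by (simp, intro endo_eqI; cases "odd_root m p"; cases "odd_root m r")
      (auto simp: br_def app_ann app_cre jw_shift jw_even_root fun_upd_twist[OF False])
qed

lemma br_cst: "br False (cst c) x = 0"
  by (simp add: br_def cst_commute)

section \<open>Highest weight modules on Fock space\<close>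

context gl_step
begin

text \<open>\<open>F\<close> is a polynomial in the \<open>W\<close>, \<open>y\<close>,
  \<open>d\<close> and the central \<open>c\<close>, so it inherits supercommutation with an element
  \<open>z\<close> of parity \<open>t\<close>. With \<open>z\<close> a creation or annihilation
  operator of a higher row, this supplies \<open>Wy\<close> and \<open>Wd\<close> for the next
  size.\<close>

lemma F_supercommute:
  assumes W: "\<And>i j. {i, j} \<subseteq> {1..M} \<Longrightarrow> br (par i j \<and> t) (W i j) z = 0"
    and y: "\<And>k. br (q k \<and> t) (y k) z = 0"
    and d: "\<And>k. br (q k \<and> t) (d k) z = 0"
    and "{i, j} \<subseteq> {1..N}"
  shows "br (par i j \<and> t) (F i j) z = 0"
proof -
  have yd: "br (par b a \<and> t) (y a * d b) z = 0" for a b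
    by (subst br_mult_left[of _ "q a \<and> t" "q b \<and> t"]) (auto simp: par_q y d)
  have "br False (y k * d k) z = 0" for k
    by (subst br_mult_left[of _ "q k \<and> t" "q k \<and> t"]) (auto simp: y d)
  then have NN: "br False NN z = 0"
    by (simp add: NN_def br_add_left br_sum_left cc)
  have Wd: "br (q a \<and> t) (W a k * d k) z = 0" if "{a, k} \<subseteq> {1..M}" for a k
    using W[OF that] by (subst br_mult_left[of _ "par a k \<and> t" "q k \<and> t"]) (auto simp: par_q d)
  have "br (q a \<and> t) (NN * d a) z = 0" for a
    by (subst br_mult_left[of _ False "q a \<and> t"]) (auto simp: NN d)
  then have R: "br (q a \<and> t) (R a) z = 0" if "a \<in> {1..M}" for a
    using that by (simp add: R_def br_diff_left br_sum_left br_sg_left Wd)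
  have E: "br (par a b \<and> t) (E a b) z = 0" if "{a, b} \<subseteq> {1..M}" for a b
    using W[OF that] by (simp add: E_def br_diff_left br_sg_left yd)
  have "x \<in> {1..M}" if "x \<in> {1..N}" "x \<noteq> N" for x
    using that by (auto simp: N_def)
  moreover have "par N x = q x" "par x N = q x" "q N = False" for x
    by (auto simp: par_def q_def)
  ultimately show ?thesis
    using assms(4) NN R E y unfolding F_def by (cases "i = N"; cases "j = N") auto
qed

end

lemma odd_root_pair: "odd_root m (i, j) \<longleftrightarrow> (i \<le> m) \<noteq> (j \<le> m)"
  by (simp add: odd_root_def odd_unit_def)

text \<open>Position \<open>(Suc M, k)\<close> of Fock space stands for the lowering operator
  e_{M+1,k}; the step to size \<open>Suc M\<close> brings in the positions of row
  \<open>Suc M\<close>. Indices out of range give 0, matching the generators that the relators of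
  U(g) remove.\<close>

fun gl_op :: "nat \<Rightarrow> weight \<Rightarrow> nat \<Rightarrow> nat \<Rightarrow> nat \<Rightarrow> endo" where
  "gl_op m l 0 i j = 0"
| "gl_op m l (Suc M) i j =
    (if {i, j} \<subseteq> {1..Suc M}
     then gl_step.F (\<lambda>i. i \<le> m) M (gl_op m l M) (\<lambda>k. cre m (Suc M, k)) (\<lambda>k. ann m (Suc M, k)) (cst (l (Suc M))) i j
     else 0)"

declare gl_op.simps(2) [simp del]

text \<open>The relations at size \<open>M\<close> can be carried on only if the operators of size
  \<open>M\<close> also supercommute with creation and annihilation in all rows above
  \<open>M\<close>; hence \<open>?A\<close> and \<open>?B\<close> are proved in one
  induction.\<close>

lemma gl_op_br: "{i, j, k, k'} \<subseteq> {1..M} \<Longrightarrow>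
      br (odd_root m (i, j) \<and> odd_root m (k, k')) (gl_op m l M i j) (gl_op m l M k k')
      = (if j = k then gl_op m l M i k' else 0)
         - sg (odd_root m (i, j) \<and> odd_root m (k, k')) * (if k' = i then gl_op m l M k j else 0)"
  and gl_step_gl_op: "gl_step (\<lambda>i. i \<le> m) M (gl_op m l M)
      (\<lambda>k. cre m (Suc M, k)) (\<lambda>k. ann m (Suc M, k)) (cst (l (Suc M)))"
proof -
  let ?A = "\<lambda>M. \<forall>i j k k'. {i, j, k, k'} \<subseteq> {1..M} \<longrightarrow>
      br (odd_root m (i, j) \<and> odd_root m (k, k')) (gl_op m l M i j) (gl_op m l M k k')
      = (if j = k then gl_op m l M i k' else 0)
         - sg (odd_root m (i, j) \<and> odd_root m (k, k')) * (if k' = i then gl_op m l M k j else 0)"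
  let ?B = "\<lambda>M z. \<forall>r k i j. M < r \<longrightarrow> {i, j} \<subseteq> {1..M} \<longrightarrow>
      br (odd_root m (i, j) \<and> odd_root m (r, k)) (gl_op m l M i j) (z (r, k)) = 0"
  have step: "gl_step (\<lambda>i. i \<le> m) M (gl_op m l M)
      (\<lambda>k. cre m (Suc M, k)) (\<lambda>k. ann m (Suc M, k)) (cst (l (Suc M)))"
    if "?A M \<and> ?B M (cre m) \<and> ?B M (ann m)" for M
  proof (unfold_locales, goal_cases)
    case (1 i j k l)
    then show ?case using that by (auto simp: odd_root_pair)
  next
    case (2 i j k)
    then show ?case using that[THEN conjunct2, THEN conjunct1, rule_format, of "Suc M" i j k]
      by (simp add: odd_root_pair)
  next
    case (3 i j k)
    then show ?case using that[THEN conjunct2, THEN conjunct2, rule_format, of "Suc M" i j k]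
      by (simp add: odd_root_pair)
  next
    case (4 i k)
    then show ?case using cre_cre[of m "(Suc M, i)" "(Suc M, k)"] by (simp add: odd_root_pair)
  next
    case (5 i k)
    then show ?case using ann_ann[of m "(Suc M, i)" "(Suc M, k)"] by (simp add: odd_root_pair)
  next
    case (6 i k)
    then show ?case using ann_cre[of m "(Suc M, i)" "(Suc M, k)"] by (simp add: odd_root_pair)
  next
    case (7 x)
    then show ?case by (rule br_cst)
  qed
  have all: "?A M \<and> ?B M (cre m) \<and> ?B M (ann m)" for M
  proof (induction M)
    case 0
    then show ?case by auto
  next
    case (Suc M)
    interpret gl_step "\<lambda>i. i \<le> m" M "gl_op m l M" "\<lambda>k. cre m (Suc M, k)" "\<lambda>k. ann m (Suc M, k)" "cst (l (Suc M))"
      "Suc M" "\<lambda>i j. (i \<le> m) \<noteq> (j \<le> m)" "\<lambda>i. (Suc M \<le> m) \<noteq> (i \<le> m)"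
      by (rule step[OF Suc.IH])
    have op: "gl_op m l (Suc M) i j = F i j" if "{i, j} \<subseteq> {1..Suc M}" for i j
      using that by (simp add: gl_op.simps(2))
    have A: "?A (Suc M)"
    proof (intro allI impI)
      fix i j k k' assume *: "{i, j, k, k'} \<subseteq> {1..Suc M}"
      then have "gl_op m l (Suc M) i j = F i j" "gl_op m l (Suc M) k k' = F k k'"
        "gl_op m l (Suc M) i k' = F i k'" "gl_op m l (Suc M) k j = F k j"
        by (auto intro!: op)
      then show "br (odd_root m (i, j) \<and> odd_root m (k, k')) (gl_op m l (Suc M) i j) (gl_op m l (Suc M) k k')
      = (if j = k then gl_op m l (Suc M) i k' else 0)
         - sg (odd_root m (i, j) \<and> odd_root m (k, k')) * (if k' = i then gl_op m l (Suc M) k j else 0)"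
        unfolding odd_root_pair using F_F[OF *] by presburger
    qed
    have B: "?B (Suc M) z" if IH: "?B M z"
      and yz: "\<And>p r. p \<noteq> r \<Longrightarrow> br (odd_root m p \<and> odd_root m r) (cre m p) (z r) = 0"
      and dz: "\<And>p r. p \<noteq> r \<Longrightarrow> br (odd_root m p \<and> odd_root m r) (ann m p) (z r) = 0" for z
    proof (intro allI impI)
      fix r k i j assume r: "Suc M < r" and ij: "{i, j} \<subseteq> {1..Suc M}"
      have "br (((i \<le> m) \<noteq> (j \<le> m)) \<and> odd_root m (r, k)) (F i j) (z (r, k)) = 0"
      proof (rule F_supercommute[OF _ _ _ ij])
        show "br (((i \<le> m) \<noteq> (j \<le> m)) \<and> odd_root m (r, k)) (gl_op m l M i j) (z (r, k)) = 0"
          if "{i, j} \<subseteq> {1..M}" for i j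
          using IH[rule_format, of r i j k] that r by (simp add: odd_root_pair)
        show "br (((Suc M \<le> m) \<noteq> (k' \<le> m)) \<and> odd_root m (r, k)) (cre m (Suc M, k')) (z (r, k)) = 0" for k'
          using yz[of "(Suc M, k')" "(r, k)"] r by (simp add: odd_root_pair)
        show "br (((Suc M \<le> m) \<noteq> (k' \<le> m)) \<and> odd_root m (r, k)) (ann m (Suc M, k')) (z (r, k)) = 0" for k'
          using dz[of "(Suc M, k')" "(r, k)"] r by (simp add: odd_root_pair)
      qed
      then show "br (odd_root m (i, j) \<and> odd_root m (r, k)) (gl_op m l (Suc M) i j) (z (r, k)) = 0"
        unfolding op[OF ij] odd_root_pair[of m i j] .
    qed
    have cre_ann: "br (odd_root m p \<and> odd_root m r) (cre m p) (ann m r) = 0" if "p \<noteq> r" for p r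
    proof -
      have c: "(odd_root m p \<and> odd_root m r) = (odd_root m r \<and> odd_root m p)" by blast
      show ?thesis unfolding c br_swap[of _ "cre m p"] ann_cre using that by simp
    qed
    have "?B (Suc M) (cre m)"
      by (rule B) (use Suc.IH in blast, rule cre_cre, simp add: ann_cre)
    moreover have "?B (Suc M) (ann m)"
      by (rule B) (use Suc.IH in blast, erule cre_ann, rule ann_ann)
    ultimately show ?case using A by blast
  qed
  show "{i, j, k, k'} \<subseteq> {1..M} \<Longrightarrow>
      br (odd_root m (i, j) \<and> odd_root m (k, k')) (gl_op m l M i j) (gl_op m l M k k')
      = (if j = k then gl_op m l M i k' else 0)
         - sg (odd_root m (i, j) \<and> odd_root m (k, k')) * (if k' = i then gl_op m l M k j else 0)"
    using all[of M, THEN conjunct1] by blast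
  show "gl_step (\<lambda>i. i \<le> m) M (gl_op m l M)
      (\<lambda>k. cre m (Suc M, k)) (\<lambda>k. ann m (Suc M, k)) (cst (l (Suc M)))"
    by (rule step[OF all])
qed

lemma app_sg: "app (sg s * a) v = (if s then - app a v else app a v)"
  by (simp add: sg_def)

lemma gl_op_diag: "gl_op m l (Suc M) (Suc M) (Suc M)
    = cst (l (Suc M)) + (\<Sum>k\<in>{1..M}. cre m (Suc M, k) * ann m (Suc M, k))"
  by (simp add: gl_op.simps(2) gl_step.F_def[OF gl_step_gl_op] gl_step.NN_def[OF gl_step_gl_op])

lemma gl_op_last_row: "j \<in> {1..M} \<Longrightarrow> gl_op m l (Suc M) (Suc M) j = cre m (Suc M, j)"
  by (simp add: gl_op.simps(2) gl_step.F_def[OF gl_step_gl_op])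

lemma gl_op_last_column: "i \<in> {1..M} \<Longrightarrow> gl_op m l (Suc M) i (Suc M)
    = (\<Sum>k\<in>{1..M}. gl_op m l M i k * ann m (Suc M, k))
       - sg ((Suc M \<le> m) \<noteq> (i \<le> m)) * (gl_op m l (Suc M) (Suc M) (Suc M) * ann m (Suc M, i))"
  by (simp add: gl_op_diag gl_op.simps(2) gl_step.F_def[OF gl_step_gl_op] gl_step.R_def[OF gl_step_gl_op]
      gl_step.NN_def[OF gl_step_gl_op])

lemma gl_op_smaller: "{i, j} \<subseteq> {1..M} \<Longrightarrow> gl_op m l (Suc M) i j
    = gl_op m l M i j - sg (((i \<le> m) \<noteq> (j \<le> m)) \<and> ((Suc M \<le> m) \<noteq> (i \<le> m))) * (cre m (Suc M, j) * ann m (Suc M, i))"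
  by (simp add: gl_op.simps(2) gl_step.F_def[OF gl_step_gl_op] gl_step.E_def[OF gl_step_gl_op])

lemma gl_op_outside: "\<not> {i, j} \<subseteq> {1..M} \<Longrightarrow> gl_op m l M i j = 0"
  by (cases M) (simp_all only: gl_op.simps if_False)

section \<open>The vacuum as a highest weight vector\<close>

definition no_row_above :: "nat \<Rightarrow> nat \<Rightarrow> vec \<Rightarrow> bool" where
  "no_row_above m r v \<longleftrightarrow> (\<forall>R k. r < R \<longrightarrow> app (ann m (R, k)) v = 0)"

lemma no_row_above_mono: "no_row_above m r v \<Longrightarrow> r \<le> r' \<Longrightarrow> no_row_above m r' v"
  by (auto simp: no_row_above_def)

text \<open>Each enlargement by an index adds to e_{i,j} only a term ending in an annihilator of the
  new row.\<close>

lemma gl_op_restrict: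
  assumes "no_row_above m r v" "{i, j} \<subseteq> {1..r}" "r \<le> M"
  shows "app (gl_op m l M i j) v = app (gl_op m l r i j) v"
  using assms(3)
proof (induction M rule: dec_induct)
  case (step M)
  have ij: "{i, j} \<subseteq> {1..M}" using assms(2) step by auto
  have "app (ann m (Suc M, i)) v = 0" using assms(1) step by (simp add: no_row_above_def)
  then show ?case unfolding gl_op_smaller[OF ij] step(3)[symmetric] by (simp add: app_sg)
qed simp

lemma gl_op_lowering:
  assumes "no_row_above m i v" "j \<in> {1..<i}" "i \<le> M"
  shows "app (gl_op m l M i j) v = app (cre m (i, j)) v"
proof -
  obtain r where r: "i = Suc r" using assms(2) by (cases i) auto
  have "app (gl_op m l M i j) v = app (gl_op m l i i j) v"
    by (rule gl_op_restrict) (use assms in auto)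
  then show ?thesis using assms(2) gl_op_last_row[of j r m l] by (simp add: r)
qed

lemma no_row_above_cre:
  assumes "no_row_above m i v"
  shows "no_row_above m i (app (cre m (i, j)) v)"
  unfolding no_row_above_def
proof (intro allI impI)
  fix R k assume "i < R"
  then have z: "app (ann m (R, k)) v = 0" using assms by (simp add: no_row_above_def)
  have "br (odd_root m (R, k) \<and> odd_root m (i, j)) (ann m (R, k)) (cre m (i, j)) = 0"
    using \<open>i < R\<close> by (simp add: ann_cre)
  then have "ann m (R, k) * cre m (i, j)
      = sg (odd_root m (R, k) \<and> odd_root m (i, j)) * (cre m (i, j) * ann m (R, k))"
    by (simp add: br_def)
  then have "app (ann m (R, k) * cre m (i, j)) v
      = app (sg (odd_root m (R, k) \<and> odd_root m (i, j)) * (cre m (i, j) * ann m (R, k))) v"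
    by (rule arg_cong)
  then show "app (ann m (R, k)) (app (cre m (i, j)) v) = 0"
    by (simp add: app_sg z)
qed

definition unit_vec :: "(nat \<times> nat \<Rightarrow> nat) \<Rightarrow> vec" where
  "unit_vec a = (\<lambda>k. if k = a then 1 else 0)"

definition vacuum :: vec where
  "vacuum = unit_vec (\<lambda>_. 0)"

lemma no_row_above_vacuum: "no_row_above m 0 vacuum"
proof -
  have "k(p := Suc (k p)) \<noteq> (\<lambda>_. 0)" for k :: "nat \<times> nat \<Rightarrow> nat" and p
    by (metis fun_upd_same nat.distinct(1))
  then show ?thesis
    by (auto simp: no_row_above_def vacuum_def unit_vec_def app_ann fun_eq_iff[of "app _ _"])
qed

text \<open>At size \<open>j\<close> the operator e_{i,j} belongs to the last column, all of whose
  terms end in an annihilator.\<close>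

lemma gl_op_raising_vacuum:
  assumes "i \<in> {1..<j}" "j \<le> M"
  shows "app (gl_op m l M i j) vacuum = 0"
proof -
  obtain r where r: "j = Suc r" using assms(1) by (cases j) auto
  have a: "app (ann m (Suc r, k)) vacuum = 0" for k
    using no_row_above_vacuum by (simp add: no_row_above_def)
  have "app (gl_op m l M i j) vacuum = app (gl_op m l j i j) vacuum"
    by (rule gl_op_restrict[OF no_row_above_mono[OF no_row_above_vacuum]]) (use assms in auto)
  also have "\<dots> = app (gl_op m l (Suc r) i (Suc r)) vacuum" by (simp add: r)
  also have "\<dots> = 0"
    by (subst gl_op_last_column) (use assms in \<open>auto simp: r app_sum app_sg a\<close>)
  finally show ?thesis .
qed

lemma gl_op_diag_vacuum:
  assumes "i \<in> {1..M}"
  shows "app (gl_op m l M i i) vacuum = smul (l i) vacuum"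
proof -
  obtain r where r: "i = Suc r" using assms(1) by (cases i) auto
  have a: "app (ann m (Suc r, k)) vacuum = 0" for k
    using no_row_above_vacuum by (simp add: no_row_above_def)
  have "app (gl_op m l M i i) vacuum = app (gl_op m l i i i) vacuum"
    by (rule gl_op_restrict[OF no_row_above_mono[OF no_row_above_vacuum]]) (use assms in auto)
  also have "\<dots> = smul (l i) vacuum"
    unfolding r gl_op_diag by (simp add: app_sum a)
  finally show ?thesis .
qed

text \<open>The rightmost factor acts first and the rows increase to the left. So each e_{a,b} meets
  a vector with no row above \<open>a\<close> occupied, where it is a plain creation
  operator.\<close>

lemma gl_op_path_vacuum:
  assumes "sorted_wrt (\<lambda>a b. fst b < fst a) ps" "\<forall>(a, b)\<in>set ps. 1 \<le> b \<and> b < a \<and> a \<le> M"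
  shows "app (prod_list (map (\<lambda>(a, b). gl_op m l M a b) ps)) vacuum
      = app (prod_list (map (cre m) ps)) vacuum
    \<and> no_row_above m (if ps = [] then 0 else fst (hd ps)) (app (prod_list (map (cre m) ps)) vacuum)"
  using assms
proof (induction ps)
  case Nil
  then show ?case by (simp add: no_row_above_vacuum)
next
  case (Cons p ps)
  obtain a b where p: "p = (a, b)" by force
  let ?w = "app (prod_list (map (cre m) ps)) vacuum"
  have IH: "app (prod_list (map (\<lambda>(a, b). gl_op m l M a b) ps)) vacuum = ?w"
    and w: "no_row_above m (if ps = [] then 0 else fst (hd ps)) ?w"
    using Cons by auto
  have "(if ps = [] then 0 else fst (hd ps)) \<le> a"
    using Cons.prems by (cases ps) (auto simp: p)
  with w have w': "no_row_above m a ?w" by (rule no_row_above_mono)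
  have "app (gl_op m l M a b) ?w = app (cre m (a, b)) ?w"
    by (rule gl_op_lowering[OF w']) (use Cons.prems in \<open>auto simp: p\<close>)
  then show ?case using no_row_above_cre[OF w', of b] by (simp add: p IH)
qed

lemma cre_unit_vec:
  assumes "a p = 0"
  shows "\<exists>s. s \<noteq> 0 \<and> app (cre m p) (unit_vec a) = smul s (unit_vec (a(p := 1)))"
proof (intro exI conjI)
  let ?s = "if odd_root m p then jw m p a else 1"
  show "?s \<noteq> 0" by (simp add: jw_def)
  show "app (cre m p) (unit_vec a) = smul ?s (unit_vec (a(p := 1)))"
  proof
    fix k
    show "app (cre m p) (unit_vec a) k = smul ?s (unit_vec (a(p := 1))) k"
    proof (cases "k = a(p := 1)")
      case True
      moreover have "a(p := 0) = a" using assms by (rule fun_upd_idem)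
      ultimately show ?thesis using assms by (simp add: app_cre unit_vec_def smul_def)
    next
      case False
      have "k(p := k p - 1) \<noteq> a" if "k p \<noteq> 0"
      proof
        assume eq: "k(p := k p - 1) = a"
        have "k p - 1 = 0" using fun_cong[OF eq, of p] assms by (simp only: fun_upd_same)
        with that have "k p = 1" by linarith
        then have "k = a(p := 1)" by (metis eq fun_upd_upd fun_upd_triv)
        with False show False by simp
      qed
      moreover have "odd (k p) \<Longrightarrow> k p \<noteq> 0" by (cases "k p") auto
      ultimately show ?thesis using False by (auto simp: app_cre unit_vec_def smul_def)
    qed
  qed
qed

text \<open>Creating at distinct unoccupied positions never gives 0. Reading off coefficients needs
  only that \<open>s\<close> is nonzero, so its sign is left implicit.\<close>

lemma cre_path_vacuum:
  assumes "distinct ps"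
  shows "\<exists>s. s \<noteq> 0 \<and> app (prod_list (map (cre m) ps)) vacuum
    = smul s (unit_vec (\<lambda>p. if p \<in> set ps then 1 else 0))"
  using assms
proof (induction ps)
  case Nil
  show ?case by (rule exI[of _ 1]) (simp add: vacuum_def smul_def)
next
  case (Cons p ps)
  let ?a = "\<lambda>p. if p \<in> set ps then 1 else 0 :: nat"
  obtain s where s: "s \<noteq> 0" "app (prod_list (map (cre m) ps)) vacuum = smul s (unit_vec ?a)"
    using Cons by auto
  obtain t where t: "t \<noteq> 0" "app (cre m p) (unit_vec ?a) = smul t (unit_vec (?a(p := 1)))"
    using cre_unit_vec[of ?a p m] Cons.prems by auto
  have eq: "?a(p := 1) = (\<lambda>r. if r \<in> set (p # ps) then 1 else 0)" by (auto simp: fun_eq_iff)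
  have "app (prod_list (map (cre m) (p # ps))) vacuum = smul (s * t) (unit_vec (?a(p := 1)))"
    by (simp only: list.map prod_list.Cons app_simps s app_smul t smul_simps)
  then show ?case unfolding eq using s(1) t(1) by (intro exI[of _ "s * t"]) simp
qed

section \<open>The representation of the enveloping algebra\<close>

interpretation gl_rep: monoid_algebra_hom cst "\<lambda>w. prod_list (map (\<lambda>(i, j). gl_op m l M i j) (letters w))" for m l M
  by unfold_locales (rule cst_hom cst_commute | simp add: zero_word_def plus_word_def)+

definition gl_rep :: "weight \<Rightarrow> ('m::finite, 'n::finite) Ugl \<Rightarrow> endo" where
  "gl_rep l u = gl_rep.ext CARD('m) l (CARD('m) + CARD('n)) (rep_Ugl u)"

lemma ssign_eq_sg: "ssign m a b = sg (odd_root m a \<and> odd_root m b)"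
  by (simp add: ssign_def sg_def odd_root_def)

lemma gl_rep_fgen: "gl_rep.ext m l M (fgen i j) = gl_op m l M i j"
  by (simp add: fgen_def gl_rep.ext_single cst_hom)

lemma gl_rep_sg: "gl_rep.ext m l M (sg s) = sg s"
  by (cases s) (simp_all add: gl_rep.ext_one gl_rep.ext_uminus)

lemma gl_rep_if: "gl_rep.ext m l M (if P then x else 0) = (if P then gl_rep.ext m l M x else 0)"
  by (simp add: gl_rep.ext_zero)

lemma gl_rep_relator:
  assumes "r \<in> gl_relators m n"
  shows "gl_rep.ext m l (m + n) r = 0"
  using assms unfolding gl_relators_def
proof (elim UnE)
  assume "r \<in> {fgen i j * fgen k l - ssign m (i, j) (k, l) * (fgen k l * fgen i j)
        - ((if j = k then fgen i l else 0)
           - ssign m (i, j) (k, l) * (if l = i then fgen k j else 0))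
      | i j k l. {i, j, k, l} \<subseteq> {1..m+n}}"
  then obtain i j k k' where r: "r = fgen i j * fgen k k' - ssign m (i, j) (k, k') * (fgen k k' * fgen i j)
        - ((if j = k then fgen i k' else 0) - ssign m (i, j) (k, k') * (if k' = i then fgen k j else 0))"
    and b: "{i, j, k, k'} \<subseteq> {1..m+n}"
    by blast
  show ?thesis
    unfolding r ssign_eq_sg gl_rep.ext_diff gl_rep.ext_mult gl_rep_sg gl_rep_if gl_rep_fgen
    using gl_op_br[OF b, of m l] unfolding br_def by simp
next
  assume "r \<in> {fgen i j | i j. \<not> {i, j} \<subseteq> {1..m+n}}"
  then show ?thesis by (auto simp: gl_rep_fgen intro!: gl_op_outside)
qed

lemma gl_rep_ideal: "x \<in> gl_ideal m n \<Longrightarrow> gl_rep.ext m l (m + n) x = 0"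
  by (induction rule: gl_ideal.induct)
    (simp_all add: gl_rep.ext_zero gl_rep.ext_add gl_rep.ext_mult gl_rep_relator)

text \<open>\<open>gl_rep\<close> is defined through the chosen representative. Any other one
  differs from it by an element of the ideal, which acts as 0.\<close>

lemma gl_rep_abs: "gl_rep l (abs_Ugl x :: ('m::finite, 'n::finite) Ugl)
    = gl_rep.ext CARD('m) l (CARD('m) + CARD('n)) x"
proof -
  let ?u = "abs_Ugl x :: ('m, 'n) Ugl"
  have "rep_Ugl ?u - x \<in> gl_ideal CARD('m) CARD('n)"
    using Quotient3_rel_rep Ugl.abs_eq_iff[of "rep_Ugl ?u" x, where 'm = 'm and 'n = 'n]
      Quotient_abs_rep[OF Quotient_Ugl] by metis
  from gl_rep_ideal[OF this, of l] show ?thesis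
    by (simp add: gl_rep_def gl_rep.ext_diff)
qed

lemma gl_rep_hom:
  fixes u v :: "('m::finite, 'n::finite) Ugl"
  shows "gl_rep l (u + v) = gl_rep l u + gl_rep l v"
    and "gl_rep l (u * v) = gl_rep l u * gl_rep l v"
    and "gl_rep l (u - v) = gl_rep l u - gl_rep l v"
    and "gl_rep l (0 :: ('m, 'n) Ugl) = 0"
    and "gl_rep l (1 :: ('m, 'n) Ugl) = 1"
    and "gl_rep l (scal c :: ('m, 'n) Ugl) = cst c"
    and "gl_rep l (e i j :: ('m, 'n) Ugl) = gl_op CARD('m) l (CARD('m) + CARD('n)) i j"
proof -
  obtain x y where u: "u = abs_Ugl x" and v: "v = abs_Ugl y"
    by (metis Quotient_abs_rep[OF Quotient_Ugl])
  show "gl_rep l (u + v) = gl_rep l u + gl_rep l v"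
    by (simp add: u v plus_Ugl.abs_eq gl_rep_abs gl_rep.ext_add)
  show "gl_rep l (u * v) = gl_rep l u * gl_rep l v"
    by (simp add: u v times_Ugl.abs_eq gl_rep_abs gl_rep.ext_mult)
  show "gl_rep l (u - v) = gl_rep l u - gl_rep l v"
    by (simp add: u v minus_Ugl.abs_eq gl_rep_abs gl_rep.ext_diff)
  show "gl_rep l (0 :: ('m, 'n) Ugl) = 0"
    by (simp add: zero_Ugl_def gl_rep_abs gl_rep.ext_zero)
  show "gl_rep l (1 :: ('m, 'n) Ugl) = 1"
    by (simp add: one_Ugl_def gl_rep_abs gl_rep.ext_one)
  show "gl_rep l (scal c :: ('m, 'n) Ugl) = cst c"
    by (simp add: scal.abs_eq gl_rep_abs fscal_def gl_rep.ext_single zero_word_def)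
  show "gl_rep l (e i j :: ('m, 'n) Ugl) = gl_op CARD('m) l (CARD('m) + CARD('n)) i j"
    by (simp add: e.abs_eq gl_rep_abs gl_rep_fgen)
qed

lemma gl_rep_sum: "gl_rep l (sum g A :: ('m::finite, 'n::finite) Ugl) = (\<Sum>a\<in>A. gl_rep l (g a))"
  by (induction A rule: infinite_finite_induct) (auto simp: gl_rep_hom)

lemma gl_rep_prod_list: "gl_rep l (prod_list xs :: ('m::finite, 'n::finite) Ugl) = prod_list (map (gl_rep l) xs)"
  by (induction xs) (auto simp: gl_rep_hom)

text \<open>Applies an element to the highest weight vector of weight \<open>l\<close>: the left
  ideal \<open>U_n_plus\<close> goes to 0, and a right factor from U(h) becomes its value at
  \<open>l\<close>.\<close>

definition act :: "weight \<Rightarrow> ('m::finite, 'n::finite) Ugl \<Rightarrow> vec" where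
  "act l u = app (gl_rep l u) vacuum"

lemma act_simps:
  fixes u v :: "('m::finite, 'n::finite) Ugl"
  shows "act l (u + v) = act l u + act l v"
    and "act l (u - v) = act l u - act l v"
    and "act l (0 :: ('m, 'n) Ugl) = 0"
    and "act l (u * v) = app (gl_rep l u) (act l v)"
    and "act l (u * scal c) = smul c (act l u)"
  by (simp_all add: act_def gl_rep_hom app_smul)

lemma act_sum: "act l (sum g A :: ('m::finite, 'n::finite) Ugl) = (\<Sum>a\<in>A. act l (g a))"
  unfolding act_def gl_rep_sum app_sum ..

lemma act_raising:
  assumes "1 \<le> i" "i < j" "j \<le> CARD('m) + CARD('n)"
  shows "act l (e i j :: ('m::finite, 'n::finite) Ugl) = 0"
  unfolding act_def gl_rep_hom by (rule gl_op_raising_vacuum) (use assms in auto)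

lemma act_U_n_plus:
  assumes "y \<in> U_n_plus"
  shows "act l (y :: ('m::finite, 'n::finite) Ugl) = 0"
proof -
  obtain z where y: "y = (\<Sum>a\<in>pos_roots CARD('m) CARD('n). z a * e (fst a) (snd a))"
    using assms by (auto simp: U_n_plus_def)
  have "act l (z a * e (fst a) (snd a) :: ('m, 'n) Ugl) = 0" if "a \<in> pos_roots CARD('m) CARD('n)" for a
    unfolding act_simps(4) using that act_raising[of "fst a" "snd a" l, where 'm = 'm and 'n = 'n]
    by (auto simp: pos_roots_def)
  then show ?thesis unfolding y act_sum by (rule sum.neutral[rule_format])
qed

lemma act_hembed: "act l (hembed P :: ('m::finite, 'n::finite) Ugl) = smul (heval CARD('m) CARD('n) P l) vacuum"
proof -
  let ?N = "CARD('m) + CARD('n)"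
  have pow: "app (gl_rep l (e i i ^ a :: ('m, 'n) Ugl)) vacuum = smul (l i ^ a) vacuum"
    if "i \<in> {1..?N}" for i a
    using that by (induction a) (simp_all add: gl_rep_hom gl_op_diag_vacuum app_smul smul_simps mult.commute, simp add: smul_def)
  have mon: "app (gl_rep l (prod_list (map (\<lambda>i. e i i ^ k i) is) :: ('m, 'n) Ugl)) vacuum
      = smul (prod_list (map (\<lambda>i. l i ^ k i) is)) vacuum" if "set is \<subseteq> {1..?N}" for k "is"
    using that by (induction "is") (simp_all add: gl_rep_hom app_smul pow smul_simps mult.commute, simp add: smul_def)
  have "act l (hembed P :: ('m, 'n) Ugl) = (\<Sum>k\<in>Poly_Mapping.keys P.
      smul (Poly_Mapping.lookup P k * prod_list (map (\<lambda>i. l i ^ Poly_Mapping.lookup k i) [1..<?N+1])) vacuum)"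
    unfolding hembed_def hsubst_def act_sum
  proof (rule sum.cong[OF refl])
    fix k
    have "set [1..<?N+1] \<subseteq> {1..?N}" by auto
    from mon[OF this] show "act l (scal (Poly_Mapping.lookup P k)
        * (\<Prod>i\<leftarrow>[1..<?N + 1]. e i i ^ Poly_Mapping.lookup k i) :: ('m, 'n) Ugl)
      = smul (Poly_Mapping.lookup P k * prod_list (map (\<lambda>i. l i ^ Poly_Mapping.lookup k i) [1..<?N+1])) vacuum"
      by (simp only: act_def gl_rep_hom app_simps app_cst smul_simps)
  qed
  also have "\<dots> = smul (heval CARD('m) CARD('n) P l) vacuum"
  proof
    fix \<kappa>
    have ap: "sum f A \<kappa> = (\<Sum>a\<in>A. f a \<kappa>)" for f :: "_ \<Rightarrow> vec" and A
      by (induction A rule: infinite_finite_induct) auto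
    show "(\<Sum>k\<in>Poly_Mapping.keys P.
      smul (Poly_Mapping.lookup P k * prod_list (map (\<lambda>i. l i ^ Poly_Mapping.lookup k i) [1..<?N+1])) vacuum) \<kappa>
      = smul (heval CARD('m) CARD('n) P l) vacuum \<kappa>"
      unfolding ap heval_def hsubst_def smul_def by (simp add: sum_distrib_right)
  qed
  finally show ?thesis .
qed

section \<open>Path elements, their edges and their brackets\<close>

lemma Max_join:
  fixes A B :: "nat set"
  assumes "finite A" "finite B" "A \<noteq> {}" "\<And>a b. a \<in> A \<Longrightarrow> b \<in> B \<Longrightarrow> b < a"
  shows "Max (A \<union> B) = Max A"
proof (rule Max_eqI)
  fix y assume "y \<in> A \<union> B"
  then show "y \<le> Max A"
    using assms(1) assms(4)[OF Max_in[OF assms(1,3)], of y] by auto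
qed (use assms in auto)

lemma Min_insert_greater:
  fixes J :: "nat set"
  assumes "finite J" "J \<noteq> {}" "\<And>j. j \<in> J \<Longrightarrow> j < t"
  shows "Min (insert t J) = Min J"
proof (rule Min_eqI)
  show "Min J \<le> y" if "y \<in> insert t J" for y
    using that assms(1) assms(3)[OF Min_in[OF assms(1,2)]] by auto
qed (use assms in auto)

text \<open>The path crosses from \<open>A\<close> to \<open>B\<close> along one edge. When
  \<open>B\<close> consists of the indices up to \<open>i\<close> and \<open>A\<close> of those
  above, e_{i,i+1} commutes with all the other factors.\<close>

lemma f_elt_join:
  assumes "finite A" "A \<noteq> {}" "finite B" "B \<noteq> {}" "\<And>a b. a \<in> A \<Longrightarrow> b \<in> B \<Longrightarrow> b < a"
  shows "f_elt (A \<union> B) = (f_elt A * e (Min A) (Max B) * f_elt B :: ('m::finite, 'n::finite) Ugl)"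
  using assms
proof (induction A rule: finite_linorder_max_induct)
  case (insert t A)
  show ?case
  proof (cases "A = {}")
    case True
    have "f_elt (insert t B) = (e t (Max B) * f_elt B :: ('m, 'n) Ugl)"
      by (rule f_elt_insert) (use insert in auto)
    then show ?thesis using True by (simp add: f_elt_singleton)
  next
    case False
    have lt: "a < t" if "a \<in> A \<union> B" for a using that insert by auto
    have IH: "f_elt (A \<union> B) = (f_elt A * e (Min A) (Max B) * f_elt B :: ('m, 'n) Ugl)"
      using insert False by auto
    have Mx: "Max (A \<union> B) = Max A"
      by (rule Max_join) (use insert False in auto)
    have Mn: "Min (insert t A) = Min A"
      by (rule Min_insert_greater) (use insert False in auto)
    have "f_elt (insert t (A \<union> B)) = (e t (Max (A \<union> B)) * f_elt (A \<union> B) :: ('m, 'n) Ugl)"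
      by (rule f_elt_insert) (use insert False lt in auto)
    also have "\<dots> = (e t (Max A) * f_elt A) * e (Min A) (Max B) * f_elt B"
      unfolding Mx IH by (simp only: mult.assoc)
    also have "e t (Max A) * f_elt A = (f_elt (insert t A) :: ('m, 'n) Ugl)"
      by (rule f_elt_insert[symmetric]) (use insert False in auto)
    finally show ?thesis unfolding Mn by simp
  qed
qed simp

text \<open>The edges of the path, with the smaller index first so that they are positive roots; the
  factors of \<open>f_elt\<close> are the swapped pairs.\<close>

definition steps :: "nat set \<Rightarrow> (nat \<times> nat) set" where
  "steps J = {(a, b). a \<in> J \<and> b \<in> J \<and> a < b \<and> (\<forall>c\<in>J. \<not> (a < c \<and> c < b))}"

lemma steps_insert:
  assumes "finite J" "J \<noteq> {}" "\<And>j. j \<in> J \<Longrightarrow> j < t"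
  shows "steps (insert t J) = insert (Max J, t) (steps J)"
proof -
  have M: "Max J \<in> J" "\<And>j. j \<in> J \<Longrightarrow> j \<le> Max J" using assms by auto
  have "p \<in> steps (insert t J) \<longleftrightarrow> p \<in> insert (Max J, t) (steps J)" for p
  proof (cases p)
    case (Pair a b)
    show ?thesis
    proof (cases "b = t")
      case True
      have "(a, t) \<in> steps (insert t J) \<longleftrightarrow> a = Max J"
      proof
        assume "(a, t) \<in> steps (insert t J)"
        then have "a \<in> J" "\<forall>c\<in>J. \<not> (a < c \<and> c < t)" by (auto simp: steps_def)
        with M assms(3) show "a = Max J" by (meson antisym_conv2)
      next
        assume "a = Max J"
        then show "(a, t) \<in> steps (insert t J)" using M assms(3) by (fastforce simp: steps_def)
      qed
      moreover have "(a, t) \<notin> steps J" using assms(3) by (auto simp: steps_def)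
      ultimately show ?thesis using True Pair by auto
    next
      case False
      with assms(3) show ?thesis unfolding Pair steps_def by (auto dest: less_asym)
    qed
  qed
  then show ?thesis by blast
qed

lemma steps_singleton: "steps {a} = {}"
  by (auto simp: steps_def)

lemma f_elt_steps:
  assumes "finite J" "J \<noteq> {}"
  shows "\<exists>ps. sorted_wrt (\<lambda>p q. fst q < fst p) ps \<and> set ps = prod.swap ` steps J
    \<and> f_elt J = (prod_list (map (\<lambda>(a, b). e a b) ps) :: ('m::finite, 'n::finite) Ugl)"
  using assms
proof (induction J rule: finite_linorder_max_induct)
  case (insert t J)
  show ?case
  proof (cases "J = {}")
    case True
    then show ?thesis by (intro exI[of _ "[]"]) (simp add: steps_singleton f_elt_singleton)
  next
    case False
    then obtain ps where ps: "sorted_wrt (\<lambda>p q. fst q < fst p) ps" "set ps = prod.swap ` steps J"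
      "f_elt J = (prod_list (map (\<lambda>(a, b). e a b) ps) :: ('m, 'n) Ugl)"
      using insert by auto
    have "f_elt (insert t J) = (e t (Max J) * f_elt J :: ('m, 'n) Ugl)"
      by (rule f_elt_insert) (use insert False in auto)
    moreover have "steps (insert t J) = insert (Max J, t) (steps J)"
      by (rule steps_insert) (use insert False in auto)
    moreover have "fst q < t" if "q \<in> set ps" for q
      using that insert(2) unfolding ps(2) by (auto simp: steps_def)
    ultimately show ?thesis
      using ps by (intro exI[of _ "(t, Max J) # ps"]) auto
  qed
qed simp

lemma f_elt_commute:
  fixes u :: "('m::finite, 'n::finite) Ugl"
  assumes "finite J" "J \<noteq> {}" "\<And>a b. a \<in> J \<Longrightarrow> b \<in> J \<Longrightarrow> b < a \<Longrightarrow> u * e a b = e a b * u"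
  shows "u * f_elt J = f_elt J * u"
  using assms
proof (induction J rule: finite_linorder_max_induct)
  case (insert t J)
  show ?case
  proof (cases "J = {}")
    case True
    then show ?thesis by (simp add: f_elt_singleton)
  next
    case False
    have f: "f_elt (insert t J) = (e t (Max J) * f_elt J :: ('m, 'n) Ugl)"
      by (rule f_elt_insert) (use insert False in auto)
    have "Max J \<in> J" using insert False by auto
    then have 1: "u * e t (Max J) = e t (Max J) * u"
      using insert by auto
    have 2: "u * f_elt J = f_elt J * u" using insert False by auto
    have "u * (e t (Max J) * f_elt J) = e t (Max J) * (u * f_elt J)"
      by (simp only: mult.assoc[symmetric] 1)
    also have "\<dots> = e t (Max J) * f_elt J * u"
      unfolding 2 by (simp only: mult.assoc)
    finally show ?thesis unfolding f .
  qed
qed simp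

lemma e_bracket:
  assumes "{i, j, k, l} \<subseteq> {1..CARD('m) + CARD('n)}"
  shows "e i j * e k l = (sg (odd_root CARD('m) (i, j) \<and> odd_root CARD('m) (k, l)) * (e k l * e i j)
      + (if j = k then e i l else 0)
      - sg (odd_root CARD('m) (i, j) \<and> odd_root CARD('m) (k, l)) * (if l = i then e k j else 0)
      :: ('m::finite, 'n::finite) Ugl)"
  using e_supercommutator[OF assms] unfolding ssign_eq_sg by (simp add: algebra_simps)

text \<open>The weights of the edges telescope.\<close>

lemma f_elt_weight:
  fixes j :: nat
  assumes "finite J" "J \<noteq> {}" "J \<subseteq> {1..CARD('m) + CARD('n)}" "j \<in> {1..CARD('m) + CARD('n)}"
  shows "e j j * f_elt J = (f_elt J * e j j + (of_bool (j = Max J) - of_bool (j = Min J)) * f_elt J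
    :: ('m::finite, 'n::finite) Ugl)"
  using assms(1-3)
proof (induction J rule: finite_linorder_max_induct)
  case (insert t J)
  show ?case
  proof (cases "J = {}")
    case True
    then show ?thesis by (simp add: f_elt_singleton)
  next
    case False
    have f: "f_elt (insert t J) = (e t (Max J) * f_elt J :: ('m, 'n) Ugl)"
      by (rule f_elt_insert) (use insert False in auto)
    have M: "Max J \<in> J" using insert False by auto
    then have tM: "Max J < t" using insert by auto
    have 1: "e j j * e t (Max J) = (e t (Max J) * e j j + (of_bool (j = t) - of_bool (j = Max J)) * e t (Max J)
        :: ('m, 'n) Ugl)"
    proof -
      have "{j, t, Max J} \<subseteq> {1..CARD('m) + CARD('n)}" using insert assms(4) M by auto
      then show ?thesis using tM
        by (subst e_bracket) (auto simp: odd_root_pair)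
    qed
    have 2: "e j j * f_elt J = (f_elt J * e j j + (of_bool (j = Max J) - of_bool (j = Min J)) * f_elt J :: ('m, 'n) Ugl)"
      using insert False by auto
    have Mx: "Max (insert t J) = t" using insert by (intro Max_eqI) auto
    have Mn: "Min (insert t J) = Min J"
      by (rule Min_insert_greater) (use insert False in auto)
    have "e j j * (e t (Max J) * f_elt J) = ((e j j * e t (Max J)) * f_elt J :: ('m, 'n) Ugl)"
      by (simp only: mult.assoc)
    also have "\<dots> = e t (Max J) * (e j j * f_elt J) + (of_bool (j = t) - of_bool (j = Max J)) * (e t (Max J) * f_elt J)"
      unfolding 1 by (simp only: distrib_right mult.assoc)
    also have "\<dots> = e t (Max J) * f_elt J * e j j + (of_bool (j = t) - of_bool (j = Min J)) * (e t (Max J) * f_elt J)"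
      unfolding 2 by (cases "j = Max J"; cases "j = Min J"; cases "j = t") (simp_all add: algebra_simps)
    finally show ?thesis unfolding f Mx Mn .
  qed
qed simp

section \<open>Applying a simple root vector\<close>

text \<open>The product of two paths of the overview: if \<open>i\<close> and \<open>Suc i\<close>
  lie in \<open>T\<close>, it is \<open>f_elt T\<close> with the factor e_{i+1,i} struck
  out.\<close>

definition block :: "nat \<Rightarrow> nat set \<Rightarrow> ('m::finite, 'n::finite) Ugl" where
  "block i T = f_elt (T \<inter> {Suc i..}) * f_elt (T \<inter> {..i})"

text \<open>The bracket of e_{i,i+1} with the edge crossing \<open>i\<close>. The edge e_{i+1,i}
  becomes a Cartan element, and moving its e_{i,i} past the lower path adds 1 unless that path is
  trivial. An edge e_{i+1,c} becomes e_{i,c}, an edge e_{b,i} becomes e_{b,i+1} with a sign; any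
  other crossing edge gives no bracket.\<close>

definition raise_coeff :: "nat \<Rightarrow> nat set \<Rightarrow> ('m::finite, 'n::finite) Ugl" where
  "raise_coeff i J = (if i \<in> J \<and> Suc i \<in> J
      then e i i - sg (i = CARD('m)) * e (Suc i) (Suc i) + (if 1 < i then 1 else 0)
     else if Suc i \<in> J then 1 else if i \<in> J then - sg (i = CARD('m)) else 0)"

lemma raise_f_elt:
  assumes J: "J \<in> II CARD('m) CARD('n)" and i: "1 \<le> i" "Suc i \<le> CARD('m) + CARD('n)"
  shows "\<exists>y. e i (Suc i) * f_elt J
    = (block i (insert i (insert (Suc i) J)) * raise_coeff i J + y * e i (Suc i) :: ('m::finite, 'n::finite) Ugl)"
proof -
  define m where "m = CARD('m)"
  define N where "N = m + CARD('n)"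
  define U L where "U = J \<inter> {Suc i..}" and "L = J \<inter> {..i}"
  define A C where "A = insert (Suc i) U" and "C = insert i L"
  define s :: "('m, 'n) Ugl" where "s = sg (i = m)"
  define b c where "b = Min U" and "c = Max L"
  define \<sigma> :: "('m, 'n) Ugl" where "\<sigma> = sg (i = m \<and> odd_root m (b, c))"
  let ?x = "e i (Suc i) :: ('m, 'n) Ugl"
  have J': "J \<subseteq> {1..N}" "1 \<in> J" "N \<in> J" "finite J"
    using J finite_subset[of J "{1..N}"] by (auto simp: II_def m_def N_def)
  have iN: "1 \<le> i" "Suc i \<le> N" using i by (simp_all add: m_def N_def)
  have UL: "U \<subseteq> {Suc i..N}" "L \<subseteq> {1..i}" "finite U" "finite L" using J' by (auto simp: U_def L_def)
  have ne: "U \<noteq> {}" "L \<noteq> {}" using J'(2,3) iN by (auto simp: U_def L_def)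
  have bc: "b \<in> U" "c \<in> L" using UL ne by (auto simp: b_def c_def)
  have bcN: "{b, c} \<subseteq> {1..N}" "Suc i \<le> b" "c \<le> i" using bc UL iN by auto
  have T: "block i (insert i (insert (Suc i) J)) = (f_elt A * f_elt C :: ('m, 'n) Ugl)"
  proof -
    have "insert i (insert (Suc i) J) \<inter> {Suc i..} = A" "insert i (insert (Suc i) J) \<inter> {..i} = C"
      by (auto simp: A_def U_def C_def L_def)
    then show ?thesis by (simp add: block_def)
  qed
  have br: "?x * e k l = sg (i = m \<and> odd_root m (k, l)) * (e k l * ?x) + (if Suc i = k then e i l else 0)
      - sg (i = m \<and> odd_root m (k, l)) * (if l = i then e k (Suc i) else 0)" if "{k, l} \<subseteq> {1..N}" for k l
  proof -
    have "odd_root CARD('m) (i, Suc i) \<longleftrightarrow> i = m" by (auto simp: odd_root_pair m_def)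
    then show ?thesis using e_bracket[of i "Suc i" k l, where 'm = 'm and 'n = 'n] iN that
      by (simp add: m_def N_def)
  qed
  \<comment> \<open>A factor inside \<open>U\<close> has first index above \<open>Suc i\<close>, one
    inside \<open>L\<close> has second index below \<open>i\<close>, so no bracket term arises. If
    e_{i,i+1} is odd, then \<open>i = m\<close>, and both indices of the factor are on the same side
    of \<open>m\<close>, so the factor is even.\<close>
  have commute: "?x * f_elt B = f_elt B * ?x" if B: "B = U \<or> B = L" for B
  proof (rule f_elt_commute)
    show "finite B" "B \<noteq> {}" using B UL ne by auto
    fix a b assume ab: "a \<in> B" "b \<in> B" "b < a"
    then have "a \<in> {Suc i..N} \<and> b \<in> {Suc i..N} \<or> a \<in> {1..i} \<and> b \<in> {1..i}" using B UL by blast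
    then have "{a, b} \<subseteq> {1..N}" "Suc i \<noteq> a" "b \<noteq> i" "(i = m \<and> odd_root m (a, b)) = False"
      using ab iN by (auto simp: odd_root_pair)
    then show "?x * e a b = e a b * ?x" using br[of a b] by (simp only:) simp
  qed
  have "J = U \<union> L" unfolding U_def L_def by (auto simp: not_less_eq_eq)
  then have f: "f_elt J = (f_elt U * e b c * f_elt L :: ('m, 'n) Ugl)"
    unfolding b_def c_def using UL by (simp only:) (rule f_elt_join[OF UL(3) ne(1) UL(4) ne(2)], fastforce)
  have x: "?x * e b c = \<sigma> * (e b c * ?x) + (if Suc i = b then e i c else 0) - \<sigma> * (if c = i then e b (Suc i) else 0)"
    unfolding \<sigma>_def by (rule br[OF bcN(1)])
  have "?x * f_elt J = f_elt U * (?x * e b c) * f_elt L"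
    unfolding f using commute[of U] by (simp add: mult.assoc[symmetric])
  also have "\<dots> = f_elt U * ((if Suc i = b then e i c else 0) - \<sigma> * (if c = i then e b (Suc i) else 0)) * f_elt L
      + f_elt U * \<sigma> * e b c * (?x * f_elt L)"
    unfolding x by (simp add: algebra_simps)
  also have "\<dots> = f_elt U * ((if Suc i = b then e i c else 0) - \<sigma> * (if c = i then e b (Suc i) else 0)) * f_elt L
      + f_elt U * \<sigma> * e b c * f_elt L * ?x"
    using commute[of L] by (simp add: mult.assoc)
  finally have main: "?x * f_elt J
    = f_elt U * ((if Suc i = b then e i c else 0) - \<sigma> * (if c = i then e b (Suc i) else 0)) * f_elt L
      + f_elt U * \<sigma> * e b c * f_elt L * ?x" .
  have iJ: "i \<in> J \<longleftrightarrow> c = i"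
  proof
    assume "i \<in> J"
    then show "c = i" unfolding c_def using UL(2,4) by (intro Max_eqI) (auto simp: L_def)
  qed (use bc in \<open>auto simp: L_def\<close>)
  have SiJ: "Suc i \<in> J \<longleftrightarrow> b = Suc i"
  proof
    assume "Suc i \<in> J"
    then show "b = Suc i" unfolding b_def using UL(1,3) by (intro Min_eqI) (auto simp: U_def)
  qed (use bc in \<open>auto simp: U_def\<close>)
  have fC: "f_elt C = (if i \<in> J then f_elt L else e i c * f_elt L :: ('m, 'n) Ugl)"
  proof (cases "i \<in> J")
    case True
    then have "C = L" by (auto simp: C_def L_def)
    then show ?thesis using True by simp
  next
    case False
    then have "j < i" if "j \<in> L" for j using that by (auto simp: L_def intro: le_neq_implies_less)
    then show ?thesis using False f_elt_insert[OF UL(4) ne(2), of i] by (simp add: C_def c_def)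
  qed
  have fA: "f_elt A = (if Suc i \<in> J then f_elt U else f_elt U * e b (Suc i) :: ('m, 'n) Ugl)"
  proof (cases "Suc i \<in> J")
    case True
    then have "A = U" by (auto simp: A_def U_def)
    then show ?thesis using True by simp
  next
    case False
    then have "Suc i < j" if "j \<in> U" for j using that by (auto simp: U_def intro: le_neq_implies_less)
    then have "f_elt (U \<union> {Suc i}) = (f_elt U * e (Min U) (Max {Suc i}) * f_elt {Suc i} :: ('m, 'n) Ugl)"
      by (intro f_elt_join UL ne) auto
    then show ?thesis using False by (simp add: f_elt_singleton A_def b_def)
  qed
  \<comment> \<open>With \<open>c = i\<close> the crossing edge runs from \<open>b\<close>, at least
    \<open>Suc i\<close>, down to \<open>i\<close>; for \<open>i = m\<close> it joins the two sides
    and is odd.\<close>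
  have \<sigma>: "\<sigma> = s" if "c = i"
  proof -
    have "(i = m \<and> odd_root m (b, i)) = (i = m)" using bcN(2) by (auto simp: odd_root_pair)
    then show ?thesis unfolding \<sigma>_def s_def that by simp
  qed
  have coeff: "f_elt U * ((if Suc i = b then e i c else 0) - \<sigma> * (if c = i then e b (Suc i) else 0)) * f_elt L
      = f_elt A * f_elt C * (raise_coeff i J :: ('m, 'n) Ugl)"
  proof (cases "c = i \<and> b = Suc i")
    case True
    then have inJ: "i \<in> J" "Suc i \<in> J" using iJ SiJ by blast+
    have ends: "Min L = 1" "Max L = i"
      using UL J'(2) iN True by (auto intro!: Min_eqI simp: L_def c_def)
    have LN: "L \<subseteq> {1..CARD('m) + CARD('n)}" "i \<in> {1..CARD('m) + CARD('n)}" "Suc i \<in> {1..CARD('m) + CARD('n)}"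
      using UL(2) iN by (auto simp: N_def m_def)
    \<comment> \<open>Origin of the summand 1: \<open>i\<close> is the top of the lower path. For
      \<open>i = 1\<close> it is the bottom as well and the two contributions cancel.\<close>
    have w: "e i i * f_elt L = (f_elt L * e i i + (if 1 < i then 1 else 0) * f_elt L :: ('m, 'n) Ugl)"
      unfolding f_elt_weight[OF UL(4) ne(2) LN(1,2)] ends using iN by simp
    have w': "e (Suc i) (Suc i) * f_elt L = (f_elt L * e (Suc i) (Suc i) :: ('m, 'n) Ugl)"
      unfolding f_elt_weight[OF UL(4) ne(2) LN(1,3)] ends using iN by simp
    have "f_elt U * (e i i - s * e (Suc i) (Suc i)) * f_elt L
        = f_elt U * (e i i * f_elt L) - s * (f_elt U * (e (Suc i) (Suc i) * f_elt L))"
      by (cases "i = m") (simp_all add: s_def algebra_simps)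
    also have "\<dots> = f_elt U * f_elt L * (e i i - s * e (Suc i) (Suc i) + (if 1 < i then 1 else 0))"
      unfolding w w' by (cases "i = m") (simp_all add: s_def algebra_simps)
    finally show ?thesis
      using True inJ \<sigma> by (simp add: fA fC raise_coeff_def s_def m_def)
  next
    case False
    have "x * (s * y) * z = x * y * z * s" for x y z :: "('m, 'n) Ugl"
      by (cases "i = m") (simp_all add: s_def mult.assoc)
    then show ?thesis
      using False iJ SiJ \<sigma> by (auto simp: fA fC raise_coeff_def s_def m_def mult.assoc)
  qed
  show ?thesis unfolding main coeff T by (rule exI) (rule refl)
qed

text \<open>The factor next to \<open>block i T\<close> in e_{i,i+1} times the sum of the
  \<open>f_elt J * X J\<close>. The contributing sets are \<open>T\<close>, \<open>T - {i}\<close>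
  and \<open>T - {Suc i}\<close>; without both indices \<open>raise_coeff\<close> is 0. The two
  conditions keep 1 and m+n in the set.\<close>

definition raise_bracket :: "nat \<Rightarrow> (nat set \<Rightarrow> ('m::finite, 'n::finite) Ugl) \<Rightarrow> nat set \<Rightarrow> ('m, 'n) Ugl" where
  "raise_bracket i X T = (e i i - sg (i = CARD('m)) * e (Suc i) (Suc i) + (if 1 < i then 1 else 0)) * X T
     + (if 1 < i then X (T - {i}) else 0)
     - (if Suc i < CARD('m) + CARD('n) then sg (i = CARD('m)) * X (T - {Suc i}) else 0)"

lemma finite_II [simp]: "finite (II m n)"
  by (rule finite_subset[of _ "Pow {1..m+n}"]) (auto simp: II_def)

lemma sum_raise_coeff:
  fixes X :: "nat set \<Rightarrow> ('m::finite, 'n::finite) Ugl"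
  assumes T: "T \<in> II CARD('m) CARD('n)" "i \<in> T" "Suc i \<in> T"
  shows "(\<Sum>J | J \<in> II CARD('m) CARD('n) \<and> insert i (insert (Suc i) J) = T. raise_coeff i J * X J)
    = raise_bracket i X T"
proof -
  define N where "N = CARD('m) + CARD('n)"
  let ?S = "{J. J \<in> II CARD('m) CARD('n) \<and> insert i (insert (Suc i) J) = T}"
  let ?A = "if 1 < i then {T - {i}} else {}"
  let ?B = "if Suc i < N then {T - {Suc i}} else {}"
  have TN: "T \<subseteq> {1..N}" "1 \<in> T" "N \<in> T" using T by (auto simp: II_def N_def)
  have i: "1 \<le> i" "Suc i \<le> N" using TN T by auto
  have sub: "insert T (?A \<union> ?B) \<subseteq> ?S"
    using T TN i by (auto simp: II_def N_def)
  have "J \<in> insert T (?A \<union> ?B)" if J: "J \<in> ?S" "i \<in> J \<or> Suc i \<in> J" for J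
  proof -
    have JN: "1 \<in> J" "N \<in> J" "insert i (insert (Suc i) J) = T" using J by (auto simp: II_def N_def)
    consider "i \<in> J" "Suc i \<in> J" | "i \<in> J" "Suc i \<notin> J" | "i \<notin> J" "Suc i \<in> J" using J(2) by blast
    then show ?thesis
    proof cases
      case 1
      then have "J = T" using JN(3) by auto
      then show ?thesis by blast
    next
      case 2
      then have "J = T - {Suc i}" using JN(3) by auto
      moreover have "Suc i < N" using 2 JN(2) i by (metis le_neq_implies_less)
      ultimately show ?thesis by simp
    next
      case 3
      then have "J = T - {i}" using JN(3) by auto
      moreover have "1 < i" using 3 JN(1) i by (metis le_neq_implies_less)
      ultimately show ?thesis by simp
    qed
  qed
  then have zero: "raise_coeff i J * X J = 0" if "J \<in> ?S - insert T (?A \<union> ?B)" for J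
    using that by (auto simp: raise_coeff_def)
  have ne: "T - {i} \<noteq> T - {Suc i}" "T - {i} \<noteq> T" "T - {Suc i} \<noteq> T"
  proof -
    have "i \<in> T - {Suc i}" "i \<notin> T - {i}" "Suc i \<notin> T - {Suc i}" using T by simp_all
    then show "T - {i} \<noteq> T - {Suc i}" "T - {i} \<noteq> T" "T - {Suc i} \<noteq> T" using T(2,3) by metis+
  qed
  have "(\<Sum>J\<in>?S. raise_coeff i J * X J) = (\<Sum>J\<in>insert T (?A \<union> ?B). raise_coeff i J * X J)"
    by (rule sum.mono_neutral_right) (use sub zero in auto)
  also have "\<dots> = raise_coeff i T * X T + (\<Sum>J\<in>?A \<union> ?B. raise_coeff i J * X J)"
    by (rule sum.insert) (use ne in \<open>simp_all split: if_splits\<close>)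
  also have "(\<Sum>J\<in>?A \<union> ?B. raise_coeff i J * X J)
      = (\<Sum>J\<in>?A. raise_coeff i J * X J) + (\<Sum>J\<in>?B. raise_coeff i J * X J)"
    by (rule sum.union_disjoint) (use ne(1) in simp_all)
  also have "(\<Sum>J\<in>?A. raise_coeff i J * X J) = (if 1 < i then X (T - {i}) else 0)"
    using T by (simp add: raise_coeff_def)
  also have "(\<Sum>J\<in>?B. raise_coeff i J * X J) = - (if Suc i < N then sg (i = CARD('m)) * X (T - {Suc i}) else 0)"
    using T by (simp add: raise_coeff_def)
  finally show ?thesis
    using T by (simp add: raise_bracket_def raise_coeff_def N_def)
qed

text \<open>The remainder keeps e_{i,i+1} in front of \<open>X J\<close> so that one statement
  serves twice: for \<open>X J\<close> in U(h) the root vector can be moved to the right end, and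
  for a scalar \<open>X J\<close> it reaches the vacuum.\<close>

lemma raise_sum:
  fixes X :: "nat set \<Rightarrow> ('m::finite, 'n::finite) Ugl"
  assumes i: "1 \<le> i" "Suc i \<le> CARD('m) + CARD('n)"
  shows "\<exists>y. e i (Suc i) * (\<Sum>J\<in>II CARD('m) CARD('n). f_elt J * X J)
    = (\<Sum>T | T \<in> II CARD('m) CARD('n) \<and> i \<in> T \<and> Suc i \<in> T. block i T * raise_bracket i X T)
      + (\<Sum>J\<in>II CARD('m) CARD('n). y J * (e i (Suc i) * X J))"
proof -
  let ?I = "II CARD('m) CARD('n)"
  let ?g = "\<lambda>J. insert i (insert (Suc i) J)"
  let ?T = "{T. T \<in> ?I \<and> i \<in> T \<and> Suc i \<in> T}"
  have "\<forall>J\<in>?I. \<exists>y. e i (Suc i) * f_elt J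
    = (block i (?g J) * raise_coeff i J + y * e i (Suc i) :: ('m, 'n) Ugl)"
    using raise_f_elt i by blast
  then obtain y where y: "\<And>J. J \<in> ?I \<Longrightarrow> e i (Suc i) * f_elt J
    = (block i (?g J) * raise_coeff i J + y J * e i (Suc i) :: ('m, 'n) Ugl)"
    by metis
  have "e i (Suc i) * (\<Sum>J\<in>?I. f_elt J * X J)
      = (\<Sum>J\<in>?I. block i (?g J) * (raise_coeff i J * X J) + y J * (e i (Suc i) * X J))"
    unfolding sum_distrib_left
  proof (rule sum.cong[OF refl])
    fix J assume "J \<in> ?I"
    have "e i (Suc i) * (f_elt J * X J) = (e i (Suc i) * f_elt J) * X J" by (simp only: mult.assoc)
    then show "e i (Suc i) * (f_elt J * X J)
        = block i (?g J) * (raise_coeff i J * X J) + y J * (e i (Suc i) * X J)"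
      unfolding y[OF \<open>J \<in> ?I\<close>] by (simp only: distrib_right mult.assoc)
  qed
  also have "\<dots> = (\<Sum>J\<in>?I. block i (?g J) * (raise_coeff i J * X J))
      + (\<Sum>J\<in>?I. y J * (e i (Suc i) * X J))"
    by (rule sum.distrib)
  also have "(\<Sum>J\<in>?I. block i (?g J) * (raise_coeff i J * X J))
      = (\<Sum>T\<in>?T. \<Sum>J | J \<in> ?I \<and> ?g J = T. block i (?g J) * (raise_coeff i J * X J))"
    by (rule sum.group[symmetric]) (use i in \<open>auto simp: II_def\<close>)
  also have "\<dots> = (\<Sum>T\<in>?T. block i T * raise_bracket i X T)"
  proof (rule sum.cong[OF refl])
    fix T assume "T \<in> ?T"
    then have T: "T \<in> ?I" "i \<in> T" "Suc i \<in> T" by auto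
    show "(\<Sum>J | J \<in> ?I \<and> ?g J = T. block i (?g J) * (raise_coeff i J * X J)) = block i T * raise_bracket i X T"
      unfolding sum_raise_coeff[OF T, symmetric] sum_distrib_left by (rule sum.cong) auto
  qed
  finally show ?thesis by blast
qed

section \<open>The polynomials $h_i$\<close>

lemma finite_pos_roots [simp]: "finite (pos_roots m n)"
  by (rule finite_subset[of _ "{1..m+n} \<times> {1..m+n}"]) (auto simp: pos_roots_def)

lemma sum_root:
  assumes "finite S"
  shows "(\<Sum>a\<in>S. root a k) = of_nat (card {a\<in>S. fst a = k}) - (of_nat (card {a\<in>S. snd a = k}) :: complex)"
proof -
  have "(\<Sum>a\<in>S. root a k) = (\<Sum>a\<in>S. of_bool (fst a = k)) - (\<Sum>a\<in>S. of_bool (snd a = k) :: complex)"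
    unfolding sum_subtractf[symmetric] by (rule sum.cong) (auto simp: root_def wt_def)
  also have "(\<Sum>a\<in>S. of_bool (fst a = k)) = (of_nat (card {a\<in>S. fst a = k}) :: complex)"
    using assms by (simp add: sum.If_cases of_bool_def Int_def)
  also have "(\<Sum>a\<in>S. of_bool (snd a = k)) = (of_nat (card {a\<in>S. snd a = k}) :: complex)"
    using assms by (simp add: sum.If_cases of_bool_def Int_def)
  finally show ?thesis .
qed

lemma card_image_Pair: "card ((\<lambda>j. (k, j)) ` S) = card S" "card ((\<lambda>j. (j, k)) ` S) = card S"
  by (rule card_image, simp add: inj_on_def)+

text \<open>Each coordinate counts the positive roots starting at \<open>k\<close> minus those
  ending there, even ones against odd ones; the factor 2 avoids fractions.\<close>

lemma rho_eq:
  assumes "k \<in> {1..m+n}"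
  shows "2 * rho m n k = (if k \<le> m then of_nat m + 1 - 2 * of_nat k - of_nat n
     else 3 * of_nat m + of_nat n + 1 - 2 * of_nat k)"
proof -
  let ?e = "{a. a \<in> pos_roots m n \<and> \<not> odd_root m a}"
  let ?o = "{a. a \<in> pos_roots m n \<and> odd_root m a}"
  have c: "card {a \<in> ?e. fst a = k} = (if k \<le> m then m - k else m + n - k)"
    "card {a \<in> ?e. snd a = k} = (if k \<le> m then k - 1 else k - 1 - m)"
    "card {a \<in> ?o. fst a = k} = (if k \<le> m then n else 0)"
    "card {a \<in> ?o. snd a = k} = (if k \<le> m then 0 else m)"
  proof -
    have "{a \<in> ?e. fst a = k} = Pair k ` (if k \<le> m then {k<..m} else {k<..m+n})"
      using assms by (auto simp: pos_roots_def odd_root_pair)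
    then show "card {a \<in> ?e. fst a = k} = (if k \<le> m then m - k else m + n - k)"
      by (simp add: card_image_Pair)
    have "{a \<in> ?e. snd a = k} = (\<lambda>j. (j, k)) ` (if k \<le> m then {1..<k} else {m<..<k})"
      using assms by (auto simp: pos_roots_def odd_root_pair)
    then show "card {a \<in> ?e. snd a = k} = (if k \<le> m then k - 1 else k - 1 - m)"
      by (simp add: card_image_Pair)
    have "{a \<in> ?o. fst a = k} = Pair k ` (if k \<le> m then {m<..m+n} else {})"
      using assms by (auto simp: pos_roots_def odd_root_pair)
    then show "card {a \<in> ?o. fst a = k} = (if k \<le> m then n else 0)"
      by (simp add: card_image_Pair)
    have "{a \<in> ?o. snd a = k} = (\<lambda>j. (j, k)) ` (if k \<le> m then {} else {1..m})"
      using assms by (auto simp: pos_roots_def odd_root_pair)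
    then show "card {a \<in> ?o. snd a = k} = (if k \<le> m then 0 else m)"
      by (simp add: card_image_Pair)
  qed
  have "2 * rho m n k = (of_nat (card {a \<in> ?e. fst a = k}) - of_nat (card {a \<in> ?e. snd a = k}))
      - (of_nat (card {a \<in> ?o. fst a = k}) - (of_nat (card {a \<in> ?o. snd a = k}) :: complex))"
    unfolding rho_def by (simp add: sum_root algebra_simps)
  then show ?thesis
    unfolding c using assms by (auto simp: of_nat_diff)
qed

text \<open>The identity (\<rho>,\<alpha>) = (\<alpha>,\<alpha>)/2 for simple roots in coordinates.
  The odd simple root is isotropic, and for it the form turns the difference into a sum.\<close>

lemma rho_simple:
  assumes "1 \<le> i" "Suc i \<le> m + n"
  shows "i \<noteq> m \<Longrightarrow> rho m n i - rho m n (Suc i) = 1"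
    and "i = m \<Longrightarrow> rho m n i + rho m n (Suc i) = 0"
proof -
  have "2 * (rho m n i - rho m n (Suc i)) = 2 * 1" if "i \<noteq> m"
    unfolding right_diff_distrib using assms that by (subst (1 2) rho_eq) auto
  then show "i \<noteq> m \<Longrightarrow> rho m n i - rho m n (Suc i) = 1" unfolding mult_cancel_left by simp
  have "2 * (rho m n i + rho m n (Suc i)) = 2 * 0" if "i = m"
    unfolding distrib_left using assms that by (subst (1 2) rho_eq) auto
  then show "i = m \<Longrightarrow> rho m n i + rho m n (Suc i) = 0" unfolding mult_cancel_left by simp
qed

lemma hC_hom: "hC (a + b) = hC a + hC b" "hC (a - b) = hC a - hC b" "hC (- a) = - hC a"
  "hC 0 = 0" "hC 1 = 1"
  by (simp_all add: hC_def single_add single_diff single_uminus)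

lemma sum_wt:
  fixes g :: "nat \<Rightarrow> 'a::ring_1"
  assumes "finite S" and "c 0 = 0" "c 1 = 1"
  shows "(\<Sum>i\<in>S. c (wt a i) * g i) = (if a \<in> S then g a else 0)"
proof -
  have "(\<Sum>i\<in>S. c (wt a i) * g i) = (\<Sum>i\<in>S. if i = a then g i else 0)"
    by (rule sum.cong) (auto simp: wt_def assms)
  then show ?thesis using assms by (simp add: sum.delta')
qed

lemma h_elt_root:
  assumes "a \<in> {1..m+n}" "b \<in> {1..m+n}"
  shows "h_elt m n (wt a - wt b) = sg (m < a) * hX a - sg (m < b) * hX b"
proof -
  have "h_elt m n (wt x) = sg (m < x) * hX x" if "x \<in> {1..m+n}" for x
    using that unfolding h_elt_def by (subst (1 2) sum_wt) (auto simp: hC_hom)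
  moreover have "h_elt m n (wt a - wt b) = h_elt m n (wt a) - h_elt m n (wt b)"
    by (simp add: h_elt_def hC_hom left_diff_distrib sum_subtractf)
  ultimately show ?thesis using assms by simp
qed

lemma form_root:
  assumes "a \<in> {1..m+n}" "b \<in> {1..m+n}"
  shows "form m n r (wt a - wt b) = sg (m < a) * r a - sg (m < b) * r b"
proof -
  have "form m n r (wt x) = sg (m < x) * r x" if "x \<in> {1..m+n}" for x
    using that unfolding form_def mult.commute[of "r _"]
    by (subst (1 2) sum_wt[where c = "\<lambda>x. x"]) auto
  moreover have "form m n r (wt a - wt b) = form m n r (wt a) - form m n r (wt b)"
    by (simp add: form_def right_diff_distrib sum_subtractf)
  ultimately show ?thesis using assms by simp
qed

lemma h_poly_eq:
  assumes "1 \<le> m" "1 \<le> n" "i < m + n"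
  shows "h_poly m n i = (if i < m then hX 1 - hX (Suc i) + hC (rho m n 1 - rho m n (Suc i)) - 1
     else hX (m + n) - hX (Suc i) + hC (rho m n (m + n) - rho m n (Suc i)))"
proof (cases "i < m")
  case True
  then have "i \<le> m - 1" by linarith
  then show ?thesis using True assms
    unfolding h_poly_def eps_def by (simp add: h_elt_root form_root)
next
  case False
  then have "\<not> i \<le> m - 1" "m + (i + 1 - m) = Suc i" using assms by linarith+
  then show ?thesis using False assms
    unfolding h_poly_def del_def by (simp add: h_elt_root form_root hC_hom)
qed

text \<open>The formulas for h_i extended to 0 and m+n-1, which no H_J with J in
  \<open>II m n\<close> involves. The values encode that 1 and m+n cannot be removed from J, so the
  cases \<open>i = 1\<close> and \<open>Suc i = m + n\<close> follow the general pattern.\<close>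

lemma h_poly_ends:
  assumes "1 \<le> m" "1 \<le> n"
  shows "h_poly m n 0 = -1" "h_poly m n (m + n - 1) = 0"
  using assms by (subst h_poly_eq; simp add: hC_hom)+

definition z_poly :: "nat \<Rightarrow> nat \<Rightarrow> hpoly" where
  "z_poly m n = h_elt m n (eta m n) + hC (heval m n (h_elt m n (eta m n)) (rho m n))"

lemma z_poly_eq:
  assumes "1 \<le> m" "1 \<le> n"
  shows "z_poly m n = hX 1 + hX (m + n) + hC (rho m n 1 + rho m n (m + n))"
  unfolding z_poly_def heval_h_elt eta_def eps_def del_def
  using assms by (simp add: h_elt_root form_root)

text \<open>With H_T factored out, the left side is the coefficient of \<open>block i T\<close>. For
  i other than \<open>m\<close>, the contributions of \<epsilon>_1 or \<delta>_n to h_{i-1} and h_i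
  cancel and \<open>rho_simple\<close> finishes. At \<open>i = m\<close> the ends differ and both
  survive, giving h_\<eta> + \<rho>(h_\<eta>); there the -1 in h_{m-1} absorbs the 1 coming from the
  lower path.\<close>

lemma h_poly_recurrence:
  assumes "1 \<le> m" "1 \<le> n" "1 \<le> i" "Suc i \<le> m + n"
  shows "hX i - sg (i = m) * hX (Suc i) + 1 + h_poly m n (i - 1) - sg (i = m) * h_poly m n i
    = (if i = m then z_poly m n else 0)"
proof -
  have S: "Suc (i - 1) = i" using assms by simp
  consider "i < m" | "i = m" | "m < i" by linarith
  then show ?thesis
  proof cases
    case 1
    then have r: "rho m n i = 1 + rho m n (Suc i)" using rho_simple(1)[of i m n] assms by (simp add: algebra_simps)
    have "i - 1 < m" using 1 by simp
    then show ?thesis using 1 assms by (simp add: h_poly_eq S hC_hom r)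
  next
    case 2
    then have r: "rho m n (Suc i) = - rho m n i" using rho_simple(2)[of i m n] assms by (simp add: eq_neg_iff_add_eq_0 add.commute)
    have "i - 1 < m" using 2 assms by simp
    then show ?thesis using 2 assms r by (simp add: h_poly_eq z_poly_eq S hC_hom)
  next
    case 3
    then have r: "rho m n i = 1 + rho m n (Suc i)" using rho_simple(1)[of i m n] assms by (simp add: algebra_simps)
    have "\<not> i - 1 < m" using 3 by simp
    then show ?thesis using 3 assms by (simp add: h_poly_eq S hC_hom r)
  qed
qed

section \<open>A Sapovalov element\<close>

lemma hembed_induct:
  fixes Q :: "('m::finite, 'n::finite) Ugl \<Rightarrow> bool"
  assumes scal: "\<And>c. Q (scal c)" and e: "\<And>j. j \<in> {1..CARD('m) + CARD('n)} \<Longrightarrow> Q (e j j)"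
    and add: "\<And>u v. Q u \<Longrightarrow> Q v \<Longrightarrow> Q (u + v)" and mult: "\<And>u v. Q u \<Longrightarrow> Q v \<Longrightarrow> Q (u * v)"
  shows "Q (hembed P)"
proof -
  have 0: "Q 0" and 1: "Q 1" using scal[of 0] scal[of 1] by (simp_all add: scal_zero scal_one)
  have pow: "Q (e j j ^ a)" if "j \<in> {1..CARD('m) + CARD('n)}" for j a
    by (induction a) (use that 1 e mult in auto)
  have "Q (prod_list (map (\<lambda>i. e i i ^ k i) is))" if "set is \<subseteq> {1..CARD('m) + CARD('n)}" for k "is"
    using that
  proof (induction "is")
    case (Cons i "is")
    then show ?case by (simp only: list.map prod_list.Cons) (intro mult pow; simp)
  qed (simp add: 1)
  then have mon: "Q (prod_list (map (\<lambda>i. e i i ^ k i) [1..<CARD('m) + CARD('n) + 1]))" for k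
    by (simp add: atLeastLessThanSuc_atLeastAtMost del: upt_Suc)
  have sum: "Q (sum g A)" if "\<And>a. Q (g a)" for g :: "(nat \<Rightarrow>\<^sub>0 nat) \<Rightarrow> ('m, 'n) Ugl" and A
    by (induction A rule: infinite_finite_induct) (auto intro: that 0 add)
  show ?thesis unfolding hembed_def hsubst_def by (intro sum mult scal mon)
qed

lemma hembed_sg: "hembed (sg s) = sg s"
  by (cases s) (simp_all add: hembed_hom)

text \<open>Passing e_{i,i+1} through a polynomial in the e_{j,j} shifts its arguments by constants;
  only the existence of the shifted factor is recorded.\<close>

lemma raising_hembed:
  assumes "1 \<le> i" "Suc i \<le> CARD('m) + CARD('n)"
  shows "\<exists>u. e i (Suc i) * hembed P = (u * e i (Suc i) :: ('m::finite, 'n::finite) Ugl)"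
proof (rule hembed_induct[where Q = "\<lambda>v. \<exists>u. e i (Suc i) * v = u * e i (Suc i)"])
  fix c show "\<exists>u. e i (Suc i) * scal c = (u * e i (Suc i) :: ('m, 'n) Ugl)"
    by (rule exI[of _ "scal c"]) (rule scal_commute[symmetric])
next
  fix j assume "j \<in> {1..CARD('m) + CARD('n)}"
  then have "e i (Suc i) * e j j
      = ((e j j + of_bool (Suc i = j) - of_bool (j = i)) * e i (Suc i) :: ('m, 'n) Ugl)"
    by (subst e_bracket) (use assms in \<open>auto simp: odd_root_pair algebra_simps\<close>)
  then show "\<exists>u. e i (Suc i) * e j j = (u * e i (Suc i) :: ('m, 'n) Ugl)" by blast
next
  fix u v :: "('m, 'n) Ugl"
  assume "\<exists>u'. e i (Suc i) * u = u' * e i (Suc i)" "\<exists>v'. e i (Suc i) * v = v' * e i (Suc i)"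
  then obtain u' v' where *: "e i (Suc i) * u = u' * e i (Suc i)" "e i (Suc i) * v = v' * e i (Suc i)" by blast
  then have "e i (Suc i) * (u + v) = (u' + v') * e i (Suc i)" by (simp add: algebra_simps)
  then show "\<exists>w. e i (Suc i) * (u + v) = w * e i (Suc i)" by blast
  have "e i (Suc i) * (u * v) = u' * (e i (Suc i) * v)" by (simp only: mult.assoc[symmetric] *(1))
  also have "\<dots> = u' * v' * e i (Suc i)" unfolding *(2) by (simp only: mult.assoc)
  finally show "\<exists>w. e i (Suc i) * (u * v) = w * e i (Suc i)" by blast
qed

lemma cartan_hembed:
  assumes j: "j \<in> {1..CARD('m) + CARD('n)}"
  shows "e j j * hembed P = (hembed P * e j j :: ('m::finite, 'n::finite) Ugl)"
proof (rule hembed_induct[where Q = "\<lambda>v. e j j * v = v * e j j"])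
  fix u v :: "('m, 'n) Ugl"
  assume *: "e j j * u = u * e j j" "e j j * v = v * e j j"
  show "e j j * (u + v) = (u + v) * e j j" by (simp add: algebra_simps *)
  have "e j j * (u * v) = u * (e j j * v)" by (simp only: mult.assoc[symmetric] *(1))
  then show "e j j * (u * v) = u * v * e j j" unfolding *(2) by (simp only: mult.assoc)
qed (use j in \<open>auto intro: scal_commute[symmetric] cartan_commute\<close>)

lemma U_n_plus_iff:
  "x \<in> U_n_plus \<longleftrightarrow>
    (\<exists>y. x = (\<Sum>a\<in>pos_roots CARD('m) CARD('n). y a * e (fst a) (snd a) :: ('m::finite, 'n::finite) Ugl))"
  by (auto simp: U_n_plus_def)

lemma U_n_plus_zero: "0 \<in> U_n_plus"
  unfolding U_n_plus_iff by (rule exI[of _ "\<lambda>_. 0"]) simp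

lemma U_n_plus_add:
  assumes "x \<in> U_n_plus" "y \<in> U_n_plus"
  shows "(x + y :: ('m::finite, 'n::finite) Ugl) \<in> U_n_plus"
proof -
  obtain a b where "x = (\<Sum>r\<in>pos_roots CARD('m) CARD('n). a r * e (fst r) (snd r))"
    "y = (\<Sum>r\<in>pos_roots CARD('m) CARD('n). b r * e (fst r) (snd r))"
    using assms unfolding U_n_plus_iff by blast
  then show ?thesis unfolding U_n_plus_iff
    by (intro exI[of _ "\<lambda>r. a r + b r"]) (simp add: distrib_right sum.distrib)
qed

lemma U_n_plus_mult:
  assumes "x \<in> U_n_plus"
  shows "(u * x :: ('m::finite, 'n::finite) Ugl) \<in> U_n_plus"
proof -
  obtain a where "x = (\<Sum>r\<in>pos_roots CARD('m) CARD('n). a r * e (fst r) (snd r))"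
    using assms unfolding U_n_plus_iff by blast
  then show ?thesis unfolding U_n_plus_iff
    by (intro exI[of _ "\<lambda>r. u * a r"]) (simp add: sum_distrib_left mult.assoc)
qed

lemma U_n_plus_sum: "(\<And>a. a \<in> A \<Longrightarrow> g a \<in> U_n_plus) \<Longrightarrow> sum g A \<in> U_n_plus"
  by (induction A rule: infinite_finite_induct) (auto intro: U_n_plus_zero U_n_plus_add)

lemma e_in_U_n_plus:
  assumes "(i, j) \<in> pos_roots CARD('m) CARD('n)"
  shows "(e i j :: ('m::finite, 'n::finite) Ugl) \<in> U_n_plus"
proof -
  have "(\<Sum>a\<in>pos_roots CARD('m) CARD('n). (if a = (i, j) then 1 else 0) * e (fst a) (snd a))
      = (\<Sum>a\<in>pos_roots CARD('m) CARD('n). if a = (i, j) then e (fst a) (snd a) else 0 :: ('m, 'n) Ugl)"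
    by (rule sum.cong) auto
  also have "\<dots> = e i j" using assms by (simp add: sum.delta')
  finally show ?thesis unfolding U_n_plus_iff
    by (intro exI[of _ "\<lambda>a. if a = (i, j) then 1 else 0"]) simp
qed

definition theta :: "('m::finite, 'n::finite) Ugl" where
  "theta = (\<Sum>J\<in>II CARD('m) CARD('n). f_elt J * hembed (H_poly CARD('m) CARD('n) J))"

lemma H_poly_remove:
  assumes "j \<in> J" "j \<in> {1..m+n}"
  shows "H_poly m n (J - {j}) = h_poly m n (j - 1) * H_poly m n J"
proof -
  have "{1..m+n} - (J - {j}) = insert j ({1..m+n} - J)" using assms by auto
  then show ?thesis using assms unfolding H_poly_eq_prod by (subst prod.insert[symmetric]) auto
qed

lemma raise_bracket_H_poly:
  assumes T: "T \<in> II CARD('m) CARD('n)" "i \<in> T" "Suc i \<in> T"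
  shows "raise_bracket i (\<lambda>J. hembed (H_poly CARD('m) CARD('n) J)) T
    = (hembed (H_poly CARD('m) CARD('n) T) * hembed (if i = CARD('m) then z_poly CARD('m) CARD('n) else 0)
      :: ('m::finite, 'n::finite) Ugl)"
proof -
  define m n where "m = CARD('m)" and "n = CARD('n)"
  have i: "1 \<le> i" "Suc i \<le> m + n" and mn: "1 \<le> m" "1 \<le> n"
    using T by (auto simp: II_def m_def n_def Suc_leI)
  let ?s = "sg (i = m) :: hpoly"
  let ?H = "H_poly m n T"
  have X: "hembed (hX i) = (e i i :: ('m, 'n) Ugl)" "hembed (hX (Suc i)) = (e (Suc i) (Suc i) :: ('m, 'n) Ugl)"
    using i by (auto intro!: hembed_hom simp: m_def n_def)
  have "raise_bracket i (\<lambda>J. hembed (H_poly m n J)) T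
    = (hembed ((hX i - ?s * hX (Suc i) + (if 1 < i then 1 else 0)) * ?H
         + (if 1 < i then H_poly m n (T - {i}) else 0)
         - (if Suc i < m + n then ?s * H_poly m n (T - {Suc i}) else 0)) :: ('m, 'n) Ugl)"
    unfolding raise_bracket_def m_def[symmetric] n_def[symmetric]
    by (simp add: hembed_hom(1-7) hembed_sg X)
  also have "(hX i - ?s * hX (Suc i) + (if 1 < i then 1 else 0)) * ?H
         + (if 1 < i then H_poly m n (T - {i}) else 0)
         - (if Suc i < m + n then ?s * H_poly m n (T - {Suc i}) else 0)
    = ?H * (hX i - ?s * hX (Suc i) + 1 + h_poly m n (i - 1) - ?s * h_poly m n i)"
  proof -
    \<comment> \<open>For \<open>i = 1\<close> both sides vanish, the right one because h_0 =
      -1.\<close>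
    have 1: "(if 1 < i then 1 else 0) * ?H + (if 1 < i then H_poly m n (T - {i}) else 0)
        = ?H * (1 + h_poly m n (i - 1))"
    proof (cases "1 < i")
      case True
      then show ?thesis using H_poly_remove[of i T m n] T i by (simp add: algebra_simps)
    next
      case False
      then have "i - 1 = 0" using i by simp
      then show ?thesis using False by (simp add: h_poly_ends[OF mn])
    qed
    \<comment> \<open>For \<open>Suc i = m + n\<close> both sides vanish, the right one because
      h_{m+n-1} = 0.\<close>
    have 2: "(if Suc i < m + n then ?s * H_poly m n (T - {Suc i}) else 0) = ?H * (?s * h_poly m n i)"
    proof (cases "Suc i < m + n")
      case True
      then show ?thesis using H_poly_remove[of "Suc i" T m n] T i by (simp add: algebra_simps)
    next
      case False
      then have "i = m + n - 1" using i by simp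
      then have "h_poly m n i = 0" using h_poly_ends(2)[OF mn] by simp
      then show ?thesis using False by simp
    qed
    have "(hX i - ?s * hX (Suc i) + (if 1 < i then 1 else 0)) * ?H
         + (if 1 < i then H_poly m n (T - {i}) else 0)
         - (if Suc i < m + n then ?s * H_poly m n (T - {Suc i}) else 0)
      = (hX i - ?s * hX (Suc i)) * ?H + ((if 1 < i then 1 else 0) * ?H + (if 1 < i then H_poly m n (T - {i}) else 0))
         - (if Suc i < m + n then ?s * H_poly m n (T - {Suc i}) else 0)"
      by (simp only: distrib_right add.assoc)
    then show ?thesis unfolding 1 2 by (simp only:) (simp add: algebra_simps)
  qed
  finally show ?thesis
    unfolding h_poly_recurrence[OF mn i] by (simp add: hembed_hom(2) m_def n_def)
qed

lemma theta_simple: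
  assumes i: "1 \<le> i" "Suc i \<le> CARD('m) + CARD('n)"
  shows "\<exists>x. \<exists>y\<in>U_n_plus. e i (Suc i) * theta
    = x * hembed (z_poly CARD('m) CARD('n)) + (y :: ('m::finite, 'n::finite) Ugl)"
proof -
  let ?I = "II CARD('m) CARD('n)"
  let ?z = "z_poly CARD('m) CARD('n)"
  let ?X = "\<lambda>J. hembed (H_poly CARD('m) CARD('n) J) :: ('m, 'n) Ugl"
  let ?T = "{T. T \<in> ?I \<and> i \<in> T \<and> Suc i \<in> T}"
  obtain y where y: "e i (Suc i) * theta = (\<Sum>T\<in>?T. block i T * raise_bracket i ?X T)
      + (\<Sum>J\<in>?I. y J * (e i (Suc i) * ?X J))"
    using raise_sum[OF i, of ?X] unfolding theta_def by blast
  have "(\<Sum>T\<in>?T. block i T * raise_bracket i ?X T)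
      = (\<Sum>T\<in>?T. block i T * ?X T * (if i = CARD('m) then 1 else 0)) * hembed ?z"
    unfolding sum_distrib_right
  proof (rule sum.cong[OF refl])
    fix T assume "T \<in> ?T"
    then show "block i T * raise_bracket i ?X T = block i T * ?X T * (if i = CARD('m) then 1 else 0) * hembed ?z"
      by (simp add: raise_bracket_H_poly mult.assoc hembed_hom(6))
  qed
  moreover have "(\<Sum>J\<in>?I. y J * (e i (Suc i) * ?X J)) \<in> U_n_plus"
  proof (rule U_n_plus_sum)
    fix J
    obtain u where "e i (Suc i) * ?X J = u * e i (Suc i)" using raising_hembed[OF i] by blast
    moreover have "(e i (Suc i) :: ('m, 'n) Ugl) \<in> U_n_plus"
      by (rule e_in_U_n_plus) (use i in \<open>simp add: pos_roots_def\<close>)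
    ultimately show "y J * (e i (Suc i) * ?X J) \<in> U_n_plus" by (simp add: U_n_plus_mult)
  qed
  ultimately show ?thesis unfolding y by (intro exI bexI) auto
qed

text \<open>Positive root vectors are iterated brackets of simple ones, and \<open>L\<close>, the
  sum of U(g) z and U(g) n+, is a left ideal, so the simple case suffices.\<close>

lemma theta_raising:
  assumes "1 \<le> a" "a < b" "b \<le> CARD('m) + CARD('n)"
  shows "\<exists>x. \<exists>y\<in>U_n_plus. e a b * theta
    = x * hembed (z_poly CARD('m) CARD('n)) + (y :: ('m::finite, 'n::finite) Ugl)"
proof -
  let ?z = "hembed (z_poly CARD('m) CARD('n)) :: ('m, 'n) Ugl"
  define L where "L = {x * ?z + y | x y. y \<in> U_n_plus}"
  have add: "u + v \<in> L" if uv: "u \<in> L" "v \<in> L" for u v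
  proof -
    obtain x y x' y' where "u = x * ?z + y" "v = x' * ?z + y'" and y: "y \<in> U_n_plus" "y' \<in> U_n_plus"
      using uv unfolding L_def by blast
    then have "u + v = (x + x') * ?z + (y + y')" by (simp add: algebra_simps)
    then show ?thesis using U_n_plus_add[OF y] unfolding L_def by blast
  qed
  have mult: "w * u \<in> L" if u: "u \<in> L" for u w
  proof -
    obtain x y where "u = x * ?z + y" and y: "y \<in> U_n_plus"
      using u unfolding L_def by blast
    then have "w * u = (w * x) * ?z + w * y" by (simp add: algebra_simps)
    then show ?thesis using U_n_plus_mult[OF y] unfolding L_def by blast
  qed
  have simple: "e i (Suc i) * theta \<in> L" if "1 \<le> i" "Suc i \<le> CARD('m) + CARD('n)" for i
    using theta_simple[OF that] unfolding L_def by blast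
  have "e a b * theta \<in> L"
    using assms(2,3)
  proof (induction b)
    case (Suc b)
    show ?case
    proof (cases "a = b")
      case True
      then show ?thesis using simple assms Suc by simp
    next
      case False
      with Suc have ab: "a < b" "Suc b \<le> CARD('m) + CARD('n)" by simp_all
      define s where "s = (sg (odd_root CARD('m) (a, b) \<and> odd_root CARD('m) (b, Suc b)) :: ('m, 'n) Ugl)"
      have "e a b * e b (Suc b) = s * (e b (Suc b) * e a b) + (e a (Suc b) :: ('m, 'n) Ugl)"
        unfolding s_def using ab assms(1) by (subst e_bracket) auto
      then have "e a (Suc b) = e a b * e b (Suc b) + (- s * e b (Suc b)) * e a b"
        by (simp add: mult.assoc)
      then have "e a (Suc b) * theta = e a b * (e b (Suc b) * theta) + (- s * e b (Suc b)) * (e a b * theta)"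
        by (simp only: distrib_right mult.assoc)
      moreover have "e a b * theta \<in> L" "e b (Suc b) * theta \<in> L"
        using Suc.IH ab assms(1) simple[of b] by simp_all
      ultimately show ?thesis using add mult by (simp only:)
    qed
  qed simp
  then show ?thesis unfolding L_def by blast
qed

lemma f_elt_in_U_b_minus:
  assumes "finite J" "J \<noteq> {}"
  shows "(f_elt J :: ('m::finite, 'n::finite) Ugl) \<in> U_b_minus"
  using assms
proof (induction J rule: finite_linorder_max_induct)
  case (insert t J)
  show ?case
  proof (cases "J = {}")
    case True
    then show ?thesis using U_b_minus.scal[of 1, where 'm = 'm and 'n = 'n]
      by (simp add: f_elt_singleton scal_one)
  next
    case False
    have f: "f_elt (insert t J) = (e t (Max J) * f_elt J :: ('m, 'n) Ugl)"
      by (rule f_elt_insert) (use insert False in auto)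
    have "Max J < t" using insert False by auto
    then show ?thesis unfolding f using insert False
      by (intro U_b_minus.mult U_b_minus.gen) auto
  qed
qed simp

lemma theta_in_U_b_minus: "(theta :: ('m::finite, 'n::finite) Ugl) \<in> U_b_minus"
proof -
  have zero: "(0 :: ('m, 'n) Ugl) \<in> U_b_minus"
    using U_b_minus.scal[of 0, where 'm = 'm and 'n = 'n] by (simp add: scal_zero)
  have sum: "sum g A \<in> U_b_minus" if "\<And>a. a \<in> A \<Longrightarrow> g a \<in> U_b_minus" for g :: "nat set \<Rightarrow> ('m, 'n) Ugl" and A
    using that by (induction A rule: infinite_finite_induct) (auto intro: zero U_b_minus.add)
  have "hembed P \<in> (U_b_minus :: ('m, 'n) Ugl set)" for P
    by (rule hembed_induct[where Q = "\<lambda>v. v \<in> U_b_minus"]) (auto intro: U_b_minus.intros)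
  moreover have "finite J" "J \<noteq> {}" if "J \<in> II CARD('m) CARD('n)" for J
    using that finite_subset[of J "{1..CARD('m) + CARD('n)}"] by (auto simp: II_def)
  ultimately show ?thesis
    unfolding theta_def by (intro sum U_b_minus.mult f_elt_in_U_b_minus)
qed

lemma theta_weight: "has_weight (theta :: ('m::finite, 'n::finite) Ugl) (- eta CARD('m) CARD('n))"
  unfolding has_weight_def
proof
  let ?m = "CARD('m)" and ?n = "CARD('n)"
  fix j assume j: "j \<in> {1..?m + ?n}"
  let ?c = "of_bool (j = ?m + ?n) - of_bool (j = 1) :: ('m, 'n) Ugl"
  have c: "scal ((- eta ?m ?n) j) = ?c"
    by (simp add: eta_def eps_def del_def wt_def scal_zero scal_one scal_uminus)
  have comm: "e j j * (f_elt J * hembed P) - (f_elt J * hembed P) * e j j = ?c * (f_elt J * hembed P)"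
    if J: "J \<in> II ?m ?n" for J P
  proof -
    have fin: "finite J" "J \<noteq> {}" "J \<subseteq> {1..?m + ?n}"
      using J finite_subset[of J "{1..?m + ?n}"] by (auto simp: II_def)
    have M: "Max J = ?m + ?n" "Min J = 1"
      using J fin by (auto intro!: Max_eqI Min_eqI simp: II_def)
    have w: "e j j * f_elt J = f_elt J * e j j + ?c * f_elt J"
      using f_elt_weight[OF fin j] unfolding M .
    have "e j j * (f_elt J * hembed P) = (e j j * f_elt J) * hembed P" by (simp only: mult.assoc)
    also have "\<dots> = f_elt J * (e j j * hembed P) + ?c * (f_elt J * hembed P)"
      unfolding w by (simp only: distrib_right mult.assoc)
    also have "\<dots> = f_elt J * hembed P * e j j + ?c * (f_elt J * hembed P)"
      unfolding cartan_hembed[OF j] by (simp only: mult.assoc)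
    finally show ?thesis by simp
  qed
  show "e j j * theta - theta * e j j = scal ((- eta ?m ?n) j) * (theta :: ('m, 'n) Ugl)"
    unfolding theta_def c sum_distrib_left sum_distrib_right sum_subtractf[symmetric]
    by (rule sum.cong[OF refl]) (rule comm)
qed

section \<open>Reordering products of root vectors\<close>

text \<open>Any rearrangement is a chain of adjacent swaps, and the differences of \<open>F\<close>
  add up along the chain inside \<open>S\<close>. The letter wanted at the front is moved there one
  swap at a time.\<close>

lemma adjacent_swaps:
  fixes F :: "'b list \<Rightarrow> 'a::ab_group_add"
  assumes zero: "0 \<in> S" and add: "\<And>x y. x \<in> S \<Longrightarrow> y \<in> S \<Longrightarrow> x + y \<in> S"
    and swap: "\<And>us a b vs. mset (us @ a # b # vs) = M \<Longrightarrow> F (us @ a # b # vs) - F (us @ b # a # vs) \<in> S"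
    and "mset xs = M" "mset ys = M"
  shows "F ys - F xs \<in> S"
proof -
  have trans: "A - C \<in> S" if "A - B \<in> S" "B - C \<in> S" for A B C
    using add[OF that] by simp
  have move: "F (us @ y1 @ x # y2) - F (us @ x # y1 @ y2) \<in> S" if "mset (us @ y1 @ x # y2) = M" for us y1 x y2
    using that
  proof (induction y1 arbitrary: us)
    case Nil
    then show ?case by (simp add: zero)
  next
    case (Cons y y1)
    have "F ((us @ [y]) @ y1 @ x # y2) - F ((us @ [y]) @ x # y1 @ y2) \<in> S"
      by (rule Cons.IH) (use Cons.prems in simp)
    moreover have "F (us @ y # x # y1 @ y2) - F (us @ x # y # y1 @ y2) \<in> S"
      by (rule swap) (use Cons.prems in \<open>simp add: add_mset_commute\<close>)
    ultimately show ?case using trans by simp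
  qed
  have "F (us @ ys) - F (us @ xs) \<in> S" if "mset (us @ xs) = M" "mset xs = mset ys" for us
    using that
  proof (induction xs arbitrary: us ys)
    case Nil
    then show ?case by (simp add: zero)
  next
    case (Cons x xs)
    have "x \<in> set ys" using Cons.prems(2) by (metis list.set_intros(1) mset_eq_setD)
    then obtain y1 y2 where y: "ys = y1 @ x # y2" by (meson split_list)
    have "F (us @ y1 @ x # y2) - F (us @ x # y1 @ y2) \<in> S"
      by (rule move) (use Cons.prems y in simp)
    moreover have "F ((us @ [x]) @ y1 @ y2) - F ((us @ [x]) @ xs) \<in> S"
      by (rule Cons.IH) (use Cons.prems y in simp_all)
    ultimately show ?case unfolding y using trans by simp
  qed
  from this[of "[]"] show ?thesis using assms(4,5) by simp
qed

text \<open>Deleting \<open>b\<close> mirrors the bracket [e_{c,b}, e_{b,a}] = e_{c,a}, which arises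
  when neighbouring factors of a path product are interchanged.\<close>

lemma steps_remove:
  assumes "(a, b) \<in> steps J" "(b, c) \<in> steps J"
  shows "steps (J - {b}) = insert (a, c) (steps J - {(a, b), (b, c)})" and "(a, c) \<notin> steps J"
proof -
  have ab: "a \<in> J" "b \<in> J" "a < b" "\<And>x. x \<in> J \<Longrightarrow> \<not> (a < x \<and> x < b)"
    and bc: "c \<in> J" "b < c" "\<And>x. x \<in> J \<Longrightarrow> \<not> (b < x \<and> x < c)"
    using assms by (auto simp: steps_def)
  show "(a, c) \<notin> steps J" using ab bc by (auto simp: steps_def)
  have "(x, y) \<in> steps (J - {b}) \<longleftrightarrow> (x, y) \<in> insert (a, c) (steps J - {(a, b), (b, c)})" for x y
  proof
    assume xy: "(x, y) \<in> steps (J - {b})"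
    then have x: "x \<in> J" "x \<noteq> b" "y \<in> J" "y \<noteq> b" "x < y" "\<And>z. z \<in> J \<Longrightarrow> z \<noteq> b \<Longrightarrow> \<not> (x < z \<and> z < y)"
      by (auto simp: steps_def)
    show "(x, y) \<in> insert (a, c) (steps J - {(a, b), (b, c)})"
    proof (cases "x < b \<and> b < y")
      case True
      have "\<not> x < a" using x(6)[of a] ab True by auto
      moreover have "\<not> a < x" using ab(4)[of x] x True by auto
      moreover have "\<not> c < y" using x(6)[of c] bc True by auto
      moreover have "\<not> y < c" using bc(3)[of y] x True by auto
      ultimately show ?thesis by simp
    next
      case False
      then have "(x, y) \<in> steps J" using x by (auto simp: steps_def)
      then show ?thesis using x by auto
    qed
  next
    assume "(x, y) \<in> insert (a, c) (steps J - {(a, b), (b, c)})"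
    then consider "x = a" "y = c" | "(x, y) \<in> steps J" "(x, y) \<noteq> (a, b)" "(x, y) \<noteq> (b, c)" by auto
    then show "(x, y) \<in> steps (J - {b})"
    proof cases
      case 1
      have "\<not> (a < z \<and> z < c)" if "z \<in> J" "z \<noteq> b" for z
        using ab(4)[OF that(1)] bc(3)[OF that(1)] that(2) by linarith
      then show ?thesis using 1 ab bc by (auto simp: steps_def)
    next
      case 2
      then have xy: "x \<in> J" "y \<in> J" "x < y" "\<And>z. z \<in> J \<Longrightarrow> \<not> (x < z \<and> z < y)" by (auto simp: steps_def)
      have "x \<noteq> b"
      proof
        assume "x = b"
        with 2(3) have "y \<noteq> c" by simp
        then show False using xy(3) xy(4)[of c] xy(2) bc(1,2) bc(3)[of y] \<open>x = b\<close> by auto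
      qed
      moreover have "y \<noteq> b"
      proof
        assume "y = b"
        with 2(2) have "x \<noteq> a" by simp
        then show False using xy(1,3) xy(4)[of a] ab(1,3) ab(4)[of x] \<open>y = b\<close> by auto
      qed
      ultimately show ?thesis using xy by (auto simp: steps_def)
    qed
  qed
  then show "steps (J - {b}) = insert (a, c) (steps J - {(a, b), (b, c)})" by (intro set_eqI) force
qed

section \<open>Triangular changes between families of path products\<close>

definition lin_span :: "(nat set \<Rightarrow> ('m::finite, 'n::finite) Ugl) \<Rightarrow> nat set set \<Rightarrow> ('m, 'n) Ugl set" where
  "lin_span V S = {\<Sum>J\<in>S. V J * scal (c J) | c. True}"

lemma lin_span_zero: "0 \<in> lin_span V S"
  unfolding lin_span_def by (rule CollectI, rule exI[of _ "\<lambda>_. 0"]) (simp add: scal_zero)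

lemma lin_span_add: "x \<in> lin_span V S \<Longrightarrow> y \<in> lin_span V S \<Longrightarrow> x + y \<in> lin_span V S"
proof -
  assume "x \<in> lin_span V S" "y \<in> lin_span V S"
  then obtain c d where "x = (\<Sum>J\<in>S. V J * scal (c J))" "y = (\<Sum>J\<in>S. V J * scal (d J))"
    unfolding lin_span_def by blast
  then have "x + y = (\<Sum>J\<in>S. V J * scal (c J + d J))"
    by (simp add: scal_add distrib_left sum.distrib)
  then show ?thesis unfolding lin_span_def by (intro CollectI exI[of _ "\<lambda>J. c J + d J"]) simp
qed

lemma lin_span_scal: "x \<in> lin_span V S \<Longrightarrow> x * scal a \<in> lin_span V S"
proof -
  assume "x \<in> lin_span V S"
  then obtain c where "x = (\<Sum>J\<in>S. V J * scal (c J))"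
    unfolding lin_span_def by blast
  then have "x * scal a = (\<Sum>J\<in>S. V J * scal (c J * a))"
    by (simp add: scal_mult sum_distrib_right mult.assoc)
  then show ?thesis unfolding lin_span_def by (intro CollectI exI[of _ "\<lambda>J. c J * a"]) simp
qed

lemma lin_span_uminus: "x \<in> lin_span V S \<Longrightarrow> - x \<in> lin_span V S"
  using lin_span_scal[of x V S "-1"] by (simp add: scal_uminus scal_one)

lemma lin_span_diff: "x \<in> lin_span V S \<Longrightarrow> y \<in> lin_span V S \<Longrightarrow> x - y \<in> lin_span V S"
  using lin_span_add[OF _ lin_span_uminus, of x V S y] by simp

lemma lin_span_sum: "(\<And>a. a \<in> A \<Longrightarrow> g a \<in> lin_span V S) \<Longrightarrow> sum g A \<in> lin_span V S"
  by (induction A rule: infinite_finite_induct) (auto intro: lin_span_zero lin_span_add)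

lemma lin_span_base:
  assumes "finite S" "J \<in> S"
  shows "V J \<in> lin_span V S"
proof -
  have "(\<Sum>K\<in>S. V K * scal (if K = J then 1 else 0)) = (\<Sum>K\<in>S. if K = J then V K else 0)"
    by (rule sum.cong) (auto simp: scal_zero scal_one)
  also have "\<dots> = V J" using assms by (simp add: sum.delta')
  finally show ?thesis unfolding lin_span_def by (intro CollectI exI[of _ "\<lambda>K. if K = J then 1 else 0"]) simp
qed

lemma lin_span_mono: "x \<in> lin_span V S \<Longrightarrow> finite S' \<Longrightarrow> S \<subseteq> S' \<Longrightarrow> x \<in> lin_span V S'"
proof -
  assume "x \<in> lin_span V S" and S: "finite S'" "S \<subseteq> S'"
  then obtain c where "x = (\<Sum>J\<in>S. V J * scal (c J))" unfolding lin_span_def by blast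
  then show ?thesis
    by (simp only:) (intro lin_span_sum lin_span_scal lin_span_base; use S in auto)
qed

text \<open>Merging adjacent edges deletes a vertex, so the correction terms of a reordering are
  indexed by proper subsets that still contain 1 and m+n.\<close>

definition finer :: "nat \<Rightarrow> nat \<Rightarrow> nat set \<Rightarrow> nat set set" where
  "finer m n J = {K \<in> II m n. K \<subset> J}"

lemma finite_finer [simp]: "finite (finer m n J)"
  by (simp add: finer_def)

text \<open>Back substitution: by induction over proper subsets, every \<open>W K\<close> among the
  corrections is replaced by its expansion in the \<open>V\<close>.\<close>

lemma unitriangular_inverse:
  fixes V W :: "nat set \<Rightarrow> ('m::finite, 'n::finite) Ugl"
  assumes VW: "\<And>J. J \<in> II m n \<Longrightarrow> V J - W J \<in> lin_span W (finer m n J)"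
    and "J \<in> II m n"
  shows "W J - V J \<in> lin_span V (finer m n J)"
proof -
  have "finite J" using assms(2) finite_subset[of J "{1..m+n}"] by (auto simp: II_def)
  then show ?thesis using assms(2)
  proof (induction J rule: finite_psubset_induct)
    case (psubset J)
    obtain c where c: "V J - W J = (\<Sum>K\<in>finer m n J. W K * scal (c K))"
      using VW[OF psubset.prems] unfolding lin_span_def by blast
    have "W K \<in> lin_span V (finer m n J)" if K: "K \<in> finer m n J" for K
    proof -
      have "W K - V K \<in> lin_span V (finer m n K)"
        using psubset.IH K by (auto simp: finer_def)
      then have "W K - V K \<in> lin_span V (finer m n J)"
        by (rule lin_span_mono) (use K in \<open>auto simp: finer_def\<close>)
      from lin_span_add[OF this lin_span_base[of "finer m n J" K V]] K show ?thesis by simp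
    qed
    then have "V J - W J \<in> lin_span V (finer m n J)"
      unfolding c by (intro lin_span_sum lin_span_scal)
    from lin_span_uminus[OF this] show ?case by simp
  qed
qed

text \<open>A path changes sides of \<open>m\<close> at most once. Hence f_J has at most one odd
  factor, and interchanging factors produces no signs.\<close>

lemma odd_steps_unique:
  assumes "p \<in> steps J" "r \<in> steps J" "odd_root m p" "odd_root m r"
  shows "p = r"
proof -
  obtain a b c d where p: "p = (a, b)" "r = (c, d)" by (cases p, cases r) auto
  then have *: "a \<in> J" "b \<in> J" "c \<in> J" "d \<in> J" "a \<le> m" "m < b" "c \<le> m" "m < d"
    "\<And>x. x \<in> J \<Longrightarrow> \<not> (a < x \<and> x < b)" "\<And>x. x \<in> J \<Longrightarrow> \<not> (c < x \<and> x < d)"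
    using assms by (auto simp: steps_def odd_root_pair)
  have "a = c" using *(9)[of c] *(10)[of a] * by linarith
  moreover have "b = d" using *(9)[of d] *(10)[of b] * by linarith
  ultimately show ?thesis by (simp add: p)
qed

text \<open>Interchanging neighbouring factors costs 0 or a product in which two adjacent edges are
  merged. Its factors are the edges of \<open>J\<close> without one vertex, in some order, so
  induction on \<open>J\<close> puts it in the span of the smaller paths; \<open>merge\<close> is
  this step.\<close>

lemma reorder_f_elt:
  assumes "J \<in> II CARD('m) CARD('n)" "distinct ps" "set ps = prod.swap ` steps J"
  shows "prod_list (map (\<lambda>(a, b). e a b) ps) - f_elt J
    \<in> (lin_span f_elt (finer CARD('m) CARD('n) J) :: ('m::finite, 'n::finite) Ugl set)"
proof -
  let ?m = "CARD('m)" and ?n = "CARD('n)"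
  let ?E = "\<lambda>ps. prod_list (map (\<lambda>(a, b). e a b) ps) :: ('m, 'n) Ugl"
  have "finite J" using assms(1) finite_subset[of J "{1..?m + ?n}"] by (auto simp: II_def)
  then show ?thesis using assms
  proof (induction J arbitrary: ps rule: finite_psubset_induct)
    case (psubset J)
    let ?S = "lin_span f_elt (finer ?m ?n J) :: ('m, 'n) Ugl set"
    have J: "finite J" "J \<noteq> {}" "J \<subseteq> {1..?m + ?n}" "1 \<in> J" "?m + ?n \<in> J"
      using psubset by (auto simp: II_def)
    have merge: "?E qs \<in> ?S" if *: "(c, b) \<in> steps J" "(b, a) \<in> steps J" "distinct qs"
      "set qs = insert (a, c) (prod.swap ` steps J - {(b, c), (a, b)})" for a b c qs
    proof -
      have lt: "b \<in> J" "c \<in> J" "a \<in> J" "c < b" "b < a" using *(1,2) by (auto simp: steps_def)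
      then have "1 < b" "b < ?m + ?n" using J(3) by force+
      then have K: "J - {b} \<in> II ?m ?n" using psubset.prems(1) by (auto simp: II_def)
      have "set qs = prod.swap ` steps (J - {b})"
        unfolding steps_remove[OF *(1,2)] *(4) by auto
      then have "?E qs - f_elt (J - {b}) \<in> lin_span f_elt (finer ?m ?n (J - {b}))"
        using psubset.IH[of "J - {b}" qs] K lt *(3) by blast
      then have "?E qs - f_elt (J - {b}) \<in> ?S"
        by (rule lin_span_mono) (auto simp: finer_def)
      moreover have "f_elt (J - {b}) \<in> ?S"
        by (rule lin_span_base) (use K lt in \<open>auto simp: finer_def\<close>)
      ultimately show ?thesis using lin_span_add by fastforce
    qed
    obtain qs where qs: "sorted_wrt (\<lambda>p q. fst q < fst p) qs" "set qs = prod.swap ` steps J"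
      "f_elt J = ?E qs"
      using f_elt_steps[OF J(1,2), where 'm = 'm and 'n = 'n] by blast
    have dq: "distinct qs" using qs(1) by (induction qs) auto
    have "?E ps - ?E qs \<in> ?S"
    proof (rule adjacent_swaps[of ?S "mset qs" ?E])
      show "mset ps = mset qs"
        using set_eq_iff_mset_eq_distinct[of ps qs] dq psubset.prems(2,3) qs(2) by blast
      fix us p r vs assume M: "mset (us @ p # r # vs) = mset qs"
      obtain a b c d where p: "p = (a, b)" "r = (c, d)" by (cases p, cases r) auto
      have dist: "distinct (us @ p # r # vs)" using M dq by (metis mset_eq_imp_distinct_iff)
      have set: "set (us @ p # r # vs) = prod.swap ` steps J" using M qs(2) by (metis mset_eq_setD)
      have st: "(b, a) \<in> steps J" "(d, c) \<in> steps J"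
      proof -
        have "p \<in> prod.swap ` steps J" "r \<in> prod.swap ` steps J" unfolding set[symmetric] by auto
        then show "(b, a) \<in> steps J" "(d, c) \<in> steps J" by (auto simp: p)
      qed
      have bd: "{a, b, c, d} \<subseteq> {1..?m + ?n}" "b < a" "d < c" using st J(3) by (auto simp: steps_def)
      have "p \<noteq> r" using dist by auto
      then have "(odd_root ?m (a, b) \<and> odd_root ?m (c, d)) = False"
        using odd_steps_unique[OF st, of ?m] by (auto simp: p odd_root_pair)
      then have br: "e a b * e c d = e c d * e a b + (if b = c then e a d else 0)
          - (if d = a then e c b else 0 :: ('m, 'n) Ugl)"
        using e_bracket[OF bd(1)] by (simp only:) simp
      have diff: "?E (us @ p # r # vs) - ?E (us @ r # p # vs)
          = (if b = c then ?E (us @ (a, d) # vs) else 0) - (if d = a then ?E (us @ (c, b) # vs) else 0)"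
      proof -
        have 1: "?E (us @ p # r # vs) = ?E us * (e a b * e c d) * ?E vs"
          by (simp add: p mult.assoc)
        have 2: "?E (us @ r # p # vs) = ?E us * (e c d * e a b) * ?E vs"
          by (simp add: p mult.assoc)
        have 3: "A * (x + s - t) * B - A * x * B = A * s * B - A * t * B" for A B x s t :: "('m, 'n) Ugl"
          by (simp add: algebra_simps)
        show ?thesis unfolding 1 2 br 3 by (simp add: mult.assoc)
      qed
      have "?E (us @ (a, d) # vs) \<in> ?S" if "b = c"
      proof (rule merge[of d b a])
        show "(d, b) \<in> steps J" "(b, a) \<in> steps J" using st that by simp_all
        \<comment> \<open>The merged edge skips a vertex of \<open>J\<close>, so it is not an edge
          of \<open>J\<close> and the new list stays distinct.\<close>
        have nin: "(a, d) \<notin> set (us @ p # r # vs)"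
          using steps_remove(2)[of d b J a] st that unfolding set by auto
        then show "distinct (us @ (a, d) # vs)" using dist by auto
        have "set us \<union> set vs = prod.swap ` steps J - {p, r}" using set dist by auto
        then show "set (us @ (a, d) # vs) = insert (a, d) (prod.swap ` steps J - {(b, d), (a, b)})"
          using that by (auto simp: p)
      qed
      moreover have "?E (us @ (c, b) # vs) \<in> ?S" if "d = a"
      proof (rule merge[of b a c])
        show "(b, a) \<in> steps J" "(a, c) \<in> steps J" using st that by simp_all
        have nin: "(c, b) \<notin> set (us @ p # r # vs)"
          using steps_remove(2)[of b a J c] st that unfolding set by auto
        then show "distinct (us @ (c, b) # vs)" using dist by auto
        have "set us \<union> set vs = prod.swap ` steps J - {p, r}" using set dist by auto
        then show "set (us @ (c, b) # vs) = insert (c, b) (prod.swap ` steps J - {(a, b), (c, a)})"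
          using that by (auto simp: p)
      qed
      ultimately show "?E (us @ p # r # vs) - ?E (us @ r # p # vs) \<in> ?S"
        unfolding diff by (intro lin_span_diff) (auto intro: lin_span_zero)
    qed (auto intro: lin_span_zero lin_span_add)
    then show ?case unfolding qs(3) .
  qed
qed

section \<open>Root vector products in the prescribed order\<close>

definition path_partition :: "nat set \<Rightarrow> nat \<times> nat \<Rightarrow> nat" where
  "path_partition J = (\<lambda>a. if a \<in> steps J then 1 else 0)"

lemma e_neg_path_partition:
  "e_neg os (path_partition J)
    = (prod_list (map (\<lambda>(a, b). e a b) (map prod.swap (filter (\<lambda>a. a \<in> steps J) os))) :: ('m::finite, 'n::finite) Ugl)"
  unfolding e_neg_def path_partition_def by (induction os) (auto simp: split_beta)

lemma steps_subset_pos_roots: "J \<subseteq> {1..m+n} \<Longrightarrow> steps J \<subseteq> pos_roots m n"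
  by (auto simp: steps_def pos_roots_def)

lemma e_neg_f_elt:
  assumes "J \<in> II CARD('m) CARD('n)" "distinct os" "set os = pos_roots CARD('m) CARD('n)"
  shows "e_neg os (path_partition J) - f_elt J
    \<in> (lin_span f_elt (finer CARD('m) CARD('n) J) :: ('m::finite, 'n::finite) Ugl set)"
  unfolding e_neg_path_partition
proof (rule reorder_f_elt[OF assms(1)])
  show "distinct (map prod.swap (filter (\<lambda>a. a \<in> steps J) os))"
    using assms(2) by (simp add: distinct_map)
  have "steps J \<subseteq> set os"
    unfolding assms(3) by (rule steps_subset_pos_roots) (use assms(1) in \<open>auto simp: II_def\<close>)
  then show "set (map prod.swap (filter (\<lambda>a. a \<in> steps J) os)) = prod.swap ` steps J" by auto
qed

section \<open>Partitions of $\eta$\<close>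

lemma sum_root_steps:
  assumes "finite J" "J \<noteq> {}"
  shows "(\<Sum>a\<in>steps J. root a k) = wt (Min J) k - wt (Max J) k"
  using assms
proof (induction J rule: finite_linorder_max_induct)
  case (insert t J)
  show ?case
  proof (cases "J = {}")
    case True
    then show ?thesis by (simp add: steps_singleton)
  next
    case False
    have s: "steps (insert t J) = insert (Max J, t) (steps J)"
      by (rule steps_insert) (use insert False in auto)
    have "(Max J, t) \<notin> steps J" using insert by (auto simp: steps_def)
    moreover have "finite (steps J)"
      by (rule finite_subset[of _ "J \<times> J"]) (use insert in \<open>auto simp: steps_def\<close>)
    moreover have "Max (insert t J) = t" using insert by (intro Max_eqI) auto
    moreover have "Min (insert t J) = Min J"
      by (rule Min_insert_greater) (use insert False in auto)
    ultimately show ?thesis unfolding s using insert False by (simp add: root_def)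
  qed
qed simp

lemma path_partition_in_partitions:
  assumes "1 \<le> m + n" "J \<in> II m n"
  shows "path_partition J \<in> partitions m n (wt 1 - wt (m + n))"
proof -
  have J: "finite J" "J \<noteq> {}" "J \<subseteq> {1..m+n}"
    using assms finite_subset[of J "{1..m+n}"] by (auto simp: II_def)
  have M: "Max J = m + n" "Min J = 1"
    using assms J by (auto intro!: Max_eqI Min_eqI simp: II_def)
  have sub: "steps J \<subseteq> pos_roots m n" by (rule steps_subset_pos_roots[OF J(3)])
  have "(\<Sum>a\<in>pos_roots m n. of_nat (path_partition J a) * root a k) = wt 1 k - wt (m + n) k" for k
  proof -
    have "(\<Sum>a\<in>pos_roots m n. of_nat (path_partition J a) * root a k) = (\<Sum>a\<in>steps J. root a k)"
      by (rule sum.mono_neutral_cong_right) (use sub in \<open>auto simp: path_partition_def\<close>)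
    then show ?thesis unfolding sum_root_steps[OF J(1,2)] M .
  qed
  then show ?thesis
    using sub by (auto simp: partitions_def path_partition_def fun_eq_iff)
qed

lemma sum_root_last_column:
  fixes p :: "nat \<times> nat \<Rightarrow> nat"
  assumes "\<And>a b. p (a, b) \<noteq> 0 \<Longrightarrow> 1 \<le> a \<and> a < b \<and> b \<le> Suc t"
  shows "(\<Sum>a\<in>{1..Suc t} \<times> {1..Suc t}. of_nat (p a) * root a k)
    = (\<Sum>a\<in>{1..t} \<times> {1..t}. of_nat (p a) * root a k)
      + (\<Sum>a\<in>{1..t}. of_nat (p (a, Suc t)) * (root (a, Suc t) k :: complex))"
proof -
  let ?f = "\<lambda>a. of_nat (p a) * (root a k :: complex)"
  let ?C = "(\<lambda>a. (a, Suc t)) ` {1..t}"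
  have "sum ?f ({1..Suc t} \<times> {1..Suc t}) = sum ?f ({1..t} \<times> {1..t} \<union> ?C)"
  proof (rule sum.mono_neutral_right)
    show "\<forall>a\<in>{1..Suc t} \<times> {1..Suc t} - ({1..t} \<times> {1..t} \<union> ?C). ?f a = 0"
    proof
      fix a assume a: "a \<in> {1..Suc t} \<times> {1..Suc t} - ({1..t} \<times> {1..t} \<union> ?C)"
      have "p a = 0"
      proof (rule ccontr)
        assume "p a \<noteq> 0"
        then have "1 \<le> fst a" "fst a < snd a" "snd a \<le> Suc t" using assms[of "fst a" "snd a"] by auto
        then have "a \<in> {1..t} \<times> {1..t} \<or> a \<in> ?C"
          by (cases a; cases "snd a = Suc t") auto
        with a show False by blast
      qed
      then show "?f a = 0" by simp
    qed
  qed auto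
  also have "\<dots> = sum ?f ({1..t} \<times> {1..t}) + sum ?f ?C"
    by (rule sum.union_disjoint) auto
  also have "sum ?f ?C = (\<Sum>a\<in>{1..t}. ?f (a, Suc t))"
    by (subst sum.reindex) (auto simp: inj_on_def)
  finally show ?thesis .
qed

text \<open>Only roots ending in the last index contribute to its coordinate, so their
  multiplicities sum to 0 or 1. In the second case the unique such root is the last edge, and
  deleting it leaves the same problem ending at a smaller \<open>c\<close>; this is why
  \<open>i\<close> is allowed to be below \<open>t\<close>.\<close>

lemma path_partition_exhaust:
  fixes p :: "nat \<times> nat \<Rightarrow> nat"
  assumes "1 \<le> i" "i \<le> t" "\<And>a b. p (a, b) \<noteq> 0 \<Longrightarrow> 1 \<le> a \<and> a < b \<and> b \<le> t"
    "\<And>k. (\<Sum>a\<in>{1..t} \<times> {1..t}. of_nat (p a) * root a k) = (wt 1 k - wt i k :: complex)"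
  shows "\<exists>J\<subseteq>{1..i}. 1 \<in> J \<and> i \<in> J \<and> p = path_partition J"
  using assms
proof (induction t arbitrary: i p)
  case 0
  then show ?case by simp
next
  case (Suc t)
  note supp = Suc.prems(3) and weight = Suc.prems(4)
  have lastcol: "(\<Sum>a\<in>{1..Suc t} \<times> {1..Suc t}. of_nat (p a) * root a k)
    = (\<Sum>a\<in>{1..t} \<times> {1..t}. of_nat (p a) * root a k)
      + (\<Sum>a\<in>{1..t}. of_nat (p (a, Suc t)) * (root (a, Suc t) k :: complex))" for k
    by (rule sum_root_last_column, rule supp)
  show ?case
  proof (cases "t = 0")
    case True
    then have "i = 1" using Suc.prems by simp
    moreover have "p = (\<lambda>_. 0)"
    proof
      fix x show "p x = 0" using supp[of "fst x" "snd x"] True by (cases "p x = 0") auto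
    qed
    ultimately show ?thesis
      by (intro exI[of _ "{1}"]) (auto simp: path_partition_def steps_singleton)
  next
    case False
    have "(\<Sum>a\<in>{1..t} \<times> {1..t}. of_nat (p a) * root a (Suc t)) = (0 :: complex)"
      by (rule sum.neutral) (auto simp: root_def wt_def)
    moreover have "(\<Sum>a\<in>{1..t}. of_nat (p (a, Suc t)) * root (a, Suc t) (Suc t))
        = (- of_nat (\<Sum>a\<in>{1..t}. p (a, Suc t)) :: complex)"
      unfolding of_nat_sum sum_negf[symmetric] by (rule sum.cong) (auto simp: root_def wt_def)
    ultimately have "- of_nat (\<Sum>a\<in>{1..t}. p (a, Suc t)) = (wt 1 (Suc t) - wt i (Suc t) :: complex)"
      using weight[of "Suc t"] lastcol[of "Suc t"] by simp
    then have "(of_nat (\<Sum>a\<in>{1..t}. p (a, Suc t)) :: complex) = of_nat (if i = Suc t then 1 else 0)"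
      using False by (simp add: wt_def split: if_splits)
    then have col: "(\<Sum>a\<in>{1..t}. p (a, Suc t)) = (if i = Suc t then 1 else 0)"
      by (rule of_nat_eq_iff[THEN iffD1])
    show ?thesis
    proof (cases "i = Suc t")
      case False
      then have z: "p (a, Suc t) = 0" if "a \<in> {1..t}" for a
        using col that by simp
      have "\<exists>J\<subseteq>{1..i}. 1 \<in> J \<and> i \<in> J \<and> p = path_partition J"
      proof (rule Suc.IH)
        show "1 \<le> a \<and> a < b \<and> b \<le> t" if "p (a, b) \<noteq> 0" for a b
        proof -
          have *: "1 \<le> a" "a < b" "b \<le> Suc t" using supp[OF that] by auto
          have "b \<noteq> Suc t"
          proof
            assume "b = Suc t"
            then have "a \<in> {1..t}" using * by auto
            from z[OF this] show False using that \<open>b = Suc t\<close> by simp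
          qed
          then show ?thesis using * by simp
        qed
        show "(\<Sum>a\<in>{1..t} \<times> {1..t}. of_nat (p a) * root a k) = (wt 1 k - wt i k :: complex)" for k
          using weight[of k] lastcol[of k] z by simp
      qed (use Suc.prems False in auto)
      then show ?thesis .
    next
      case True
      then have "(\<Sum>a\<in>{1..t}. p (a, Suc t)) = 1" using col by simp
      then have "\<exists>c\<in>{1..t}. p (c, Suc t) = 1 \<and> (\<forall>a\<in>{1..t}. c \<noteq> a \<longrightarrow> p (a, Suc t) = 0)"
        by (rule sum_eq_1_iff[OF finite_atLeastAtMost, THEN iffD1])
      then obtain c where c: "c \<in> {1..t}" "p (c, Suc t) = 1"
        "\<And>a. a \<in> {1..t} \<Longrightarrow> a \<noteq> c \<Longrightarrow> p (a, Suc t) = 0"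
        by metis
      define p' where "p' = p((c, Suc t) := 0)"
      have "\<exists>J\<subseteq>{1..c}. 1 \<in> J \<and> c \<in> J \<and> p' = path_partition J"
      proof (rule Suc.IH)
        show "1 \<le> a \<and> a < b \<and> b \<le> t" if "p' (a, b) \<noteq> 0" for a b
        proof -
          have pn: "p (a, b) \<noteq> 0" "(a, b) \<noteq> (c, Suc t)" using that by (auto simp: p'_def split: if_splits)
          have *: "1 \<le> a" "a < b" "b \<le> Suc t" using supp[OF pn(1)] by auto
          have "b \<noteq> Suc t"
          proof
            assume b: "b = Suc t"
            then have "a \<in> {1..t}" "a \<noteq> c" using * pn(2) by auto
            from c(3)[OF this] show False using pn(1) b by simp
          qed
          then show ?thesis using * by simp
        qed
        fix k
        have "(\<Sum>a\<in>{1..t}. of_nat (p (a, Suc t)) * root (a, Suc t) k)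
            = (\<Sum>a\<in>{1..t}. if a = c then root (a, Suc t) k else 0 :: complex)"
          by (rule sum.cong) (auto simp: c)
        also have "\<dots> = root (c, Suc t) k" using c(1) by (simp add: sum.delta')
        finally have 1: "(\<Sum>a\<in>{1..t}. of_nat (p (a, Suc t)) * root (a, Suc t) k) = (root (c, Suc t) k :: complex)" .
        have 2: "(\<Sum>a\<in>{1..t} \<times> {1..t}. of_nat (p' a) * root a k)
            = (\<Sum>a\<in>{1..t} \<times> {1..t}. of_nat (p a) * root a k :: complex)"
          by (rule sum.cong) (auto simp: p'_def)
        show "(\<Sum>a\<in>{1..t} \<times> {1..t}. of_nat (p' a) * root a k) = (wt 1 k - wt c k :: complex)"
        proof -
          have cancel: "A = x - y" if "A + r = x - z" "r = y - z" for A r x y z :: complex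
            using that by (simp add: algebra_simps)
          have "(\<Sum>a\<in>{1..t} \<times> {1..t}. of_nat (p a) * root a k) + root (c, Suc t) k = wt 1 k - wt i k"
            using weight[of k] unfolding lastcol 1 .
          moreover have "root (c, Suc t) k = wt c k - wt i k" unfolding True by (simp add: root_def)
          ultimately show ?thesis unfolding 2 by (rule cancel)
        qed
      next
        show "1 \<le> c" "c \<le> t" using c(1) by simp_all
      qed
      then obtain J where J: "J \<subseteq> {1..c}" "1 \<in> J" "c \<in> J" "p' = path_partition J" by blast
      have fin: "finite J" using J(1) finite_subset by blast
      have Max: "Max J = c" using J fin by (intro Max_eqI) auto
      have lt: "j < Suc t" if "j \<in> J" for j using that J(1) c(1) by force
      have "steps (insert (Suc t) J) = insert (c, Suc t) (steps J)"
        using steps_insert[OF fin _ lt] J(2) unfolding Max by blast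
      moreover have "p = p'((c, Suc t) := 1)" unfolding p'_def using fun_upd_idem[of p "(c, Suc t)" 1, OF c(2)] by simp
      ultimately have "p = path_partition (insert (Suc t) J)"
        unfolding J(4) by (auto simp: path_partition_def fun_eq_iff)
      moreover have "insert (Suc t) J \<subseteq> {1..i}" using J(1) c(1) True by auto
      ultimately show ?thesis using J(2) True by (intro exI[of _ "insert (Suc t) J"]) auto
    qed
  qed
qed

lemma partitions_eta:
  assumes "1 \<le> m" "1 \<le> n"
  shows "partitions m n (eta m n) = path_partition ` II m n"
proof -
  have eta: "eta m n = wt 1 - wt (m + n)" by (simp add: eta_def eps_def del_def)
  have "p \<in> path_partition ` II m n" if p: "p \<in> partitions m n (eta m n)" for p
  proof -
    have supp: "1 \<le> a \<and> a < b \<and> b \<le> m + n" if "p (a, b) \<noteq> 0" for a b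
    proof -
      have "\<forall>a. a \<notin> pos_roots m n \<longrightarrow> p a = 0" using p by (simp add: partitions_def)
      with that have "(a, b) \<in> pos_roots m n" by metis
      then show ?thesis by (simp add: pos_roots_def)
    qed
    have "(\<Sum>a\<in>{1..m+n} \<times> {1..m+n}. of_nat (p a) * root a k) = (wt 1 k - wt (m + n) k :: complex)" for k
    proof -
      have "(\<Sum>a\<in>{1..m+n} \<times> {1..m+n}. of_nat (p a) * root a k)
          = (\<Sum>a\<in>pos_roots m n. of_nat (p a) * root a k :: complex)"
        by (rule sum.mono_neutral_right) (use supp in \<open>auto simp: pos_roots_def\<close>)
      also have "\<dots> = eta m n k" using p by (auto simp: partitions_def fun_eq_iff)
      finally show ?thesis by (simp add: eta)
    qed
    then have "\<exists>J\<subseteq>{1..m+n}. 1 \<in> J \<and> m + n \<in> J \<and> p = path_partition J"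
      by (intro path_partition_exhaust[where t = "m + n"]) (use assms supp in auto)
    then show ?thesis by (auto simp: II_def)
  qed
  then show ?thesis
    using path_partition_in_partitions[of m n] assms unfolding eta by auto
qed

lemma fst_steps:
  assumes "finite J" "J \<noteq> {}"
  shows "J = fst ` steps J \<union> {Max J}"
proof -
  have "x \<in> fst ` steps J" if x: "x \<in> J" "x \<noteq> Max J" for x
  proof -
    \<comment> \<open>The successor of \<open>x\<close> in \<open>J\<close>, which provides the edge
      starting at \<open>x\<close>.\<close>
    let ?y = "Min {y \<in> J. x < y}"
    have "x < Max J" using x Max_ge[OF assms(1) x(1)] by simp
    then have ne: "finite {y \<in> J. x < y}" "{y \<in> J. x < y} \<noteq> {}"
      using Max_in[OF assms] assms(1) by auto
    then have "?y \<in> {y \<in> J. x < y}" by (rule Min_in)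
    moreover have "\<not> (x < z \<and> z < ?y)" if "z \<in> J" for z
      using Min_le[OF ne(1), of z] that by auto
    ultimately have "(x, ?y) \<in> steps J" using x by (auto simp: steps_def)
    then show ?thesis by force
  qed
  then show ?thesis using Max_in[OF assms] by (auto simp: steps_def)
qed

lemma steps_determine:
  assumes "J \<in> II m n" "K \<in> II m n" "steps J = steps K"
  shows "J = K"
proof -
  have "J = fst ` steps J \<union> {m + n}" if "J \<in> II m n" for J
  proof -
    have J: "finite J" "J \<noteq> {}" "J \<subseteq> {1..m+n}" "m + n \<in> J"
      using that finite_subset[of J "{1..m+n}"] by (auto simp: II_def)
    then have "Max J = m + n" by (intro Max_eqI) auto
    then show ?thesis using fst_steps[OF J(1,2)] by simp
  qed
  then show ?thesis using assms by metis
qed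

lemma inj_path_partition: "inj_on path_partition (II m n)"
proof (rule inj_onI)
  fix J K assume "J \<in> II m n" "K \<in> II m n" and eq: "path_partition J = path_partition K"
  have "a \<in> steps J \<longleftrightarrow> a \<in> steps K" for a
    using fun_cong[OF eq, of a] by (auto simp: path_partition_def split: if_splits)
  then have "steps J = steps K" by blast
  then show "J = K" using steps_determine \<open>J \<in> II m n\<close> \<open>K \<in> II m n\<close> by blast
qed

text \<open>Identifies the partition \<pi>^0 that carries the normalisation: if every edge has
  length one, the successor of each vertex \<open>k\<close> is \<open>Suc k\<close>.\<close>

lemma simple_path:
  assumes "J \<in> II m n" "steps J \<subseteq> simple_roots m n"
  shows "J = {1..m+n}"
proof -
  have J: "J \<subseteq> {1..m+n}" "1 \<in> J" "m + n \<in> J" "finite J" using assms(1) finite_subset[of J "{1..m+n}"] by (auto simp: II_def)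
  have "k \<in> J" if "1 \<le> k" "k \<le> m + n" for k
    using that
  proof (induction k rule: nat_induct_at_least)
    case (Suc k)
    let ?y = "Min {y \<in> J. k < y}"
    have ne: "finite {y \<in> J. k < y}" "{y \<in> J. k < y} \<noteq> {}"
      using J Suc by (auto intro!: exI[of _ "m + n"])
    then have y: "?y \<in> {y \<in> J. k < y}" by (rule Min_in)
    moreover have "\<not> (k < z \<and> z < ?y)" if "z \<in> J" for z
      using Min_le[OF ne(1), of z] that by auto
    ultimately have "(k, ?y) \<in> steps J" using Suc by (auto simp: steps_def)
    then have "?y = Suc k" using assms(2) by (auto simp: simple_roots_def)
    then show ?case using y by simp
  qed (rule J(2))
  then show ?thesis using J(1) by auto
qed

lemma steps_full: "steps {1..N} \<subseteq> {(i, i + 1) | i. 1 \<le> i \<and> i + 1 \<le> N}"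
proof
  fix a assume a: "a \<in> steps {1..N}"
  then have *: "1 \<le> fst a" "fst a < snd a" "snd a \<le> N" "\<not> fst a + 1 < snd a"
    by (auto simp: steps_def split_beta)
  then have "snd a = fst a + 1" by linarith
  then show "a \<in> {(i, i + 1) | i. 1 \<le> i \<and> i + 1 \<le> N}" using * by (cases a) auto
qed

section \<open>Existence\<close>

lemma S_h_add: "P \<in> S_h m n \<Longrightarrow> R \<in> S_h m n \<Longrightarrow> P + R \<in> S_h m n"
  unfolding S_h_def using keys_add[of P R] by fastforce

lemma S_h_mult:
  assumes "P \<in> S_h m n" "R \<in> S_h m n"
  shows "P * R \<in> S_h m n"
  unfolding S_h_def
proof (intro CollectI ballI)
  fix k assume "k \<in> Poly_Mapping.keys (P * R)"
  then obtain a b where k: "k = a + b" "a \<in> Poly_Mapping.keys P" "b \<in> Poly_Mapping.keys R"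
    using keys_mult[of P R] by blast
  then show "Poly_Mapping.keys k \<subseteq> {1..m+n}"
    using assms keys_add[of a b] unfolding S_h_def k(1) by blast
qed

lemma S_h_hC: "hC c \<in> S_h m n"
  by (simp add: S_h_def hC_def)

lemma S_h_hX: "i \<in> {1..m+n} \<Longrightarrow> hX i \<in> S_h m n"
  by (simp add: S_h_def hX_def)

lemma S_h_one: "1 \<in> S_h m n"
  using S_h_hC[of 1] by (simp add: hC_hom)

lemma S_h_diff:
  assumes "P \<in> S_h m n" "R \<in> S_h m n"
  shows "P - R \<in> S_h m n"
proof -
  have "P + hC (- 1) * R \<in> S_h m n" by (intro S_h_add S_h_mult S_h_hC assms)
  then show ?thesis by (simp add: hC_hom)
qed

lemma S_h_sum: "(\<And>a. a \<in> A \<Longrightarrow> g a \<in> S_h m n) \<Longrightarrow> sum g A \<in> S_h m n"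
  using S_h_hC[of 0 m n]
  by (induction A rule: infinite_finite_induct) (auto simp: hC_hom intro: S_h_add)

lemma S_h_prod: "(\<And>a. a \<in> A \<Longrightarrow> g a \<in> S_h m n) \<Longrightarrow> prod g A \<in> S_h m n"
  by (induction A rule: infinite_finite_induct) (auto intro: S_h_one S_h_mult)

lemma H_poly_in_S_h:
  assumes "1 \<le> m" "1 \<le> n"
  shows "H_poly m n J \<in> S_h m n"
proof -
  have "h_poly m n (x - 1) \<in> S_h m n" if "x \<in> {1..m+n}" for x
    using that assms
    by (subst h_poly_eq) (auto intro!: S_h_add S_h_diff S_h_hC S_h_hX S_h_one)
  then show ?thesis unfolding H_poly_eq_prod by (intro S_h_prod) simp
qed

lemma unitriangular_expansion:
  fixes V :: "nat set \<Rightarrow> ('m::finite, 'n::finite) Ugl"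
  assumes "x - V J \<in> lin_span V (finer m n J)" "J \<in> II m n"
  shows "\<exists>b. x = (\<Sum>K\<in>II m n. V K * scal (b K)) \<and> b J = 1 \<and> (\<forall>K\<in>II m n. b K \<noteq> 0 \<longrightarrow> K \<subseteq> J)"
proof -
  obtain c where c: "x - V J = (\<Sum>K\<in>finer m n J. V K * scal (c K))"
    using assms(1) unfolding lin_span_def by blast
  define b where "b = (\<lambda>K. if K = J then 1 else if K \<in> finer m n J then c K else 0)"
  have nin: "J \<notin> finer m n J" by (simp add: finer_def)
  have "(\<Sum>K\<in>II m n. V K * scal (b K)) = (\<Sum>K\<in>insert J (finer m n J). V K * scal (b K))"
    by (rule sum.mono_neutral_right) (use assms(2) in \<open>auto simp: b_def finer_def scal_zero\<close>)
  also have "\<dots> = V J * scal (b J) + (\<Sum>K\<in>finer m n J. V K * scal (b K))"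
    by (rule sum.insert) (use nin in auto)
  also have "(\<Sum>K\<in>finer m n J. V K * scal (b K)) = x - V J"
    unfolding c by (rule sum.cong) (use nin in \<open>auto simp: b_def\<close>)
  finally have "x = (\<Sum>K\<in>II m n. V K * scal (b K))" by (simp add: b_def scal_one)
  then show ?thesis by (intro exI[of _ b]) (auto simp: b_def finer_def)
qed

lemma full_in_II: "1 \<le> m \<Longrightarrow> {1..m+n} \<in> II m n"
  by (auto simp: II_def)

text \<open>The full set is the largest element of \<open>II m n\<close>, so its coefficient is
  untouched by a triangular change.\<close>

lemma sum_II_full:
  assumes "1 \<le> m" "\<And>J. J \<in> II m n \<Longrightarrow> \<not> {1..m+n} \<subseteq> J \<Longrightarrow> g J = 0"
  shows "sum g (II m n) = g {1..m+n}"
proof -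
  have "sum g (II m n) = sum g {{1..m+n}}"
    by (rule sum.mono_neutral_right) (use assms full_in_II[OF assms(1)] in \<open>auto simp: II_def\<close>)
  then show ?thesis by simp
qed

lemma H_poly_full: "H_poly m n {1..m+n} = 1"
  by (simp add: H_poly_eq_prod)

text \<open>\<open>theta\<close> is already singular; what remains is its expansion in the ordered
  products. If f_J has coefficient b_{J,K} at the product for K, then \<open>theta\<close> has there
  the sum over J of the b_{J,K} H_J, again in U(h).\<close>

lemma sapovalov_exists:
  fixes os :: "(nat \<times> nat) list"
  assumes os: "distinct os" "set os = pos_roots CARD('m::finite) CARD('n::finite)"
  shows "\<exists>H. sapovalov os (eta CARD('m) CARD('n)) H (theta :: ('m, 'n) Ugl)"
proof -
  define m n where mn_def: "m = CARD('m)" "n = CARD('n)"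
  have mn: "1 \<le> m" "1 \<le> n" by (simp_all add: mn_def Suc_leI)
  let ?I = "II m n"
  let ?V = "\<lambda>J. e_neg os (path_partition J) :: ('m, 'n) Ugl"
  have inv: "f_elt J - ?V J \<in> lin_span ?V (finer m n J)" if "J \<in> ?I" for J
    by (rule unitriangular_inverse[OF _ that]) (use e_neg_f_elt[OF _ os] in \<open>simp add: mn_def\<close>)
  have "\<forall>J\<in>?I. \<exists>b. f_elt J = (\<Sum>K\<in>?I. ?V K * scal (b K)) \<and> b J = 1 \<and> (\<forall>K\<in>?I. b K \<noteq> 0 \<longrightarrow> K \<subseteq> J)"
    by (intro ballI unitriangular_expansion inv)
  then obtain b where b: "\<And>J. J \<in> ?I \<Longrightarrow> f_elt J = (\<Sum>K\<in>?I. ?V K * scal (b J K))"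
    "\<And>J. J \<in> ?I \<Longrightarrow> b J J = 1" "\<And>J K. J \<in> ?I \<Longrightarrow> K \<in> ?I \<Longrightarrow> b J K \<noteq> 0 \<Longrightarrow> K \<subseteq> J"
    by (subst (asm) bchoice_iff) blast
  define G where "G K = (\<Sum>J\<in>?I. hC (b J K) * H_poly m n J)" for K
  \<comment> \<open>\<open>G\<close> is indexed by sets and \<open>H\<close> by partitions; the
    bijection between them is inverted.\<close>
  define H where "H p = G (the_inv_into ?I path_partition p)" for p
  have inj: "inj_on path_partition ?I" by (rule inj_path_partition)
  have HG: "H (path_partition K) = G K" if "K \<in> ?I" for K
    unfolding H_def using the_inv_into_f_f[OF inj that] by simp
  have parts: "partitions m n (eta m n) = path_partition ` ?I" by (rule partitions_eta[OF mn])
  have "theta = (\<Sum>J\<in>?I. \<Sum>K\<in>?I. ?V K * hembed (hC (b J K) * H_poly m n J))"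
    unfolding theta_def mn_def[symmetric]
  proof (rule sum.cong[OF refl])
    fix J assume "J \<in> ?I"
    show "f_elt J * hembed (H_poly m n J) = (\<Sum>K\<in>?I. ?V K * hembed (hC (b J K) * H_poly m n J))"
      unfolding b(1)[OF \<open>J \<in> ?I\<close>] by (simp add: sum_distrib_right hembed_hom mult.assoc)
  qed
  also have "\<dots> = (\<Sum>K\<in>?I. \<Sum>J\<in>?I. ?V K * hembed (hC (b J K) * H_poly m n J))"
    by (rule sum.swap)
  also have "\<dots> = (\<Sum>K\<in>?I. ?V K * hembed (G K))"
    by (simp only: G_def hembed_hom sum_distrib_left)
  also have "\<dots> = (\<Sum>K\<in>?I. ?V K * hembed (H (path_partition K)))"
    by (rule sum.cong) (simp_all add: HG)
  also have "\<dots> = sapovalov_sum os (eta m n) H"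
    unfolding sapovalov_sum_def mn_def[symmetric] parts by (simp add: sum.reindex[OF inj])
  finally have sum: "(theta :: ('m, 'n) Ugl) = sapovalov_sum os (eta m n) H" .
  have S: "H p \<in> S_h m n" if "p \<in> partitions m n (eta m n)" for p
    unfolding H_def G_def by (intro S_h_sum S_h_mult S_h_hC H_poly_in_S_h mn)
  have simple: "H p = 1" if p: "p \<in> partitions m n (eta m n)" "\<forall>a. a \<notin> simple_roots m n \<longrightarrow> p a = 0" for p
  proof -
    obtain J where J: "J \<in> ?I" "p = path_partition J" using p(1) unfolding parts by blast
    have "steps J \<subseteq> simple_roots m n"
    proof
      fix a assume "a \<in> steps J"
      then have "p a = 1" by (simp add: J(2) path_partition_def)
      then show "a \<in> simple_roots m n" using p(2) by (metis zero_neq_one)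
    qed
    then have full: "J = {1..m+n}" by (rule simple_path[OF J(1)])
    \<comment> \<open>By triangularity only the full path has the product of all simple root vectors
      in its expansion.\<close>
    have "G J = hC (b J J) * H_poly m n J"
      unfolding G_def full
    proof (rule sum_II_full[OF mn(1)])
      fix K assume K: "K \<in> ?I" "\<not> {1..m+n} \<subseteq> K"
      then have "b K J = 0" using b(3)[of K J] J(1) full by blast
      then show "hC (b K {1..m+n}) * H_poly m n K = 0" by (simp add: hC_hom full)
    qed
    also have "\<dots> = 1" using b(2)[OF J(1)] H_poly_full[of m n] by (simp add: hC_hom full)
    finally show ?thesis unfolding J(2) HG[OF J(1)] .
  qed
  have raise: "\<exists>x. \<exists>y\<in>U_n_plus. e (fst a) (snd a) * theta
      = x * (hembed (h_elt m n (eta m n)) + scal (heval m n (h_elt m n (eta m n)) (rho m n))) + (y :: ('m, 'n) Ugl)"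
    if "a \<in> pos_roots m n" for a
    using theta_raising[of "fst a" "snd a", where 'm = 'm and 'n = 'n] that
    by (auto simp: pos_roots_def z_poly_def hembed_hom mn_def)
  show ?thesis
    unfolding sapovalov_def Let_def mn_def[symmetric]
    using sum S simple raise theta_in_U_b_minus theta_weight[where 'm = 'm and 'n = 'n]
    by (intro exI[of _ H]) (simp add: mn_def)
qed

section \<open>Uniqueness of the evaluation\<close>

lemma act_mult_hembed:
  "act l (u * hembed P :: ('m::finite, 'n::finite) Ugl) = smul (heval CARD('m) CARD('n) P l) (act l u)"
  unfolding act_simps(4) act_hembed app_smul by (simp only: act_def)

lemma act_scal: "act l (scal c :: ('m::finite, 'n::finite) Ugl) = smul c vacuum"
  by (simp add: act_def gl_rep_hom)

text \<open>On the vacuum the right coefficients H_\<pi> act by their values at \<lambda>, so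
  \<open>t\<close> and its evaluation have the same image, also after left multiplication by
  \<open>e i j\<close>. The element h_\<eta> + \<rho>(h_\<eta>) acts by (\<lambda>+\<rho>,\<eta>) =
  0.\<close>

lemma act_sapovalov_eval:
  assumes S: "sapovalov os (eta CARD('m) CARD('n)) H (t :: ('m::finite, 'n::finite) Ugl)"
    and l: "form CARD('m) CARD('n) (l + rho CARD('m) CARD('n)) (eta CARD('m) CARD('n)) = 0"
    and ij: "(i, j) \<in> pos_roots CARD('m) CARD('n)"
  shows "act l (e i j * (sapovalov_eval os (eta CARD('m) CARD('n)) H l :: ('m, 'n) Ugl)) = 0"
proof -
  let ?m = "CARD('m)" and ?n = "CARD('n)"
  let ?P = "partitions ?m ?n (eta ?m ?n)"
  let ?h = "h_elt ?m ?n (eta ?m ?n)"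
  have t: "t = sapovalov_sum os (eta ?m ?n) H" using S by (simp add: sapovalov_def Let_def)
  have "\<exists>x. \<exists>y\<in>U_n_plus. e (fst (i, j)) (snd (i, j)) * t
      = x * (hembed ?h + scal (heval ?m ?n ?h (rho ?m ?n))) + (y :: ('m, 'n) Ugl)"
    using S ij unfolding sapovalov_def Let_def by blast
  then obtain x y where xy: "e i j * t = x * (hembed ?h + scal (heval ?m ?n ?h (rho ?m ?n))) + y" "y \<in> U_n_plus"
    by auto
  have "act l (hembed ?h + scal (heval ?m ?n ?h (rho ?m ?n)) :: ('m, 'n) Ugl)
      = smul (form ?m ?n (l + rho ?m ?n) (eta ?m ?n)) vacuum"
    unfolding act_simps(1) act_hembed act_scal heval_h_elt form_add_left
    by (rule ext) (simp add: smul_def distrib_right)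
  also have "\<dots> = 0" unfolding l by (rule ext) (simp add: smul_def)
  finally have "act l (e i j * t) = 0"
    unfolding xy(1) act_simps(1) act_simps(4) using act_U_n_plus[OF xy(2)] by simp
  moreover have "act l (e i j * t) = act l (e i j * (sapovalov_eval os (eta ?m ?n) H l :: ('m, 'n) Ugl))"
    unfolding t sapovalov_sum_def sapovalov_eval_def sum_distrib_left act_sum mult.assoc[symmetric]
      act_mult_hembed act_simps(5) ..
  ultimately show ?thesis by simp
qed

definition block_steps :: "nat \<Rightarrow> nat set \<Rightarrow> (nat \<times> nat) set" where
  "block_steps i T = steps (T \<inter> {Suc i..}) \<union> steps (T \<inter> {..i})"

text \<open>The smaller ends of the edges are all vertices except the tops of the two paths,
  \<open>i\<close> and \<open>m + n\<close>, which are therefore added.\<close>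

lemma block_steps_inj:
  assumes "T \<in> II m n" "i \<in> T" "Suc i \<in> T"
  shows "T = fst ` block_steps i T \<union> {i, m + n}"
proof -
  have T: "finite T" "T \<subseteq> {1..m+n}" "m + n \<in> T"
    using assms finite_subset[of T "{1..m+n}"] by (auto simp: II_def)
  have "Suc i \<le> m + n" using assms(3) T(2) by auto
  have M: "Max (T \<inter> {Suc i..}) = m + n" "Max (T \<inter> {..i}) = i"
    using T assms \<open>Suc i \<le> m + n\<close> by (auto intro!: Max_eqI)
  have "T \<inter> {Suc i..} = fst ` steps (T \<inter> {Suc i..}) \<union> {m + n}"
    "T \<inter> {..i} = fst ` steps (T \<inter> {..i}) \<union> {i}"
    using fst_steps[of "T \<inter> {Suc i..}"] fst_steps[of "T \<inter> {..i}"] T assms unfolding M by auto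
  moreover have "T = (T \<inter> {Suc i..}) \<union> (T \<inter> {..i})" by auto
  ultimately show ?thesis unfolding block_steps_def by blast
qed

text \<open>The rows of the upper path exceed \<open>i\<close> and those of the lower one do not, so
  the concatenated factors are still in decreasing order of rows and act by distinct creation
  operators.\<close>

lemma act_block:
  assumes T: "T \<in> II CARD('m) CARD('n)" "i \<in> T" "Suc i \<in> T"
  shows "\<exists>s. s \<noteq> 0 \<and> act l (block i T :: ('m::finite, 'n::finite) Ugl)
    = smul s (unit_vec (\<lambda>p. if p \<in> prod.swap ` block_steps i T then 1 else 0))"
proof -
  let ?m = "CARD('m)" and ?N = "CARD('m) + CARD('n)"
  let ?A = "T \<inter> {Suc i..}" and ?C = "T \<inter> {..i}"
  have TN: "finite T" "T \<subseteq> {1..?N}" using T finite_subset[of T "{1..?N}"] by (auto simp: II_def)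
  have ne: "finite ?A" "?A \<noteq> {}" "finite ?C" "?C \<noteq> {}" using T TN by auto
  obtain ps where ps: "sorted_wrt (\<lambda>p q. fst q < fst p) ps" "set ps = prod.swap ` steps ?A"
    "f_elt ?A = (prod_list (map (\<lambda>(a, b). e a b) ps) :: ('m, 'n) Ugl)"
    using f_elt_steps[OF ne(1,2)] by blast
  obtain qs where qs: "sorted_wrt (\<lambda>p q. fst q < fst p) qs" "set qs = prod.swap ` steps ?C"
    "f_elt ?C = (prod_list (map (\<lambda>(a, b). e a b) qs) :: ('m, 'n) Ugl)"
    using f_elt_steps[OF ne(3,4)] by blast
  have "fst q < fst p" if "p \<in> set ps" "q \<in> set qs" for p q
    using that unfolding ps(2) qs(2) by (auto simp: steps_def)
  then have sorted: "sorted_wrt (\<lambda>p q. fst q < fst p) (ps @ qs)"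
    using ps(1) qs(1) by (auto simp: sorted_wrt_append)
  have set: "set (ps @ qs) = prod.swap ` block_steps i T"
    unfolding block_steps_def set_append ps(2) qs(2) by blast
  have range: "\<forall>(a, b)\<in>set (ps @ qs). 1 \<le> b \<and> b < a \<and> a \<le> ?N"
    using TN(2) unfolding set block_steps_def by (force simp: steps_def)
  have "distinct xs" if "sorted_wrt (\<lambda>p q. fst q < fst p) xs" for xs :: "(nat \<times> nat) list"
    using that by (induction xs) auto
  from this[OF sorted] have dist: "distinct (ps @ qs)" .
  have "block i T = (prod_list (map (\<lambda>(a, b). e a b) (ps @ qs)) :: ('m, 'n) Ugl)"
    by (simp add: block_def ps(3) qs(3))
  then have "act l (block i T :: ('m, 'n) Ugl)
      = app (prod_list (map (\<lambda>(a, b). gl_op ?m l ?N a b) (ps @ qs))) vacuum"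
    by (simp only: act_def gl_rep_prod_list map_map o_def case_prod_unfold gl_rep_hom)
  also have "\<dots> = app (prod_list (map (cre ?m) (ps @ qs))) vacuum"
    using gl_op_path_vacuum[OF sorted range] by blast
  finally show ?thesis using cre_path_vacuum[OF dist, of ?m] unfolding set by simp
qed

text \<open>On the vacuum each block becomes a nonzero multiple of a unit vector, and different
  \<open>T\<close> have different unit vectors. Reading the coordinate \<open>ind T0\<close>
  isolates the equation for \<open>T0\<close>.\<close>

lemma singular_coefficients:
  fixes u :: "nat set \<Rightarrow> complex"
  assumes sing: "act l (e i (Suc i) * (\<Sum>J\<in>II CARD('m) CARD('n). f_elt J * scal (u J)) :: ('m::finite, 'n::finite) Ugl) = 0"
    and i: "1 \<le> i" "Suc i \<le> CARD('m) + CARD('n)"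
    and T0: "T0 \<in> II CARD('m) CARD('n)" "i \<in> T0" "Suc i \<in> T0"
  shows "(l i - sg (i = CARD('m)) * l (Suc i) + (if 1 < i then 1 else 0)) * u T0
     + (if 1 < i then u (T0 - {i}) else 0)
     - (if Suc i < CARD('m) + CARD('n) then sg (i = CARD('m)) * u (T0 - {Suc i}) else 0) = 0"
proof -
  let ?m = "CARD('m)" and ?N = "CARD('m) + CARD('n)"
  let ?I = "II CARD('m) CARD('n)"
  let ?T = "{T. T \<in> ?I \<and> i \<in> T \<and> Suc i \<in> T}"
  let ?X = "\<lambda>J. scal (u J) :: ('m, 'n) Ugl"
  define B where "B T = (l i - sg (i = ?m) * l (Suc i) + (if 1 < i then 1 else 0)) * u T
     + (if 1 < i then u (T - {i}) else 0) - (if Suc i < ?N then sg (i = ?m) * u (T - {Suc i}) else 0)" for T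
  define ind where "ind T = (\<lambda>p. if p \<in> prod.swap ` block_steps i T then 1 else 0 :: nat)" for T
  have sg: "sg b = (scal (sg b) :: ('m, 'n) Ugl)" for b
    by (cases b) (simp_all add: scal_one scal_uminus)
  have diag: "app (gl_rep l (e j j :: ('m, 'n) Ugl)) vacuum = smul (l j) vacuum" if "j \<in> {1..?N}" for j
    unfolding gl_rep_hom by (rule gl_op_diag_vacuum[OF that])
  have bracket: "act l (raise_bracket i ?X T) = smul (B T) vacuum" for T
  proof -
    have "raise_bracket i ?X T = (e i i * scal (u T) - e (Suc i) (Suc i) * scal (sg (i = ?m) * u T)
      + scal ((if 1 < i then u T else 0) + (if 1 < i then u (T - {i}) else 0)
          - (if Suc i < ?N then sg (i = ?m) * u (T - {Suc i}) else 0)) :: ('m, 'n) Ugl)"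
      unfolding raise_bracket_def
      by (cases "i = ?m") (auto simp: scal_add scal_diff scal_zero scal_one scal_uminus algebra_simps)
    moreover have "act l (e j j * scal c :: ('m, 'n) Ugl) = smul (l j * c) vacuum" if "j \<in> {1..?N}" for j c
      unfolding act_simps(5) unfolding act_def diag[OF that] smul_simps by (simp only: mult.commute)
    ultimately have "act l (raise_bracket i ?X T) = smul (l i * u T) vacuum - smul (l (Suc i) * (sg (i = ?m) * u T)) vacuum
      + smul ((if 1 < i then u T else 0) + (if 1 < i then u (T - {i}) else 0)
          - (if Suc i < ?N then sg (i = ?m) * u (T - {Suc i}) else 0)) vacuum"
      using i by (simp only: act_simps(1,2) act_scal) simp
    also have "\<dots> = smul (B T) vacuum"
      by (rule ext) (simp add: smul_def B_def algebra_simps)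
    finally show ?thesis .
  qed
  obtain y where y: "e i (Suc i) * (\<Sum>J\<in>?I. f_elt J * ?X J)
    = (\<Sum>T\<in>?T. block i T * raise_bracket i ?X T) + (\<Sum>J\<in>?I. y J * (e i (Suc i) * ?X J))"
    using raise_sum[OF i, of ?X] by blast
  have "act l (y J * (e i (Suc i) * ?X J)) = 0" for J
    unfolding act_simps(4)[of l "y J"] act_simps(5)
    using act_raising[of i "Suc i" l, where 'm = 'm and 'n = 'n] i by (simp add: smul_simps)
  then have "act l (\<Sum>J\<in>?I. y J * (e i (Suc i) * ?X J)) = 0"
    unfolding act_sum by (intro sum.neutral) blast
  with sing have zero: "(\<Sum>T\<in>?T. act l (block i T * raise_bracket i ?X T)) = 0"
    unfolding y act_simps(1) act_sum by simp
  have "\<forall>T\<in>?T. \<exists>s. s \<noteq> 0 \<and> act l (block i T :: ('m, 'n) Ugl) = smul s (unit_vec (ind T))"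
    using act_block[of _ i l] unfolding ind_def by blast
  then obtain s where s: "\<And>T. T \<in> ?T \<Longrightarrow> s T \<noteq> 0"
    "\<And>T. T \<in> ?T \<Longrightarrow> act l (block i T :: ('m, 'n) Ugl) = smul (s T) (unit_vec (ind T))"
    by (subst (asm) bchoice_iff) blast
  have ap: "sum f A k = (\<Sum>a\<in>A. f a k)" for f :: "nat set \<Rightarrow> vec" and A k
    by (induction A rule: infinite_finite_induct) auto
  have "act l (block i T * raise_bracket i ?X T) (ind T0) = (if T = T0 then B T0 * s T0 else 0)" if T: "T \<in> ?T" for T
  proof -
    have "act l (block i T * raise_bracket i ?X T) = smul (B T) (act l (block i T :: ('m, 'n) Ugl))"
      unfolding act_simps(4) bracket app_smul by (simp only: act_def)
    then have "act l (block i T * raise_bracket i ?X T) (ind T0) = B T * (s T * unit_vec (ind T) (ind T0))"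
      unfolding s(2)[OF T] by (simp add: smul_def)
    moreover have "ind T = ind T0 \<Longrightarrow> T = T0"
    proof -
      assume "ind T = ind T0"
      then have "p \<in> prod.swap ` block_steps i T \<longleftrightarrow> p \<in> prod.swap ` block_steps i T0" for p
        unfolding ind_def by (metis zero_neq_one)
      then have "prod.swap ` block_steps i T = prod.swap ` block_steps i T0" by blast
      then have "block_steps i T = block_steps i T0" by (simp add: inj_image_eq_iff)
      then show "T = T0" using block_steps_inj T T0 by (metis (no_types, lifting) mem_Collect_eq)
    qed
    ultimately show ?thesis by (auto simp: unit_vec_def)
  qed
  then have "(\<Sum>T\<in>?T. act l (block i T * raise_bracket i ?X T) (ind T0)) = (\<Sum>T\<in>?T. if T = T0 then B T0 * s T0 else 0)"
    by (intro sum.cong) auto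
  also have "\<dots> = B T0 * s T0" using T0 by (simp add: sum.delta')
  finally have "B T0 * s T0 = 0" using fun_cong[OF zero, of "ind T0"] unfolding ap by simp
  then have "B T0 = 0" using s(1)[of T0] T0 by simp
  then show ?thesis unfolding B_def .
qed

text \<open>Induction on the number of missing indices and then on the least missing index x = i+1.
  The equation for \<open>i\<close> and T = J with x added expresses u_J through u_T, which misses
  fewer indices, and u_{T - {i}}, which misses equally many but has a smaller first gap.\<close>

lemma coefficients_vanish:
  fixes u :: "nat set \<Rightarrow> complex"
  assumes full: "u {1..m+n} = 0"
    and rec: "\<And>i T. 1 \<le> i \<Longrightarrow> Suc i < m + n \<Longrightarrow> T \<in> II m n \<Longrightarrow> i \<in> T \<Longrightarrow> Suc i \<in> T \<Longrightarrow> u T = 0 \<Longrightarrow>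
      (1 < i \<Longrightarrow> u (T - {i}) = 0) \<Longrightarrow> u (T - {Suc i}) = 0"
    and "J \<in> II m n"
  shows "u J = 0"
  using assms(3)
proof (induction "card ({1..m+n} - J)" arbitrary: J)
  case 0
  then have "{1..m+n} - J = {}" by simp
  then have "J = {1..m+n}" using 0(2) by (auto simp: II_def)
  then show ?case using full by simp
next
  case (Suc k)
  note fewer = Suc.hyps(1)
  have "u J = 0" if "J \<in> II m n" "card ({1..m+n} - J) = Suc k" "x = Min ({1..m+n} - J)" for x J
    using that
  proof (induction x arbitrary: J rule: less_induct)
    case (less x J)
    let ?M = "{1..m+n} - J"
    have M: "finite ?M" "?M \<noteq> {}" using less.prems(2) by (simp, metis card.empty nat.distinct(1))
    have x: "x \<in> ?M" "\<And>y. y \<in> ?M \<Longrightarrow> x \<le> y"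
      unfolding less.prems(3) by (rule Min_in[OF M], rule Min_le[OF M(1)])
    have ends: "1 \<in> J" "m + n \<in> J" "J \<subseteq> {1..m+n}" using less.prems(1) by (auto simp: II_def)
    have "x \<noteq> 1" "x \<noteq> m + n" using x(1) ends by auto
    then have xb: "1 < x" "x < m + n" using x(1) by auto
    define i where "i = x - 1"
    have i: "x = Suc i" "1 \<le> i" "Suc i < m + n" using xb by (auto simp: i_def)
    have iJ: "i \<in> J" using x(2)[of i] i by fastforce
    define T where "T = insert x J"
    have T: "T \<in> II m n" using less.prems(1) x(1) by (auto simp: T_def II_def)
    have MT: "{1..m+n} - T = ?M - {x}" by (auto simp: T_def)
    have "card ({1..m+n} - T) = k" unfolding MT using x(1) less.prems(2) M by simp
    then have uT: "u T = 0" using fewer[of T] T by simp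
    \<comment> \<open>Compared with \<open>J\<close>, the gap at \<open>x\<close> has moved down to
      \<open>i\<close>, and \<open>i\<close> is now the least one.\<close>
    have uTi: "u (T - {i}) = 0" if "1 < i"
    proof (rule less.IH)
      have MTi: "{1..m+n} - (T - {i}) = insert i (?M - {x})"
        using iJ i ends by (auto simp: T_def)
      have "i \<notin> ?M - {x}" using iJ by simp
      then show "card ({1..m+n} - (T - {i})) = Suc k"
        unfolding MTi using M x(1) less.prems(2) by simp
      show "i < x" using i by simp
      show "T - {i} \<in> II m n" using T that i by (auto simp: II_def)
      show "i = Min ({1..m+n} - (T - {i}))"
        unfolding MTi using M x(2) i by (intro Min_eqI[symmetric]) fastforce+
    qed
    have "u (T - {Suc i}) = 0"
      by (rule rec[OF i(2,3) T _ _ uT uTi]) (use iJ i in \<open>auto simp: T_def\<close>)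
    moreover have "T - {Suc i} = J" using x(1) i by (auto simp: T_def)
    ultimately show ?case by simp
  qed
  then show ?case using Suc by metis
qed

text \<open>Among the ordered products only the one for \<pi>^0 involves the full path, with
  coefficient 1, so the normalisation H_{\<pi>^0} = 1 survives the change to the f_J.\<close>

lemma sapovalov_eval_expansion:
  fixes os :: "(nat \<times> nat) list"
  assumes os: "distinct os" "set os = pos_roots CARD('m::finite) CARD('n::finite)"
    and S: "sapovalov os (eta CARD('m) CARD('n)) H (t :: ('m, 'n) Ugl)"
  shows "\<exists>c. sapovalov_eval os (eta CARD('m) CARD('n)) H l
      = (\<Sum>J\<in>II CARD('m) CARD('n). f_elt J * scal (c J) :: ('m, 'n) Ugl)
    \<and> c {1..CARD('m) + CARD('n)} = 1"
proof -
  define m n where mn_def: "m = CARD('m)" "n = CARD('n)"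
  have mn: "1 \<le> m" "1 \<le> n" by (simp_all add: mn_def Suc_leI)
  let ?I = "II m n"
  let ?V = "\<lambda>J. e_neg os (path_partition J) :: ('m, 'n) Ugl"
  let ?F = "{1..m+n}"
  have F: "?F \<in> ?I" by (rule full_in_II[OF mn(1)])
  have "\<forall>J\<in>?I. \<exists>a. ?V J = (\<Sum>K\<in>?I. f_elt K * scal (a K)) \<and> a J = 1 \<and> (\<forall>K\<in>?I. a K \<noteq> 0 \<longrightarrow> K \<subseteq> J)"
    unfolding mn_def by (intro ballI unitriangular_expansion e_neg_f_elt os)
  then obtain a where a: "\<And>J. J \<in> ?I \<Longrightarrow> ?V J = (\<Sum>K\<in>?I. f_elt K * scal (a J K))"
    "\<And>J. J \<in> ?I \<Longrightarrow> a J J = 1" "\<And>J K. J \<in> ?I \<Longrightarrow> K \<in> ?I \<Longrightarrow> a J K \<noteq> 0 \<Longrightarrow> K \<subseteq> J"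
    by (subst (asm) bchoice_iff) blast
  define h where "h J = heval m n (H (path_partition J)) l" for J
  define c where "c K = (\<Sum>J\<in>?I. a J K * h J)" for K
  have inj: "inj_on path_partition ?I" by (rule inj_path_partition)
  have parts: "partitions m n (eta m n) = path_partition ` ?I" by (rule partitions_eta[OF mn])
  have "sapovalov_eval os (eta m n) H l = (\<Sum>J\<in>?I. ?V J * scal (h J))"
    unfolding sapovalov_eval_def mn_def[symmetric] parts by (simp add: sum.reindex[OF inj] h_def)
  also have "\<dots> = (\<Sum>J\<in>?I. \<Sum>K\<in>?I. f_elt K * scal (a J K * h J))"
  proof (rule sum.cong[OF refl])
    fix J assume "J \<in> ?I"
    show "?V J * scal (h J) = (\<Sum>K\<in>?I. f_elt K * scal (a J K * h J))"
      unfolding a(1)[OF \<open>J \<in> ?I\<close>] by (simp add: sum_distrib_right scal_mult mult.assoc)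
  qed
  also have "\<dots> = (\<Sum>K\<in>?I. \<Sum>J\<in>?I. f_elt K * scal (a J K * h J))" by (rule sum.swap)
  also have "\<dots> = (\<Sum>K\<in>?I. f_elt K * scal (c K))"
  proof (rule sum.cong[OF refl])
    fix K
    have "scal (sum g A) = (\<Sum>x\<in>A. scal (g x) :: ('m, 'n) Ugl)" for g :: "nat set \<Rightarrow> complex" and A
      by (induction A rule: infinite_finite_induct) (auto simp: scal_zero scal_add)
    then show "(\<Sum>J\<in>?I. f_elt K * scal (a J K * h J)) = (f_elt K * scal (c K) :: ('m, 'n) Ugl)"
      by (simp only: c_def sum_distrib_left)
  qed
  finally have 1: "sapovalov_eval os (eta m n) H l = (\<Sum>K\<in>?I. f_elt K * scal (c K) :: ('m, 'n) Ugl)" .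
  have "c ?F = a ?F ?F * h ?F"
    unfolding c_def
  proof (rule sum_II_full[OF mn(1)])
    fix J assume "J \<in> ?I" "\<not> ?F \<subseteq> J"
    then show "a J ?F * h J = 0" using a(3)[of J ?F] F by auto
  qed
  also have "\<dots> = h ?F" using a(2)[OF F] by simp
  also have "\<dots> = 1"
  proof -
    have "path_partition ?F x = 0" if "x \<notin> simple_roots m n" for x
      using that steps_full[of "m + n"] unfolding path_partition_def simple_roots_def by auto
    moreover have "path_partition ?F \<in> partitions m n (eta m n)" unfolding parts using F by blast
    ultimately have "H (path_partition ?F) = 1"
      using S unfolding sapovalov_def Let_def mn_def[symmetric] by blast
    then show ?thesis by (simp add: h_def heval_hom)
  qed
  finally show ?thesis using 1 unfolding mn_def by blast
qed

text \<open>Both coefficient families solve the same homogeneous equations and equal 1 at the full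
  set. Their difference solves them with initial value 0, so it vanishes, and the two sums agree
  already in U(g).\<close>

lemma sapovalov_eval_eq_sum:
  fixes os :: "(nat \<times> nat) list"
  assumes os: "distinct os" "set os = pos_roots CARD('m::finite) CARD('n::finite)"
    and l: "form CARD('m) CARD('n) (l + rho CARD('m) CARD('n)) (eta CARD('m) CARD('n)) = 0"
    and S: "sapovalov os (eta CARD('m) CARD('n)) H (t :: ('m, 'n) Ugl)"
  shows "(\<Sum>J\<in>II CARD('m) CARD('n). f_elt J * scal (heval CARD('m) CARD('n) (H_poly CARD('m) CARD('n) J) l))
    = (sapovalov_eval os (eta CARD('m) CARD('n)) H l :: ('m, 'n) Ugl)"
proof -
  define m n where mn_def: "m = CARD('m)" "n = CARD('n)"
  let ?I = "II m n"
  obtain c where c: "sapovalov_eval os (eta m n) H l = (\<Sum>J\<in>?I. f_elt J * scal (c J) :: ('m, 'n) Ugl)" "c {1..m+n} = 1"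
    using sapovalov_eval_expansion[OF os S] unfolding mn_def by blast
  define d where "d J = heval m n (H_poly m n J) l" for J
  have d1: "d {1..m+n} = 1" unfolding d_def H_poly_full by (rule heval_hom)
  have sing_c: "act l (e i (Suc i) * (\<Sum>J\<in>?I. f_elt J * scal (c J)) :: ('m, 'n) Ugl) = 0"
    if "1 \<le> i" "Suc i \<le> m + n" for i
    using act_sapovalov_eval[OF S l, of i "Suc i"] that c(1) by (simp add: pos_roots_def mn_def)
  have sing_d: "act l (e i (Suc i) * (\<Sum>J\<in>?I. f_elt J * scal (d J)) :: ('m, 'n) Ugl) = 0"
    if i: "1 \<le> i" "Suc i \<le> m + n" for i
  proof -
    obtain x y where xy: "e i (Suc i) * theta = x * hembed (z_poly m n) + (y :: ('m, 'n) Ugl)" "y \<in> U_n_plus"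
      using theta_raising[of i "Suc i", where 'm = 'm and 'n = 'n] i unfolding mn_def by auto
    have "heval m n (z_poly m n) l = form m n (l + rho m n) (eta m n)"
      unfolding z_poly_def by (simp add: heval_hom heval_h_elt form_add_left)
    then have "act l (e i (Suc i) * theta :: ('m, 'n) Ugl) = smul 0 (act l x)"
      unfolding xy(1) act_simps(1) act_mult_hembed using act_U_n_plus[OF xy(2)] l by (simp add: mn_def)
    also have "\<dots> = 0" by (rule ext) (simp add: smul_def)
    finally show ?thesis
      unfolding theta_def d_def mn_def sum_distrib_left act_sum mult.assoc[symmetric] act_mult_hembed act_simps(5) .
  qed
  define u where "u J = c J - d J" for J
  have sing: "act l (e i (Suc i) * (\<Sum>J\<in>?I. f_elt J * scal (u J)) :: ('m, 'n) Ugl) = 0"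
    if "1 \<le> i" "Suc i \<le> m + n" for i
  proof -
    have "(\<Sum>J\<in>?I. f_elt J * scal (u J)) = (\<Sum>J\<in>?I. f_elt J * scal (c J)) - (\<Sum>J\<in>?I. f_elt J * scal (d J) :: ('m, 'n) Ugl)"
      by (simp add: u_def scal_diff right_diff_distrib sum_subtractf)
    then show ?thesis
      using sing_c[OF that] sing_d[OF that] by (simp add: right_diff_distrib act_simps(2))
  qed
  have "u J = 0" if "J \<in> ?I" for J
  proof (rule coefficients_vanish[OF _ _ that])
    show "u {1..m+n} = 0" unfolding u_def c(2) d1 by simp
    fix i T
    assume i: "1 \<le> i" "Suc i < m + n" and T: "T \<in> ?I" "i \<in> T" "Suc i \<in> T"
      and 0: "u T = 0" "1 < i \<Longrightarrow> u (T - {i}) = 0"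
    have "(l i - sg (i = m) * l (Suc i) + (if 1 < i then 1 else 0)) * u T
     + (if 1 < i then u (T - {i}) else 0) - (if Suc i < m + n then sg (i = m) * u (T - {Suc i}) else 0) = 0"
      unfolding mn_def
      by (rule singular_coefficients) (use sing[of i] i T in \<open>simp_all add: mn_def\<close>)
    \<comment> \<open>The other terms drop out by assumption, and the unknown is left with a sign,
      whatever the weight \<open>l\<close>.\<close>
    then have "sg (i = m) * u (T - {Suc i}) = 0" using 0 i by (cases "1 < i") simp_all
    then show "u (T - {Suc i}) = 0" by (cases "i = m") auto
  qed
  then have "c J = d J" if "J \<in> ?I" for J using that by (simp add: u_def)
  then have "(\<Sum>J\<in>?I. f_elt J * scal (d J)) = (sapovalov_eval os (eta m n) H l :: ('m, 'n) Ugl)"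
    unfolding c(1) by (intro sum.cong) auto
  then show ?thesis unfolding d_def mn_def .
qed

text \<open>Existence is included so that the claim on all Sapovalov elements is not vacuous; the
  equality for every \<open>H\<close> also contains the independence of the evaluation from the
  choice made. The order \<open>os\<close> on the positive roots is arbitrary.\<close>

theorem theorem4p9:
  fixes m n :: nat and l :: weight and os :: "(nat \<times> nat) list"
  assumes "m = CARD('m::finite)" and "n = CARD('n::finite)"
    and "distinct os" and "set os = pos_roots m n"
  shows "ncdet (m + n - 1) (Amat l :: nat \<Rightarrow> nat \<Rightarrow> ('m, 'n) Ugl)
           = (\<Sum>J \<in> II m n. f_elt J * scal (heval m n (H_poly m n J) l))
       \<and> (form m n (l + rho m n) (eta m n) = 0 \<longrightarrow>
            (\<exists>H (\<theta> :: ('m, 'n) Ugl). sapovalov os (eta m n) H \<theta>)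
          \<and> (\<forall>H (\<theta> :: ('m, 'n) Ugl). sapovalov os (eta m n) H \<theta> \<longrightarrow>
               ncdet (m + n - 1) (Amat l :: nat \<Rightarrow> nat \<Rightarrow> ('m, 'n) Ugl)
                 = sapovalov_eval os (eta m n) H l))"
proof -
  have os: "set os = pos_roots CARD('m) CARD('n)" using assms by simp
  have det: "ncdet (m + n - 1) (Amat l :: nat \<Rightarrow> nat \<Rightarrow> ('m, 'n) Ugl)
      = (\<Sum>J \<in> II m n. f_elt J * scal (heval m n (H_poly m n J) l))"
    unfolding assms(1,2) by (rule ncdet_Amat)
  show ?thesis
  proof (intro conjI impI allI)
    show "ncdet (m + n - 1) (Amat l :: nat \<Rightarrow> nat \<Rightarrow> ('m, 'n) Ugl)
      = (\<Sum>J \<in> II m n. f_elt J * scal (heval m n (H_poly m n J) l))" by (rule det)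
  next
    show "\<exists>H (\<theta> :: ('m, 'n) Ugl). sapovalov os (eta m n) H \<theta>"
      using sapovalov_exists[OF assms(3) os] unfolding assms(1,2) by blast
  next
    fix H and \<theta> :: "('m, 'n) Ugl"
    assume l: "form m n (l + rho m n) (eta m n) = 0" and S: "sapovalov os (eta m n) H \<theta>"
    show "ncdet (m + n - 1) (Amat l :: nat \<Rightarrow> nat \<Rightarrow> ('m, 'n) Ugl) = sapovalov_eval os (eta m n) H l"
      unfolding det unfolding assms(1,2)
      by (rule sapovalov_eval_eq_sum[OF assms(3) os l[unfolded assms(1,2)] S[unfolded assms(1,2)]])
  qed
qed

end
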